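(* Let $R$ be a commutative Noetherian ring, $\alpha$ an automorphism of $R$, and $S=R[\theta;\alpha]$. Suppose $S$ is primitive. (a) If $R$ has Krull dimension $0$, then $S$ satisfies $(\diamond)$. (b) Suppose $R$ contains an uncountable field, and that either $R$ has Krull dimension at least $2$ or $\mathrm{Spec}(R)$ is uncountable. Then $S$ does not satisfy $(\diamond)$.
   Context: $R[\theta;\alpha]$: skew polynomial ring with $\theta r=\alpha(r)\theta$. A ring is primitive if it has a faithful simple right module. A ring satisfies $(\diamond)$ if for every simple right module $V$, every finitely generated submodule of the injective hull $E(V)$ is Artinian. *)

theory Defs
  imports "HOL-Algebra.Ring_Divisibility" "HOL-Algebra.QuotRing" "HOL-Algebra.Subrings" "HOL-Library.Countable_Set"
begin

text \<open>Elements are finitely supported coefficient sequences; f represents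
  sum_i (f i) theta^i. Multiplication follows theta r = alpha(r) theta, i.e.
  (a theta^i)(b theta^j) = a alpha^i(b) theta^(i+j).\<close>

definition skew_poly_ring :: "('a, 'b) ring_scheme \<Rightarrow> ('a \<Rightarrow> 'a) \<Rightarrow> (nat \<Rightarrow> 'a) ring" where
  "skew_poly_ring R \<alpha> =
    \<lparr> carrier = {f. (\<forall>n. f n \<in> carrier R) \<and> finite {n. f n \<noteq> \<zero>\<^bsub>R\<^esub>}},
      mult = (\<lambda>f g n. finsum R (\<lambda>i. f i \<otimes>\<^bsub>R\<^esub> (\<alpha> ^^ i) (g (n - i))) {..n}),
      one = (\<lambda>n. if n = 0 then \<one>\<^bsub>R\<^esub> else \<zero>\<^bsub>R\<^esub>),
      zero = (\<lambda>n. \<zero>\<^bsub>R\<^esub>),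
      add = (\<lambda>f g n. f n \<oplus>\<^bsub>R\<^esub> g n) \<rparr>"

record ('s, 'm) rmod =
  mcarrier :: "'m set"
  madd :: "'m \<Rightarrow> 'm \<Rightarrow> 'm"
  mzero :: "'m"
  mact :: "'m \<Rightarrow> 's \<Rightarrow> 'm"

definition rmodule :: "('s, 'b) ring_scheme \<Rightarrow> ('s, 'm) rmod \<Rightarrow> bool" where
  "rmodule S M \<longleftrightarrow> ring S \<and>
    mzero M \<in> mcarrier M \<and>
    (\<forall>x \<in> mcarrier M. \<forall>y \<in> mcarrier M. madd M x y \<in> mcarrier M) \<and>
    (\<forall>x \<in> mcarrier M. \<forall>y \<in> mcarrier M. \<forall>z \<in> mcarrier M.
        madd M (madd M x y) z = madd M x (madd M y z)) \<and>
    (\<forall>x \<in> mcarrier M. \<forall>y \<in> mcarrier M. madd M x y = madd M y x) \<and>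
    (\<forall>x \<in> mcarrier M. madd M (mzero M) x = x) \<and>
    (\<forall>x \<in> mcarrier M. \<exists>y \<in> mcarrier M. madd M x y = mzero M) \<and>
    (\<forall>x \<in> mcarrier M. \<forall>s \<in> carrier S. mact M x s \<in> mcarrier M) \<and>
    (\<forall>x \<in> mcarrier M. \<forall>s \<in> carrier S. \<forall>t \<in> carrier S.
        mact M x (s \<oplus>\<^bsub>S\<^esub> t) = madd M (mact M x s) (mact M x t)) \<and>
    (\<forall>x \<in> mcarrier M. \<forall>y \<in> mcarrier M. \<forall>s \<in> carrier S.
        mact M (madd M x y) s = madd M (mact M x s) (mact M y s)) \<and>
    (\<forall>x \<in> mcarrier M. \<forall>s \<in> carrier S. \<forall>t \<in> carrier S.
        mact M x (s \<otimes>\<^bsub>S\<^esub> t) = mact M (mact M x s) t) \<and>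
    (\<forall>x \<in> mcarrier M. mact M x \<one>\<^bsub>S\<^esub> = x)"

definition submod :: "('s, 'b) ring_scheme \<Rightarrow> ('s, 'm) rmod \<Rightarrow> 'm set \<Rightarrow> bool" where
  "submod S M N \<longleftrightarrow> N \<subseteq> mcarrier M \<and> mzero M \<in> N \<and>
    (\<forall>x \<in> N. \<forall>y \<in> N. madd M x y \<in> N) \<and>
    (\<forall>x \<in> N. \<forall>s \<in> carrier S. mact M x s \<in> N)"

definition simple_submod :: "('s, 'b) ring_scheme \<Rightarrow> ('s, 'm) rmod \<Rightarrow> 'm set \<Rightarrow> bool" where
  "simple_submod S M N \<longleftrightarrow> submod S M N \<and> N \<noteq> {mzero M} \<and>
    (\<forall>L. submod S M L \<and> L \<subseteq> N \<longrightarrow> L = {mzero M} \<or> L = N)"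

definition simple_module :: "('s, 'b) ring_scheme \<Rightarrow> ('s, 'm) rmod \<Rightarrow> bool" where
  "simple_module S M \<longleftrightarrow> rmodule S M \<and> simple_submod S M (mcarrier M)"

definition faithful :: "('s, 'b) ring_scheme \<Rightarrow> ('s, 'm) rmod \<Rightarrow> bool" where
  "faithful S M \<longleftrightarrow> (\<forall>s \<in> carrier S. (\<forall>x \<in> mcarrier M. mact M x s = mzero M) \<longrightarrow> s = \<zero>\<^bsub>S\<^esub>)"

text \<open>The theorem's hypothesis "S is primitive" (exists a faithful simple right
  module) is stated via a universally quantified module W in the assumptions.\<close>

definition fin_gen_submod :: "('s, 'b) ring_scheme \<Rightarrow> ('s, 'm) rmod \<Rightarrow> 'm set \<Rightarrow> bool" where
  "fin_gen_submod S M N \<longleftrightarrow> submod S M N \<and>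
    (\<exists>A. finite A \<and> A \<subseteq> N \<and> (\<forall>L. submod S M L \<and> A \<subseteq> L \<longrightarrow> N \<subseteq> L))"

definition artinian_submod :: "('s, 'b) ring_scheme \<Rightarrow> ('s, 'm) rmod \<Rightarrow> 'm set \<Rightarrow> bool" where
  "artinian_submod S M N \<longleftrightarrow>
    \<not> (\<exists>C :: nat \<Rightarrow> 'm set. \<forall>i. submod S M (C i) \<and> C i \<subseteq> N \<and> C (Suc i) \<subset> C i)"

definition essential_submod :: "('s, 'b) ring_scheme \<Rightarrow> ('s, 'm) rmod \<Rightarrow> 'm set \<Rightarrow> bool" where
  "essential_submod S M V \<longleftrightarrow> submod S M V \<and>
    (\<forall>L. submod S M L \<and> L \<noteq> {mzero M} \<longrightarrow> L \<inter> V \<noteq> {mzero M})"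

definition right_ideal :: "('s, 'b) ring_scheme \<Rightarrow> 's set \<Rightarrow> bool" where
  "right_ideal S I \<longleftrightarrow> I \<subseteq> carrier S \<and> \<zero>\<^bsub>S\<^esub> \<in> I \<and>
    (\<forall>a \<in> I. \<forall>b \<in> I. a \<oplus>\<^bsub>S\<^esub> b \<in> I) \<and>
    (\<forall>a \<in> I. \<forall>s \<in> carrier S. a \<otimes>\<^bsub>S\<^esub> s \<in> I)"

text \<open>Injectivity via Baer's criterion: every S-linear map from a right ideal
  of S into M extends to S (i.e. is left multiplication by an element of M).\<close>
definition injective_module :: "('s, 'b) ring_scheme \<Rightarrow> ('s, 'm) rmod \<Rightarrow> bool" where
  "injective_module S M \<longleftrightarrow> rmodule S M \<and>
    (\<forall>I f. right_ideal S I \<and> f \<in> I \<rightarrow> mcarrier M \<and>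
        (\<forall>a \<in> I. \<forall>b \<in> I. f (a \<oplus>\<^bsub>S\<^esub> b) = madd M (f a) (f b)) \<and>
        (\<forall>a \<in> I. \<forall>s \<in> carrier S. f (a \<otimes>\<^bsub>S\<^esub> s) = mact M (f a) s)
      \<longrightarrow> (\<exists>e \<in> mcarrier M. \<forall>a \<in> I. f a = mact M e a))"

text \<open>Property (diamond), for modules with carrier type 'm: whenever E is an
  injective hull of a simple module V (E injective, V a simple essential
  submodule of E), every finitely generated submodule of E is Artinian.\<close>
definition diamond :: "('s, 'b) ring_scheme \<Rightarrow> 'm itself \<Rightarrow> bool" where
  "diamond S T \<longleftrightarrow> (\<forall>(E :: ('s, 'm) rmod) V N.
     injective_module S E \<and> simple_submod S E V \<and> essential_submod S E V \<and>
     fin_gen_submod S E N \<longrightarrow> artinian_submod S E N)"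

definition krull_dim_ge :: "('a, 'b) ring_scheme \<Rightarrow> nat \<Rightarrow> bool" where
  "krull_dim_ge R n \<longleftrightarrow> (\<exists>P :: nat \<Rightarrow> 'a set.
     (\<forall>i \<le> n. primeideal (P i) R) \<and> (\<forall>i < n. P i \<subset> P (Suc i)))"

definition krull_dim_zero :: "('a, 'b) ring_scheme \<Rightarrow> bool" where
  "krull_dim_zero R \<longleftrightarrow> krull_dim_ge R 0 \<and> \<not> krull_dim_ge R 1"

end

theory Submission
  imports Defs
begin

text \<open>Let \<open>W\<close> be the given faithful simple module, \<open>w \<in> W\<close> with prime annihilator \<open>P\<^sub>0\<close>, and
  \<open>P\<^sub>i\<close> the annihilator of \<open>w \<theta>\<^sup>i\<close>. Finitely many \<open>P\<^sub>i\<close> already intersect in zero, so they are a finite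
  \<open>\<alpha>\<close>-orbit consisting of the minimal primes of \<open>R\<close>.

  In dimension zero, let \<open>x\<close> lie in the injective hull of a simple module. If the leading
  coefficients of the annihilator of \<open>x\<close> were contained in a prime \<open>Q\<close>, then some \<open>e \<notin> Q\<close> would
  kill them, and \<open>x e S\<close> would be isomorphic to \<open>e S\<close>. But \<open>x e S\<close> meets the simple module, in which
  some nonzero \<open>v\<close> satisfies \<open>v = v \<theta> t\<close>, and lowest terms rule this out in \<open>e S\<close>. So the annihilator
  contains a monic element, \<open>x S\<close> is finitely generated over \<open>R\<close>, and \<open>R\<close> is Artinian.

  For the second part, \<open>w \<theta>\<^sup>N a\<close> lies in the span of the \<open>w \<theta>\<^sup>i\<close> with \<open>i < N\<close> for some \<open>a\<close> outside
  all \<open>P\<^sub>i\<close>. Countable prime avoidance and Krull's principal ideal theorem give a nonminimal prime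
  \<open>Q\<close> containing no \<open>\<alpha>\<^sup>-\<^sup>n a\<close>. Nakayama's lemma shows that \<open>W\<close> is not divisible by a regular
  \<open>c \<in> Q\<close> locally at \<open>Q\<close>, and that no prime between \<open>c\<close> and \<open>Q\<close> is \<open>\<alpha>\<close>-periodic. Dividing an element
  of \<open>W\<close> by \<open>c\<close> in the hull yields \<open>y\<close> whose annihilator modulo \<open>W\<close> is such a prime, and then the
  submodules \<open>y \<theta>\<^sup>n S\<close> strictly decrease.\<close>

subsection \<open>Noetherian commutative rings\<close>

text \<open>The property concerns modules on one fixed carrier type, so its failure needs an
  injective hull built inside that type. The hull is cut out of the module of
  \<open>K\<close>-linear functionals on \<open>S\<close>, with \<open>K\<close> the given field;
  functionals extend by linear algebra, which replaces the general theory of injective modules. Its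
  elements are then encoded as sets of sequences.

  Uncountability of \<open>K\<close> enters through one fact: an ideal covered by countably many
  ideals lies in one of them. Without a relation for some \<open>w \<theta>\<^sup>N\<close>, each
  ideal of possible leading coefficients is covered by the countable orbit of minimal primes, hence
  kills its \<open>w \<theta>\<^sup>n\<close>, and \<open>w\<close> could not lie in
  \<open>w \<theta> S\<close>.

  The obstacle is that \<open>W\<close> need not be finitely generated over \<open>R\<close>.
  Avoiding every \<open>\<beta>\<^sup>n a\<close>, with \<beta> the inverse of \<alpha>, makes
  \<open>W\<close> finitely generated locally at \<open>Q\<close>, so that Nakayama's lemma applies.
  Localisations are never formed: statements carry a multiplier outside the prime instead.\<close>

locale noetherian_cring = cring R + noetherian_ring R for R (structure)
begin

lemma ideal_iff:
  "ideal I R \<longleftrightarrow> I \<subseteq> carrier R \<and> \<zero> \<in> I \<and> (\<forall>a\<in>I. \<forall>b\<in>I. a \<oplus> b \<in> I) \<and>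
     (\<forall>r\<in>carrier R. \<forall>a\<in>I. r \<otimes> a \<in> I)" (is "?L \<longleftrightarrow> ?R")
proof
  assume ?L
  then interpret ideal I R .
  show ?R using a_subset zero_closed I_l_closed a_closed by auto
next
  assume R: ?R
  have sub: "I \<subseteq> carrier R" using R by blast
  have inv: "\<ominus> a \<in> I" if "a \<in> I" for a
  proof -
    have "\<ominus> a = (\<ominus> \<one>) \<otimes> a" using that sub by (simp add: l_minus subset_iff)
    then show ?thesis using R that by auto
  qed
  have "subgroup I (add_monoid R)"
    using R inv by (intro add.subgroupI) (auto simp: a_inv_def)
  moreover have "a \<otimes> x \<in> I" if "a \<in> I" "x \<in> carrier R" for a x
    using R that sub m_comm[of a x] by auto
  ultimately show ?L
    using R sub by (intro idealI) (auto simp: ring_axioms)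
qed

text \<open>A nonempty chain of ideals in a Noetherian ring contains its own union, so Zorn's lemma
  applies inside an arbitrary family of ideals. The seed \<open>I0\<close> gives control from below;
  later it keeps \<open>c\<close> inside a maximal annihilator.\<close>

lemma exists_maximal_ideal_in:
  assumes "I0 \<in> F" "\<And>I. I \<in> F \<Longrightarrow> ideal I R"
  shows "\<exists>M\<in>F. I0 \<subseteq> M \<and> (\<forall>J\<in>F. M \<subseteq> J \<longrightarrow> J = M)"
proof -
  let ?A = "{I \<in> F. I0 \<subseteq> I}"
  have "\<exists>M\<in>?A. \<forall>X\<in>?A. M \<subseteq> X \<longrightarrow> X = M"
  proof (rule subset_Zorn_nonempty)
    show "?A \<noteq> {}" using assms by blast
  next
    fix C assume C: "C \<noteq> {}" "subset.chain ?A C"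
    then have "subset.chain {I. ideal I R} C"
      using assms(2) by (auto simp: subset.chain_def)
    then have "\<Union>C \<in> C" using ideal_chain_is_trivial C(1) by blast
    then show "\<Union>C \<in> ?A" using C(2) by (auto simp: subset.chain_def)
  qed
  then show ?thesis by (metis (no_types, lifting) mem_Collect_eq order_trans)
qed

lemma ideal_ascending_chain:
  assumes "\<And>n::nat. ideal (I n) R" "\<And>n. I n \<subseteq> I (Suc n)"
  shows "\<exists>n. \<forall>k\<ge>n. I k = I n"
proof -
  obtain M where M: "M \<in> range I" "\<forall>J\<in>range I. M \<subseteq> J \<longrightarrow> J = M"
    using exists_maximal_ideal_in[of "I 0" "range I"] assms(1) by blast
  then obtain n where "M = I n" by blast
  then show ?thesis using M(2) lift_Suc_mono_le[of I n] assms(2) by (intro exI[of _ n]) auto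
qed

lemma ideal_list_generators:
  assumes "ideal I R"
  shows "\<exists>xs. set xs \<subseteq> I \<and> (\<forall>J. ideal J R \<longrightarrow> set xs \<subseteq> J \<longrightarrow> I \<subseteq> J)"
proof -
  obtain A where A: "A \<subseteq> carrier R" "finite A" "I = Idl A" using finetely_gen[OF assms] by blast
  obtain xs where xs: "set xs = A" using finite_list[OF A(2)] by blast
  have "set xs \<subseteq> I" using xs A genideal_self by blast
  moreover have "I \<subseteq> J" if "ideal J R" "set xs \<subseteq> J" for J
    using genideal_minimal[OF that(1)] that(2) xs A(3) by blast
  ultimately show ?thesis by blast
qed

text \<open>A maximal counterexample has only good ideals strictly above it. Together with
  \<open>not_prime_witness\<close> this reduces claims about ideals to prime ideals.\<close>

lemma noetherian_induct [consumes 1, case_names step]: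
  assumes "ideal J R"
    and "\<And>J. ideal J R \<Longrightarrow> (\<And>J'. ideal J' R \<Longrightarrow> J \<subset> J' \<Longrightarrow> Q J') \<Longrightarrow> Q J"
  shows "Q J"
proof (rule ccontr)
  assume "\<not> Q J"
  then obtain M where M: "M \<in> {I. ideal I R \<and> \<not> Q I}"
    "\<forall>I\<in>{I. ideal I R \<and> \<not> Q I}. M \<subseteq> I \<longrightarrow> I = M"
    using exists_maximal_ideal_in[of J "{I. ideal I R \<and> \<not> Q I}"] assms(1) by blast
  have "Q M"
  proof (rule assms(2))
    show "ideal M R" using M(1) by blast
    show "Q J'" if "ideal J' R" "M \<subset> J'" for J' using M(2) that by blast
  qed
  with M(1) show False by blast
qed

lemma not_prime_witness:
  assumes "ideal J R" "\<not> primeideal J R" "J \<noteq> carrier R"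
  obtains a b where "a \<in> carrier R" "b \<in> carrier R" "a \<notin> J" "b \<notin> J" "a \<otimes> b \<in> J"
  using assms primeidealI[OF assms(1)] is_cring by metis

lemma primeD:
  assumes "primeideal P R"
  shows "ideal P R" "P \<subseteq> carrier R" "\<one> \<notin> P"
    "\<And>a b. a \<in> carrier R \<Longrightarrow> b \<in> carrier R \<Longrightarrow> a \<otimes> b \<in> P \<Longrightarrow> a \<in> P \<or> b \<in> P"
proof -
  interpret primeideal P R by fact
  show "ideal P R" by unfold_locales
  show "P \<subseteq> carrier R" using a_subset .
  show "\<one> \<notin> P" using one_imp_carrier I_notcarr by blast
  show "\<And>a b. a \<in> carrier R \<Longrightarrow> b \<in> carrier R \<Longrightarrow> a \<otimes> b \<in> P \<Longrightarrow> a \<in> P \<or> b \<in> P"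
    using I_prime by blast
qed

lemma idealD:
  assumes "ideal I R"
  shows "I \<subseteq> carrier R" "\<zero> \<in> I" "\<And>a b. a \<in> I \<Longrightarrow> b \<in> I \<Longrightarrow> a \<oplus> b \<in> I"
    "\<And>a r. a \<in> I \<Longrightarrow> r \<in> carrier R \<Longrightarrow> r \<otimes> a \<in> I"
    "\<And>a r. a \<in> I \<Longrightarrow> r \<in> carrier R \<Longrightarrow> a \<otimes> r \<in> I"
    "\<And>a b. a \<in> I \<Longrightarrow> b \<in> I \<Longrightarrow> a \<ominus> b \<in> I"
proof -
  interpret ideal I R by fact
  show "I \<subseteq> carrier R" "\<zero> \<in> I" "\<And>a b. a \<in> I \<Longrightarrow> b \<in> I \<Longrightarrow> a \<oplus> b \<in> I"
    "\<And>a r. a \<in> I \<Longrightarrow> r \<in> carrier R \<Longrightarrow> r \<otimes> a \<in> I"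
    "\<And>a r. a \<in> I \<Longrightarrow> r \<in> carrier R \<Longrightarrow> a \<otimes> r \<in> I"
    using a_subset I_l_closed I_r_closed a_closed by auto
  show "\<And>a b. a \<in> I \<Longrightarrow> b \<in> I \<Longrightarrow> a \<ominus> b \<in> I"
    by (simp add: a_closed a_minus_def a_inv_closed)
qed

text \<open>These are \<open>J + aR\<close> and, below, \<open>(J : a)\<close>. If \<open>ab\<close>
  lies in \<open>J\<close> but neither factor does, both are strictly larger than \<open>J\<close>,
  and \<open>(J + aR)/J\<close> is isomorphic to \<open>R/(J : a)\<close>, so \<open>R/J\<close> is
  an extension of two smaller cases.\<close>

definition adjoin :: "'a set \<Rightarrow> 'a \<Rightarrow> 'a set" where
  "adjoin J a = {x \<oplus> a \<otimes> r | x r. x \<in> J \<and> r \<in> carrier R}"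

definition colon :: "'a set \<Rightarrow> 'a \<Rightarrow> 'a set" where
  "colon J a = {r \<in> carrier R. a \<otimes> r \<in> J}"

lemma adjoin_ideal:
  assumes J: "ideal J R" and a: "a \<in> carrier R"
  shows "ideal (adjoin J a) R" "J \<subseteq> adjoin J a" "a \<in> adjoin J a"
proof -
  note D = idealD[OF J]
  show "J \<subseteq> adjoin J a"
  proof
    fix x assume "x \<in> J"
    then have "x = x \<oplus> a \<otimes> \<zero>" "x \<in> J" using D(1) a by auto
    then show "x \<in> adjoin J a" unfolding adjoin_def by blast
  qed
  have "a = \<zero> \<oplus> a \<otimes> \<one>" using a by simp
  then show "a \<in> adjoin J a" unfolding adjoin_def using D(2) by blast
  show "ideal (adjoin J a) R"
    unfolding ideal_iff
  proof (intro conjI ballI)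
    show "adjoin J a \<subseteq> carrier R" unfolding adjoin_def using D(1) a by auto
    show "\<zero> \<in> adjoin J a" using \<open>J \<subseteq> adjoin J a\<close> D(2) by blast
  next
    fix u v assume "u \<in> adjoin J a" "v \<in> adjoin J a"
    then obtain x r y s where *: "x \<in> J" "r \<in> carrier R" "u = x \<oplus> a \<otimes> r"
      "y \<in> J" "s \<in> carrier R" "v = y \<oplus> a \<otimes> s" unfolding adjoin_def by blast
    have "x \<in> carrier R" "y \<in> carrier R" using * D(1) by auto
    then have "u \<oplus> v = (x \<oplus> y) \<oplus> a \<otimes> (r \<oplus> s)" using * a by algebra
    then show "u \<oplus> v \<in> adjoin J a" unfolding adjoin_def using * D(3) by blast
  next
    fix c u assume c: "c \<in> carrier R" and "u \<in> adjoin J a"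
    then obtain x r where *: "x \<in> J" "r \<in> carrier R" "u = x \<oplus> a \<otimes> r"
      unfolding adjoin_def by blast
    have "x \<in> carrier R" using * D(1) by auto
    then have "c \<otimes> u = c \<otimes> x \<oplus> a \<otimes> (c \<otimes> r)" using * a c by algebra
    then show "c \<otimes> u \<in> adjoin J a" unfolding adjoin_def using * c D(4) by blast
  qed
qed

lemma colon_ideal:
  assumes J: "ideal J R" and a: "a \<in> carrier R"
  shows "ideal (colon J a) R" "J \<subseteq> colon J a"
proof -
  note D = idealD[OF J]
  show "J \<subseteq> colon J a" unfolding colon_def using D a by auto
  show "ideal (colon J a) R"
    unfolding ideal_iff colon_def using D a
    by (auto simp: r_distr m_lcomm)
qed

text \<open>Stabilisation of a descending chain of ideals up to multiplication by elements of a set.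
  With the set \<open>{\<one>}\<close> this is the descending chain condition, with the complement of a prime
  it is the descending chain condition in the localisation.\<close>

definition dcc_mod :: "'a set \<Rightarrow> 'a set \<Rightarrow> bool" where
  "dcc_mod T J \<longleftrightarrow> (\<forall>I :: nat \<Rightarrow> 'a set.
     (\<forall>n. ideal (I n) R \<and> J \<subseteq> I n \<and> I (Suc n) \<subseteq> I n) \<longrightarrow>
     (\<exists>n. \<forall>k\<ge>n. \<forall>x\<in>I n. \<exists>t\<in>T. t \<otimes> x \<in> I k))"

text \<open>For \<open>ab\<close> in \<open>J\<close>, a chain over \<open>J\<close> is controlled
  by its sums with \<open>aR\<close> and its colons by \<open>a\<close>. The sums give
  \<open>t x = y + a r\<close> with \<open>y\<close> already in the small ideal; then
  \<open>a r\<close> is in the large one, and the colons move \<open>r\<close> down after a second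
  multiplier \<open>s\<close>. The product \<open>s t\<close> works for \<open>x\<close>.\<close>

lemma dcc_mod_of_primes:
  assumes T: "\<one> \<in> T" "T \<subseteq> carrier R" "\<And>s t. s \<in> T \<Longrightarrow> t \<in> T \<Longrightarrow> s \<otimes> t \<in> T"
    and J: "ideal J R"
    and primes: "\<And>Q. primeideal Q R \<Longrightarrow> J \<subseteq> Q \<Longrightarrow> dcc_mod T Q"
  shows "dcc_mod T J"
  using J primes
proof (induction J rule: noetherian_induct)
  case (step J)
  have IH: "dcc_mod T J'" if "ideal J' R" "J \<subset> J'" for J'
    using step(2)[OF that] step(3) that by blast
  show ?case
  proof (cases "primeideal J R \<or> J = carrier R")
    case True
    then show ?thesis
    proof
      assume "J = carrier R"
      have "\<exists>t\<in>T. t \<otimes> x \<in> I k" if "\<forall>n. ideal (I n) R \<and> J \<subseteq> I n \<and> I (Suc n) \<subseteq> I n" "x \<in> I n"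
        for I :: "nat \<Rightarrow> 'a set" and x n k
      proof -
        have "x \<in> carrier R" using that idealD(1) by blast
        then show ?thesis using that T(1) \<open>J = carrier R\<close> by (intro bexI[of _ \<one>]) auto
      qed
      then show ?thesis unfolding dcc_mod_def by blast
    qed (use step(3) in blast)
  next
    case False
    then obtain a b where ab: "a \<in> carrier R" "b \<in> carrier R" "a \<notin> J" "b \<notin> J" "a \<otimes> b \<in> J"
      using not_prime_witness step(1) by blast
    note A = adjoin_ideal[OF step(1) ab(1)] and C = colon_ideal[OF step(1) ab(1)]
    have dA: "dcc_mod T (adjoin J a)" using IH A ab by blast
    have "b \<in> colon J a" using ab unfolding colon_def by auto
    then have dC: "dcc_mod T (colon J a)" using IH C ab by blast
    show ?thesis unfolding dcc_mod_def
    proof (intro allI impI)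
      fix I :: "nat \<Rightarrow> 'a set"
      assume I: "\<forall>n. ideal (I n) R \<and> J \<subseteq> I n \<and> I (Suc n) \<subseteq> I n"
      have dec: "I k \<subseteq> I n" if "n \<le> k" for n k
        using lift_Suc_antimono_le[of I] I that by blast
      have "\<forall>n. ideal (adjoin (I n) a) R \<and> adjoin J a \<subseteq> adjoin (I n) a \<and> adjoin (I (Suc n)) a \<subseteq> adjoin (I n) a"
        using I adjoin_ideal(1) ab(1) unfolding adjoin_def by blast
      then obtain n where n: "\<forall>k\<ge>n. \<forall>x\<in>adjoin (I n) a. \<exists>t\<in>T. t \<otimes> x \<in> adjoin (I k) a"
        using spec[OF dA[unfolded dcc_mod_def], of "\<lambda>n. adjoin (I n) a"] by blast
      have "\<forall>n. ideal (colon (I n) a) R \<and> colon J a \<subseteq> colon (I n) a \<and> colon (I (Suc n)) a \<subseteq> colon (I n) a"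
        using I colon_ideal(1) ab(1) unfolding colon_def by blast
      then obtain m where m: "\<forall>k\<ge>m. \<forall>x\<in>colon (I m) a. \<exists>t\<in>T. t \<otimes> x \<in> colon (I k) a"
        using spec[OF dC[unfolded dcc_mod_def], of "\<lambda>n. colon (I n) a"] by blast
      show "\<exists>n. \<forall>k\<ge>n. \<forall>x\<in>I n. \<exists>t\<in>T. t \<otimes> x \<in> I k"
      proof (intro exI allI impI ballI)
        fix k x assume k: "max n m \<le> k" and x: "x \<in> I (max n m)"
        have Ik: "ideal (I k) R" "ideal (I (max n m)) R" using I by auto
        have xc: "x \<in> carrier R" using x Ik idealD(1) by blast
        have "x \<in> adjoin (I n) a" using x dec[of n "max n m"] adjoin_ideal(2) I ab by fastforce
        then obtain t where t: "t \<in> T" "t \<otimes> x \<in> adjoin (I k) a" using n k by auto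
        then obtain y r where yr: "y \<in> I k" "r \<in> carrier R" "t \<otimes> x = y \<oplus> a \<otimes> r"
          unfolding adjoin_def by blast
        have cc: "y \<in> carrier R" "t \<in> carrier R" using yr Ik idealD(1) t T by blast+
        have "a \<otimes> r = t \<otimes> x \<ominus> y" using cc yr xc ab by algebra
        moreover have "t \<otimes> x \<ominus> y \<in> I (max n m)"
          using x yr(1) dec[OF k] cc by (simp add: idealD(4,6)[OF Ik(2)] subset_iff)
        ultimately have "r \<in> colon (I m) a" using yr dec[of m "max n m"] unfolding colon_def by auto
        then obtain s where s: "s \<in> T" "s \<otimes> r \<in> colon (I k) a" using m k by auto
        then have sr: "a \<otimes> (s \<otimes> r) \<in> I k" unfolding colon_def by blast
        have sc: "s \<in> carrier R" using s T by blast
        have "(s \<otimes> t) \<otimes> x = s \<otimes> y \<oplus> a \<otimes> (s \<otimes> r)"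
        proof -
          have "(s \<otimes> t) \<otimes> x = s \<otimes> (t \<otimes> x)" using sc cc xc by (simp add: m_assoc)
          then show ?thesis unfolding yr(3) using sc cc yr(2) ab by algebra
        qed
        then have "(s \<otimes> t) \<otimes> x \<in> I k" using idealD[OF Ik(1)] yr(1) sr sc by simp
        then show "\<exists>t\<in>T. t \<otimes> x \<in> I k" using T s t by blast
      qed
    qed
  qed
qed

section \<open>Minimal primes over an ideal\<close>

definition minimal_prime_over :: "'a set \<Rightarrow> 'a set \<Rightarrow> bool" where
  "minimal_prime_over J P \<longleftrightarrow> primeideal P R \<and> J \<subseteq> P \<and>
     (\<forall>P'. primeideal P' R \<longrightarrow> J \<subseteq> P' \<longrightarrow> P' \<subseteq> P \<longrightarrow> P' = P)"

text \<open>If \<open>ab\<close> lies in \<open>J\<close>, a prime over \<open>J\<close> contains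
  \<open>a\<close> or \<open>b\<close>, so the families for \<open>J + aR\<close> and
  \<open>J + bR\<close> together serve for \<open>J\<close>. The minimal primes are picked out of
  this family afterwards.\<close>

lemma finite_primes_below:
  assumes "ideal J R"
  shows "\<exists>F. finite F \<and> (\<forall>P\<in>F. primeideal P R \<and> J \<subseteq> P) \<and>
    (\<forall>Q. primeideal Q R \<and> J \<subseteq> Q \<longrightarrow> (\<exists>P\<in>F. P \<subseteq> Q))"
  using assms
proof (induction J rule: noetherian_induct)
  case (step J)
  show ?case
  proof (cases "primeideal J R \<or> J = carrier R")
    case True
    then show ?thesis
    proof
      assume "primeideal J R"
      then show ?thesis by (intro exI[of _ "{J}"]) auto
    next
      assume "J = carrier R"
      then show ?thesis using primeD(2,3) by (intro exI[of _ "{}"]) fastforce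
    qed
  next
    case False
    then obtain a b where ab: "a \<in> carrier R" "b \<in> carrier R" "a \<notin> J" "b \<notin> J" "a \<otimes> b \<in> J"
      using not_prime_witness step(1) by blast
    note A = adjoin_ideal[OF step(1) ab(1)] and B = adjoin_ideal[OF step(1) ab(2)]
    obtain F where F: "finite F" "\<forall>P\<in>F. primeideal P R \<and> adjoin J a \<subseteq> P"
      "\<forall>Q. primeideal Q R \<and> adjoin J a \<subseteq> Q \<longrightarrow> (\<exists>P\<in>F. P \<subseteq> Q)"
      using step(2)[of "adjoin J a"] A ab by blast
    obtain G where G: "finite G" "\<forall>P\<in>G. primeideal P R \<and> adjoin J b \<subseteq> P"
      "\<forall>Q. primeideal Q R \<and> adjoin J b \<subseteq> Q \<longrightarrow> (\<exists>P\<in>G. P \<subseteq> Q)"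
      using step(2)[of "adjoin J b"] B ab by blast
    have sub: "adjoin J c \<subseteq> Q" if "ideal Q R" "J \<subseteq> Q" "c \<in> Q" for Q c
      using that unfolding adjoin_def by (auto intro!: idealD(3,5)[OF that(1)])
    have "\<exists>P\<in>F \<union> G. P \<subseteq> Q" if "primeideal Q R" "J \<subseteq> Q" for Q
    proof -
      have "a \<in> Q \<or> b \<in> Q" using primeD(4)[OF that(1)] ab that(2) by blast
      then have "adjoin J a \<subseteq> Q \<or> adjoin J b \<subseteq> Q"
        using sub[OF primeD(1)[OF that(1)] that(2)] by metis
      then have "(\<exists>P\<in>F. P \<subseteq> Q) \<or> (\<exists>P\<in>G. P \<subseteq> Q)" using F(3) G(3) that(1) by metis
      then show ?thesis by blast
    qed
    moreover have "finite (F \<union> G)" "\<forall>P\<in>F \<union> G. primeideal P R \<and> J \<subseteq> P"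
      using F(1,2) G(1,2) A(2) B(2) by (simp, blast)
    ultimately show ?thesis by blast
  qed
qed

lemma minimal_primes:
  assumes J: "ideal J R"
  shows "finite {P. minimal_prime_over J P}"
    and "primeideal Q R \<Longrightarrow> J \<subseteq> Q \<Longrightarrow> \<exists>P. minimal_prime_over J P \<and> P \<subseteq> Q"
proof -
  obtain F where F: "finite F" "\<forall>P\<in>F. primeideal P R \<and> J \<subseteq> P"
      "\<forall>Q. primeideal Q R \<and> J \<subseteq> Q \<longrightarrow> (\<exists>P\<in>F. P \<subseteq> Q)"
    using finite_primes_below[OF J] by blast
  have "{P. minimal_prime_over J P} \<subseteq> F"
  proof
    fix P assume "P \<in> {P. minimal_prime_over J P}"
    then have P: "primeideal P R" "J \<subseteq> P"
       "\<forall>P'. primeideal P' R \<longrightarrow> J \<subseteq> P' \<longrightarrow> P' \<subseteq> P \<longrightarrow> P' = P"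
      unfolding minimal_prime_over_def by auto
    obtain G where "G \<in> F" "G \<subseteq> P" using F(3) P by blast
    then show "P \<in> F" using F(2) P(3) by blast
  qed
  then show "finite {P. minimal_prime_over J P}" using F(1) finite_subset by blast
  assume Q: "primeideal Q R" "J \<subseteq> Q"
  have "finite {P\<in>F. P \<subseteq> Q}" "{P\<in>F. P \<subseteq> Q} \<noteq> {}" using F Q by auto
  then obtain M where M: "M \<in> {P\<in>F. P \<subseteq> Q}" "\<forall>P\<in>{P\<in>F. P \<subseteq> Q}. P \<subseteq> M \<longrightarrow> M = P"
    using finite_has_minimal[of "{P\<in>F. P \<subseteq> Q}"] by blast
  have "minimal_prime_over J M"
    unfolding minimal_prime_over_def
  proof (intro conjI allI impI)
    fix P' assume P': "primeideal P' R" "J \<subseteq> P'" "P' \<subseteq> M"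
    then obtain G where "G \<in> F" "G \<subseteq> P'" using F(3) by blast
    then show "P' = M" using M P'(3) by blast
  qed (use M F in auto)
  then show "\<exists>P. minimal_prime_over J P \<and> P \<subseteq> Q" using M by blast
qed

text \<open>On an uncountable line \<open>z + t x\<close>, \<open>t\<close> in \<open>K\<close>, two
  points fall into the same ideal. Their difference is a unit multiple of \<open>x\<close>, so that
  ideal contains \<open>x\<close> and then \<open>z\<close>.\<close>

lemma countable_avoidance:
  assumes K: "subfield K R" "uncountable K"
    and I: "ideal I R" and C: "countable \<C>" "\<And>J. J \<in> \<C> \<Longrightarrow> ideal J R"
    and cov: "I \<subseteq> \<Union>\<C>"
  shows "\<exists>J\<in>\<C>. I \<subseteq> J"
proof -
  \<comment> \<open>The free element \<open>z\<close> makes the claim inductive: for generators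
    \<open>x # xs\<close> the hypothesis is applied to every point of the line through
    \<open>z\<close> in direction \<open>x\<close>.\<close>
  have "\<exists>J\<in>\<C>. z \<in> J \<and> set xs \<subseteq> J" if "z \<in> I" "set xs \<subseteq> I" for z xs
    using that
  proof (induction xs arbitrary: z)
    case Nil
    then show ?case using cov by auto
  next
    case (Cons x xs)
    have KR: "K \<subseteq> carrier R" using subfieldE(3)[OF K(1)] .
    have xz: "x \<in> I" "z \<in> I" "x \<in> carrier R" "z \<in> carrier R" using Cons idealD(1)[OF I] by auto
    have "\<forall>t\<in>K. \<exists>J\<in>\<C>. z \<oplus> t \<otimes> x \<in> J \<and> set xs \<subseteq> J"
    proof
      fix t assume "t \<in> K"
      then have "z \<oplus> t \<otimes> x \<in> I" using xz KR by (simp add: subset_iff idealD(3,4)[OF I])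
      then show "\<exists>J\<in>\<C>. z \<oplus> t \<otimes> x \<in> J \<and> set xs \<subseteq> J" using Cons by simp
    qed
    then obtain f where f: "\<forall>t\<in>K. f t \<in> \<C> \<and> z \<oplus> t \<otimes> x \<in> f t \<and> set xs \<subseteq> f t" by metis
    have "\<not> inj_on f K"
    proof
      assume "inj_on f K"
      moreover have "countable (f ` K)" using f C(1) countable_subset[of "f ` K" \<C>] by blast
      ultimately show False using K(2) countable_image_inj_on by blast
    qed
    then obtain s t where st: "s \<in> K" "t \<in> K" "s \<noteq> t" "f s = f t" unfolding inj_on_def by blast
    define J where "J = f s"
    have J: "J \<in> \<C>" "z \<oplus> s \<otimes> x \<in> J" "z \<oplus> t \<otimes> x \<in> J" "set xs \<subseteq> J"
      using f st unfolding J_def by auto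
    have JI: "ideal J R" using C(2) J(1) .
    have stc: "s \<in> carrier R" "t \<in> carrier R" using st KR by auto
    have stK: "s \<ominus> t \<in> K"
      using st subringE(3,5,7)[OF subfieldE(1)[OF K(1)]] by (auto simp: a_minus_def)
    have "s \<ominus> t \<noteq> \<zero>" using st stc by simp
    then obtain u where u: "u \<in> K" "u \<otimes> (s \<ominus> t) = \<one>"
      using subfield_m_inv[OF K(1)] stK by blast
    have uc: "u \<in> carrier R" using u KR by blast
    have "(z \<oplus> s \<otimes> x) \<ominus> (z \<oplus> t \<otimes> x) \<in> J" using idealD(6)[OF JI] J by blast
    moreover have "(z \<oplus> s \<otimes> x) \<ominus> (z \<oplus> t \<otimes> x) = (s \<ominus> t) \<otimes> x"
      using xz stc by algebra
    ultimately have "u \<otimes> ((s \<ominus> t) \<otimes> x) \<in> J" using idealD(4)[OF JI] uc by simp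
    moreover have "u \<otimes> ((s \<ominus> t) \<otimes> x) = x"
      using u uc stc xz by (simp add: m_assoc[symmetric])
    ultimately have xJ: "x \<in> J" by simp
    then have "(z \<oplus> s \<otimes> x) \<ominus> s \<otimes> x \<in> J" using J stc by (simp add: idealD(4,6)[OF JI])
    moreover have "(z \<oplus> s \<otimes> x) \<ominus> s \<otimes> x = z" using xz stc by algebra
    ultimately show ?case using xJ J by auto
  qed
  moreover obtain xs where xs: "set xs \<subseteq> I" "\<forall>J. ideal J R \<longrightarrow> set xs \<subseteq> J \<longrightarrow> I \<subseteq> J"
    using ideal_list_generators[OF I] by blast
  ultimately obtain J where "J \<in> \<C>" "set xs \<subseteq> J" using idealD(2)[OF I] by blast
  then show ?thesis using xs C(2) by blast
qed

end

subsection \<open>Finitely generated modules\<close>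

locale noetherian_module = noetherian_cring R + module R M for R (structure) and M (structure)
begin

definition rsub :: "'c set \<Rightarrow> bool" where
  "rsub N \<longleftrightarrow> N \<subseteq> carrier M \<and> \<zero>\<^bsub>M\<^esub> \<in> N \<and> (\<forall>x\<in>N. \<forall>y\<in>N. x \<oplus>\<^bsub>M\<^esub> y \<in> N) \<and>
     (\<forall>r\<in>carrier R. \<forall>x\<in>N. r \<odot>\<^bsub>M\<^esub> x \<in> N)"

text \<open>For an ideal \<open>A\<close> this is \<open>A\<close> times the submodule generated by
  the list; \<open>A = carrier R\<close> gives that submodule itself. Separate coefficients let
  Nakayama's lemma speak of \<open>P\<close> times a module.\<close>

primrec lspan :: "'a set \<Rightarrow> 'c list \<Rightarrow> 'c set" where
  "lspan A [] = {\<zero>\<^bsub>M\<^esub>}"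
| "lspan A (x # xs) = {a \<odot>\<^bsub>M\<^esub> x \<oplus>\<^bsub>M\<^esub> u | a u. a \<in> A \<and> u \<in> lspan A xs}"

definition msum :: "'c set \<Rightarrow> 'c set \<Rightarrow> 'c set" where
  "msum N L = {n \<oplus>\<^bsub>M\<^esub> l | n l. n \<in> N \<and> l \<in> L}"

lemma rsubD:
  assumes "rsub N"
  shows "N \<subseteq> carrier M" "\<zero>\<^bsub>M\<^esub> \<in> N" "\<And>x y. x \<in> N \<Longrightarrow> y \<in> N \<Longrightarrow> x \<oplus>\<^bsub>M\<^esub> y \<in> N"
    "\<And>r x. r \<in> carrier R \<Longrightarrow> x \<in> N \<Longrightarrow> r \<odot>\<^bsub>M\<^esub> x \<in> N"
    "\<And>x. x \<in> N \<Longrightarrow> \<ominus>\<^bsub>M\<^esub> x \<in> N" "\<And>x y. x \<in> N \<Longrightarrow> y \<in> N \<Longrightarrow> x \<ominus>\<^bsub>M\<^esub> y \<in> N"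
proof -
  show sub: "N \<subseteq> carrier M" and "\<zero>\<^bsub>M\<^esub> \<in> N" and add: "\<And>x y. x \<in> N \<Longrightarrow> y \<in> N \<Longrightarrow> x \<oplus>\<^bsub>M\<^esub> y \<in> N"
    and smul: "\<And>r x. r \<in> carrier R \<Longrightarrow> x \<in> N \<Longrightarrow> r \<odot>\<^bsub>M\<^esub> x \<in> N"
    using assms unfolding rsub_def by auto
  show neg: "\<ominus>\<^bsub>M\<^esub> x \<in> N" if "x \<in> N" for x
  proof -
    have "x \<in> carrier M" using that sub by blast
    then have "\<ominus>\<^bsub>M\<^esub> x = (\<ominus> \<one>) \<odot>\<^bsub>M\<^esub> x" by (simp add: smult_l_minus)
    then show ?thesis using smul that by simp
  qed
  show "x \<ominus>\<^bsub>M\<^esub> y \<in> N" if "x \<in> N" "y \<in> N" for x y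
    using that add neg by (simp add: a_minus_def)
qed

lemma smult_ac: "r \<in> carrier R \<Longrightarrow> s \<in> carrier R \<Longrightarrow> x \<in> carrier M \<Longrightarrow>
    r \<odot>\<^bsub>M\<^esub> (s \<odot>\<^bsub>M\<^esub> x) = s \<odot>\<^bsub>M\<^esub> (r \<odot>\<^bsub>M\<^esub> x)"
  by (metis m_comm smult_assoc1)

lemma add_diff_cancel:
  assumes "a \<in> carrier M" "b \<in> carrier M"
  shows "(a \<oplus>\<^bsub>M\<^esub> b) \<ominus>\<^bsub>M\<^esub> a = b"
proof -
  have "(a \<oplus>\<^bsub>M\<^esub> b) \<ominus>\<^bsub>M\<^esub> a = (b \<oplus>\<^bsub>M\<^esub> a) \<oplus>\<^bsub>M\<^esub> \<ominus>\<^bsub>M\<^esub> a"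
    using assms by (simp add: a_minus_def M.a_comm)
  then show ?thesis using assms by (simp add: M.a_assoc M.r_neg)
qed

lemma carrier_ideal: "ideal (carrier R) R"
  by (rule oneideal)

lemma zero_rsub: "rsub {\<zero>\<^bsub>M\<^esub>}"
  by (auto simp: rsub_def)

lemma msum_rsub:
  assumes "rsub N" "rsub L"
  shows "rsub (msum N L)" "N \<subseteq> msum N L" "L \<subseteq> msum N L"
proof -
  note N = rsubD[OF assms(1)] and L = rsubD[OF assms(2)]
  show "N \<subseteq> msum N L"
  proof
    fix x assume "x \<in> N"
    moreover then have "x = x \<oplus>\<^bsub>M\<^esub> \<zero>\<^bsub>M\<^esub>" using N(1) by auto
    ultimately show "x \<in> msum N L" unfolding msum_def using L(2) by blast
  qed
  show "L \<subseteq> msum N L"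
  proof
    fix x assume "x \<in> L"
    moreover then have "x = \<zero>\<^bsub>M\<^esub> \<oplus>\<^bsub>M\<^esub> x" using L(1) by auto
    ultimately show "x \<in> msum N L" unfolding msum_def using N(2) by blast
  qed
  show "rsub (msum N L)"
    unfolding rsub_def
  proof (intro conjI ballI)
    show "msum N L \<subseteq> carrier M" unfolding msum_def using N(1) L(1) by auto
    show "\<zero>\<^bsub>M\<^esub> \<in> msum N L" using \<open>N \<subseteq> msum N L\<close> N(2) by blast
  next
    fix x y assume "x \<in> msum N L" "y \<in> msum N L"
    then obtain a b c d where *: "a \<in> N" "b \<in> L" "x = a \<oplus>\<^bsub>M\<^esub> b" "c \<in> N" "d \<in> L" "y = c \<oplus>\<^bsub>M\<^esub> d"
      unfolding msum_def by blast
    then have "a \<in> carrier M" "b \<in> carrier M" "c \<in> carrier M" "d \<in> carrier M" using N(1) L(1) by auto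
    then have "x \<oplus>\<^bsub>M\<^esub> y = (a \<oplus>\<^bsub>M\<^esub> c) \<oplus>\<^bsub>M\<^esub> (b \<oplus>\<^bsub>M\<^esub> d)" using * by (simp add: M.a_ac)
    then show "x \<oplus>\<^bsub>M\<^esub> y \<in> msum N L" unfolding msum_def using N(3)[OF *(1,4)] L(3)[OF *(2,5)] by blast
  next
    fix r x assume r: "r \<in> carrier R" and "x \<in> msum N L"
    then obtain a b where *: "a \<in> N" "b \<in> L" "x = a \<oplus>\<^bsub>M\<^esub> b" unfolding msum_def by blast
    then have "a \<in> carrier M" "b \<in> carrier M" using N(1) L(1) by auto
    then have "r \<odot>\<^bsub>M\<^esub> x = r \<odot>\<^bsub>M\<^esub> a \<oplus>\<^bsub>M\<^esub> r \<odot>\<^bsub>M\<^esub> b" using * r by (simp add: smult_r_distr)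
    then show "r \<odot>\<^bsub>M\<^esub> x \<in> msum N L" unfolding msum_def using N(4)[OF r *(1)] L(4)[OF r *(2)] by blast
  qed
qed

lemma lspan_rsub:
  assumes A: "ideal A R" and "set xs \<subseteq> carrier M"
  shows "rsub (lspan A xs)"
  using assms(2)
proof (induction xs)
  case Nil
  then show ?case by (simp add: zero_rsub)
next
  case (Cons x xs)
  note D = idealD[OF A]
  have x: "x \<in> carrier M" and L: "rsub (lspan A xs)" using Cons by auto
  have "rsub {a \<odot>\<^bsub>M\<^esub> x | a. a \<in> A}"
    unfolding rsub_def
  proof (intro conjI ballI)
    show "{a \<odot>\<^bsub>M\<^esub> x | a. a \<in> A} \<subseteq> carrier M" using D(1) x by auto
    have "\<zero>\<^bsub>M\<^esub> = \<zero> \<odot>\<^bsub>M\<^esub> x" using x by simp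
    then show "\<zero>\<^bsub>M\<^esub> \<in> {a \<odot>\<^bsub>M\<^esub> x | a. a \<in> A}" using D(2) by blast
  next
    fix u v assume "u \<in> {a \<odot>\<^bsub>M\<^esub> x | a. a \<in> A}" "v \<in> {a \<odot>\<^bsub>M\<^esub> x | a. a \<in> A}"
    then obtain a b where *: "a \<in> A" "u = a \<odot>\<^bsub>M\<^esub> x" "b \<in> A" "v = b \<odot>\<^bsub>M\<^esub> x" by blast
    then have "u \<oplus>\<^bsub>M\<^esub> v = (a \<oplus> b) \<odot>\<^bsub>M\<^esub> x" using D(1) x by (simp add: smult_l_distr subset_iff)
    then show "u \<oplus>\<^bsub>M\<^esub> v \<in> {a \<odot>\<^bsub>M\<^esub> x | a. a \<in> A}" using D(3)[OF *(1,3)] by blast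
  next
    fix r u assume r: "r \<in> carrier R" and "u \<in> {a \<odot>\<^bsub>M\<^esub> x | a. a \<in> A}"
    then obtain a where *: "a \<in> A" "u = a \<odot>\<^bsub>M\<^esub> x" by blast
    then have "r \<odot>\<^bsub>M\<^esub> u = (r \<otimes> a) \<odot>\<^bsub>M\<^esub> x" using D(1) x r by (simp add: smult_assoc1 subset_iff)
    then show "r \<odot>\<^bsub>M\<^esub> u \<in> {a \<odot>\<^bsub>M\<^esub> x | a. a \<in> A}" using D(4)[OF *(1) r] by blast
  qed
  then have "rsub (msum {a \<odot>\<^bsub>M\<^esub> x | a. a \<in> A} (lspan A xs))" using msum_rsub(1) L by blast
  moreover have "msum {a \<odot>\<^bsub>M\<^esub> x | a. a \<in> A} (lspan A xs) = lspan A (x # xs)"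
    unfolding msum_def by auto
  ultimately show ?case by simp
qed

lemma lspan_mono: "A \<subseteq> B \<Longrightarrow> lspan A xs \<subseteq> lspan B xs"
  by (induction xs) fastforce+

lemma lspan_subset:
  assumes N: "rsub N" and "\<And>x a. x \<in> set xs \<Longrightarrow> a \<in> A \<Longrightarrow> a \<odot>\<^bsub>M\<^esub> x \<in> N"
  shows "lspan A xs \<subseteq> N"
  using assms(2)
proof (induction xs)
  case Nil
  then show ?case using rsubD(2)[OF N] by simp
next
  case (Cons x xs)
  then have "lspan A xs \<subseteq> N" "\<And>a. a \<in> A \<Longrightarrow> a \<odot>\<^bsub>M\<^esub> x \<in> N" by auto
  then show ?case using rsubD(3)[OF N] by auto
qed

lemma lspan_memI:
  assumes A: "ideal A R" and "set xs \<subseteq> carrier M" "x \<in> set xs" "a \<in> A"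
  shows "a \<odot>\<^bsub>M\<^esub> x \<in> lspan A xs"
  using assms(2,3)
proof (induction xs)
  case (Cons y ys)
  have L: "rsub (lspan A ys)" using lspan_rsub[OF A] Cons by simp
  have y: "y \<in> carrier M" using Cons by simp
  have a: "a \<in> carrier R" using idealD(1)[OF A] assms(4) by blast
  show ?case
  proof (cases "x = y")
    case True
    then have "a \<odot>\<^bsub>M\<^esub> x = a \<odot>\<^bsub>M\<^esub> y \<oplus>\<^bsub>M\<^esub> \<zero>\<^bsub>M\<^esub>" using y a by simp
    then show ?thesis using rsubD(2)[OF L] assms(4) by auto
  next
    case False
    then have "a \<odot>\<^bsub>M\<^esub> x \<in> lspan A ys" using Cons by simp
    moreover then have "a \<odot>\<^bsub>M\<^esub> x = \<zero> \<odot>\<^bsub>M\<^esub> y \<oplus>\<^bsub>M\<^esub> a \<odot>\<^bsub>M\<^esub> x" using y rsubD(1)[OF L] by auto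
    ultimately show ?thesis using idealD(2)[OF A] unfolding lspan.simps by blast
  qed
qed simp

lemma lspan_carrier_memI:
  assumes "set xs \<subseteq> carrier M" "x \<in> set xs"
  shows "x \<in> lspan (carrier R) xs"
proof -
  have "\<one> \<odot>\<^bsub>M\<^esub> x \<in> lspan (carrier R) xs" using lspan_memI[OF carrier_ideal] assms by simp
  then show ?thesis using assms by auto
qed

lemma rsub_smult_vimage:
  assumes "rsub N" "r \<in> carrier R"
  shows "rsub {x \<in> carrier M. r \<odot>\<^bsub>M\<^esub> x \<in> N}"
  unfolding rsub_def using rsubD[OF assms(1)] assms(2)
  by (auto simp: smult_r_distr smult_ac[of r])

lemma lspan_list_mono:
  assumes "ideal A R" "set xs \<subseteq> set ys" "set ys \<subseteq> carrier M"
  shows "lspan A xs \<subseteq> lspan A ys"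
  using assms lspan_rsub lspan_memI by (intro lspan_subset) auto

lemma smult_lspan_mem:
  assumes A: "ideal A R" and xs: "set xs \<subseteq> carrier M" and a: "a \<in> A"
    and u: "u \<in> lspan (carrier R) xs"
  shows "a \<odot>\<^bsub>M\<^esub> u \<in> lspan A xs"
proof -
  have ac: "a \<in> carrier R" using a idealD(1)[OF A] by blast
  have S: "rsub {u \<in> carrier M. a \<odot>\<^bsub>M\<^esub> u \<in> lspan A xs}"
    using rsub_smult_vimage[OF lspan_rsub[OF A xs] ac] .
  have "x \<in> {u \<in> carrier M. a \<odot>\<^bsub>M\<^esub> u \<in> lspan A xs}" if "x \<in> set xs" for x
    using lspan_memI[OF A xs that a] that xs by auto
  then have "lspan (carrier R) xs \<subseteq> {u \<in> carrier M. a \<odot>\<^bsub>M\<^esub> u \<in> lspan A xs}"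
    using rsubD(4)[OF S] by (intro lspan_subset[OF S]) blast
  then show ?thesis using u by blast
qed

text \<open>The local ring is replaced by multipliers outside \<open>P\<close>, and determinants by
  elimination of one generator at a time: once \<open>s x\<close> lies in \<open>N\<close> plus the
  \<open>P\<close>-span of the others, multiplying by \<open>s\<close> removes \<open>x\<close> from
  their relations.\<close>

lemma nakayama:
  assumes N: "rsub N" and P: "primeideal P R" and "set xs \<subseteq> carrier M"
    and "\<And>x. x \<in> set xs \<Longrightarrow> \<exists>t\<in>carrier R - P. t \<odot>\<^bsub>M\<^esub> x \<in> msum N (lspan P xs)"
  shows "\<exists>t\<in>carrier R - P. \<forall>x\<in>set xs. t \<odot>\<^bsub>M\<^esub> x \<in> N"
  using assms(3,4)
proof (induction xs)
  case Nil
  then show ?case using primeD(3)[OF P] by auto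
next
  case (Cons x xs)
  note PI = primeD(1)[OF P] and PD = primeD(2-4)[OF P]
  have x: "x \<in> carrier M" and xs: "set xs \<subseteq> carrier M" using Cons by auto
  let ?L = "msum N (lspan P xs)"
  have Ls: "rsub (lspan P xs)" using lspan_rsub[OF PI xs] .
  have L: "rsub ?L" using msum_rsub(1)[OF N Ls] .
  have split: "\<exists>w\<in>?L. \<exists>p\<in>P. z = w \<oplus>\<^bsub>M\<^esub> p \<odot>\<^bsub>M\<^esub> x" if zin: "z \<in> msum N (lspan P (x # xs))" for z
  proof -
    obtain n p u where *: "n \<in> N" "p \<in> P" "u \<in> lspan P xs" "z = n \<oplus>\<^bsub>M\<^esub> (p \<odot>\<^bsub>M\<^esub> x \<oplus>\<^bsub>M\<^esub> u)"
      using zin unfolding msum_def lspan.simps by blast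
    have cc: "n \<in> carrier M" "u \<in> carrier M" "p \<in> carrier R"
      using * rsubD(1)[OF N] rsubD(1)[OF Ls] PD(1) by auto
    have "z = (n \<oplus>\<^bsub>M\<^esub> u) \<oplus>\<^bsub>M\<^esub> p \<odot>\<^bsub>M\<^esub> x" using * cc x by (simp add: M.a_ac)
    moreover have "n \<oplus>\<^bsub>M\<^esub> u \<in> ?L" using * unfolding msum_def by blast
    ultimately show ?thesis using * by blast
  qed
  obtain t where t: "t \<in> carrier R - P" "t \<odot>\<^bsub>M\<^esub> x \<in> msum N (lspan P (x # xs))"
    using Cons.prems(2)[of x] by auto
  obtain w p where wp: "w \<in> ?L" "p \<in> P" "t \<odot>\<^bsub>M\<^esub> x = w \<oplus>\<^bsub>M\<^esub> p \<odot>\<^bsub>M\<^esub> x"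
    using split[OF t(2)] by blast
  \<comment> \<open>From \<open>t x = w + p x\<close> the term \<open>p x\<close> moves to the left;
    \<open>s\<close> stays outside \<open>P\<close> because \<open>t\<close> is outside and
    \<open>p\<close> inside.\<close>
  define s where "s = t \<ominus> p"
  have pc: "p \<in> carrier R" "t \<in> carrier R" "w \<in> carrier M" using wp t PD(1) rsubD(1)[OF L] by auto
  then have sc: "s \<in> carrier R" unfolding s_def by simp
  have sP: "s \<notin> P"
  proof
    assume "s \<in> P"
    then have "s \<oplus> p \<in> P" using idealD(3)[OF PI] wp by simp
    moreover have "s \<oplus> p = t" unfolding s_def using pc by algebra
    ultimately show False using t by simp
  qed
  have "s \<odot>\<^bsub>M\<^esub> x = t \<odot>\<^bsub>M\<^esub> x \<ominus>\<^bsub>M\<^esub> p \<odot>\<^bsub>M\<^esub> x"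
    unfolding s_def using pc x by (simp add: a_minus_def smult_l_distr smult_l_minus)
  also have "\<dots> = w" unfolding wp(3) using pc x by (simp add: a_minus_def M.a_ac M.r_neg M.r_neg1)
  finally have sx: "s \<odot>\<^bsub>M\<^esub> x \<in> ?L" using wp(1) by simp
  have "\<exists>t\<in>carrier R - P. t \<odot>\<^bsub>M\<^esub> y \<in> ?L" if y: "y \<in> set xs" for y
  proof -
    obtain t' where t': "t' \<in> carrier R - P" "t' \<odot>\<^bsub>M\<^esub> y \<in> msum N (lspan P (x # xs))"
      using Cons.prems(2)[of y] y by auto
    obtain w' p' where w': "w' \<in> ?L" "p' \<in> P" "t' \<odot>\<^bsub>M\<^esub> y = w' \<oplus>\<^bsub>M\<^esub> p' \<odot>\<^bsub>M\<^esub> x"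
      using split[OF t'(2)] by blast
    have cc: "p' \<in> carrier R" "t' \<in> carrier R" "w' \<in> carrier M" "y \<in> carrier M"
      using w' t' PD(1) rsubD(1)[OF L] y xs by auto
    have "(s \<otimes> t') \<odot>\<^bsub>M\<^esub> y = s \<odot>\<^bsub>M\<^esub> w' \<oplus>\<^bsub>M\<^esub> p' \<odot>\<^bsub>M\<^esub> (s \<odot>\<^bsub>M\<^esub> x)"
      using cc sc x w'(3) by (simp add: smult_assoc1 smult_r_distr smult_ac[of s p' x])
    moreover have "\<dots> \<in> ?L" using rsubD(3,4)[OF L] w'(1) sx sc cc(1) by simp
    moreover have "s \<otimes> t' \<in> carrier R - P" using PD(3)[of s t'] sc sP t' by auto
    ultimately show ?thesis by metis
  qed
  then obtain t' where t': "t' \<in> carrier R - P" "\<forall>y\<in>set xs. t' \<odot>\<^bsub>M\<^esub> y \<in> N"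
    using Cons.IH[OF xs] by blast
  have t'c: "t' \<in> carrier R" using t' by blast
  have V: "rsub {u \<in> carrier M. t' \<odot>\<^bsub>M\<^esub> u \<in> N}" using rsub_smult_vimage[OF N t'c] .
  have "lspan P xs \<subseteq> {u \<in> carrier M. t' \<odot>\<^bsub>M\<^esub> u \<in> N}"
    using t'(2) xs PD(1) by (intro lspan_subset[OF V] rsubD(4)[OF V]) auto
  moreover obtain n u where nu: "n \<in> N" "u \<in> lspan P xs" "s \<odot>\<^bsub>M\<^esub> x = n \<oplus>\<^bsub>M\<^esub> u"
    using sx unfolding msum_def by blast
  ultimately have tu: "t' \<odot>\<^bsub>M\<^esub> u \<in> N" "u \<in> carrier M" by auto
  have "(t' \<otimes> s) \<odot>\<^bsub>M\<^esub> x = t' \<odot>\<^bsub>M\<^esub> n \<oplus>\<^bsub>M\<^esub> t' \<odot>\<^bsub>M\<^esub> u"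
    using t'c sc x nu(3) tu(2) nu(1) rsubD(1)[OF N]
    by (simp add: smult_assoc1 smult_r_distr subset_iff)
  then have "(t' \<otimes> s) \<odot>\<^bsub>M\<^esub> x \<in> N" using rsubD(3,4)[OF N] tu nu(1) t'c by simp
  moreover have "(t' \<otimes> s) \<odot>\<^bsub>M\<^esub> y \<in> N" if "y \<in> set xs" for y
  proof -
    have "(t' \<otimes> s) \<odot>\<^bsub>M\<^esub> y = s \<odot>\<^bsub>M\<^esub> (t' \<odot>\<^bsub>M\<^esub> y)"
      using that xs sc t'c by (simp add: smult_assoc1 smult_ac[of t' s] subset_iff)
    then show ?thesis using rsubD(4)[OF N] sc t'(2) that by simp
  qed
  moreover have "t' \<otimes> s \<in> carrier R - P" using PD(3)[of t' s] sc sP t' by auto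
  ultimately show ?case by (intro bexI[of _ "t' \<otimes> s"]) auto
qed

text \<open>Splitting off the first generator \<open>x\<close>, a chain member is determined within
  a larger one by its intersection with the span of the rest and by the ideal \<open>I n\<close> of
  coefficients of \<open>x\<close> occurring in it. Both kinds of chain stabilise.\<close>

lemma descending_chain_lspan:
  assumes dcc: "dcc_mod {\<one>} {\<zero>}" and "set xs \<subseteq> carrier M"
    and "\<And>n::nat. rsub (C n)" "\<And>n. C (Suc n) \<subseteq> C n" "\<And>n. C n \<subseteq> lspan (carrier R) xs"
  shows "\<exists>n. \<forall>k\<ge>n. C k = C n"
  using assms(2-)
proof (induction xs arbitrary: C)
  case Nil
  have "C n = {\<zero>\<^bsub>M\<^esub>}" for n using Nil(4)[of n] rsubD(2)[OF Nil(2)[of n]] by auto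
  then show ?case by simp
next
  case (Cons x xs)
  have x: "x \<in> carrier M" and xs: "set xs \<subseteq> carrier M" using Cons by auto
  let ?L = "lspan (carrier R) xs"
  have L: "rsub ?L" using lspan_rsub[OF carrier_ideal xs] .
  note D = rsubD[OF Cons.prems(2)]
  define I where "I n = {r \<in> carrier R. r \<odot>\<^bsub>M\<^esub> x \<in> msum (C n) ?L}" for n
  have dec: "C k \<subseteq> C n" if "n \<le> k" for n k
    using lift_Suc_antimono_le[of C] Cons.prems(3) that by blast
  have I: "ideal (I n) R" for n
    unfolding ideal_iff I_def
    using rsubD[OF msum_rsub(1)[OF Cons.prems(2) L]] x
    by (auto simp: smult_l_distr smult_assoc1)
  have I0: "{\<zero>} \<subseteq> I n" "I (Suc n) \<subseteq> I n" for n
    using idealD(2)[OF I] Cons.prems(3)[of n] unfolding I_def msum_def by blast+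
  obtain m where m: "\<forall>k\<ge>m. \<forall>r\<in>I m. \<exists>t\<in>{\<one>}. t \<otimes> r \<in> I k"
    using spec[OF dcc[unfolded dcc_mod_def], of I] I I0 by blast
  have mI: "r \<in> I k" if "k \<ge> m" "r \<in> I m" for k r
    using m[rule_format, OF that] that(2) unfolding I_def by auto
  have "\<exists>n. \<forall>k\<ge>n. C k \<inter> ?L = C n \<inter> ?L"
  proof (rule Cons.IH[OF xs])
    show "rsub (C n \<inter> ?L)" for n
      using Cons.prems(2)[of n] L unfolding rsub_def by auto
  qed (use Cons.prems(3) in auto)
  then obtain n where n: "\<forall>k\<ge>n. C k \<inter> ?L = C n \<inter> ?L" by blast
  show ?case
  proof (intro exI allI impI equalityI)
    fix k assume k: "max n m \<le> k"
    show "C k \<subseteq> C (max n m)" using dec[OF k] .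
    show "C (max n m) \<subseteq> C k"
    proof
      fix c assume c: "c \<in> C (max n m)"
      then obtain r u where ru: "r \<in> carrier R" "u \<in> ?L" "c = r \<odot>\<^bsub>M\<^esub> x \<oplus>\<^bsub>M\<^esub> u"
        using Cons.prems(4)[of "max n m"] unfolding lspan.simps by blast
      have cc: "u \<in> carrier M" "c \<in> carrier M" using ru rsubD(1)[OF L] c D(1) by auto
      have "r \<odot>\<^bsub>M\<^esub> x = c \<oplus>\<^bsub>M\<^esub> \<ominus>\<^bsub>M\<^esub> u"
        using ru cc x by (simp add: M.a_assoc M.r_neg)
      moreover have "c \<in> C m" using c dec[of m "max n m"] by auto
      ultimately have "r \<in> I m" unfolding I_def msum_def using ru rsubD(5)[OF L] by blast
      then have "r \<in> I k" using mI k by simp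
      then obtain d v where dv: "d \<in> C k" "v \<in> ?L" "r \<odot>\<^bsub>M\<^esub> x = d \<oplus>\<^bsub>M\<^esub> v"
        unfolding I_def msum_def by blast
      have cc': "v \<in> carrier M" "d \<in> carrier M" using dv rsubD(1)[OF L] D(1) by auto
      have e: "c = d \<oplus>\<^bsub>M\<^esub> (v \<oplus>\<^bsub>M\<^esub> u)" using ru dv cc cc' by (simp add: M.a_assoc)
      then have "v \<oplus>\<^bsub>M\<^esub> u = c \<ominus>\<^bsub>M\<^esub> d" using cc cc' by (simp add: add_diff_cancel)
      moreover have "c \<ominus>\<^bsub>M\<^esub> d \<in> C (max n m)" using D(6) c dv(1) dec[OF k] by blast
      ultimately have "v \<oplus>\<^bsub>M\<^esub> u \<in> C (max n m) \<inter> ?L" using rsubD(3)[OF L dv(2) ru(2)] by auto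
      moreover have "C (max n m) \<inter> ?L = C k \<inter> ?L"
        using n[rule_format, of k] n[rule_format, of "max n m"] k by simp
      ultimately have "v \<oplus>\<^bsub>M\<^esub> u \<in> C k" by blast
      then show "c \<in> C k" using e D(3) dv(1) by simp
    qed
  qed
qed

end

section \<open>Krull's principal ideal theorem\<close>

definition regular_module :: "('a, 'b) ring_scheme \<Rightarrow> ('a, 'a) module" where
  "regular_module R = \<lparr>carrier = carrier R, mult = (\<otimes>\<^bsub>R\<^esub>), one = \<one>\<^bsub>R\<^esub>, zero = \<zero>\<^bsub>R\<^esub>,
     add = (\<oplus>\<^bsub>R\<^esub>), smult = (\<otimes>\<^bsub>R\<^esub>)\<rparr>"

lemma regular_module_simps [simp]:
  "carrier (regular_module R) = carrier R" "zero (regular_module R) = zero R"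
  "add (regular_module R) = add R" "smult (regular_module R) = mult R"
  by (simp_all add: regular_module_def)

context noetherian_cring
begin

text \<open>The submodules of the ring over itself are its ideals, so \<open>lspan\<close> and
  \<open>nakayama\<close> become available for ideals.\<close>

lemma regular_module: "noetherian_module R (regular_module R)"
proof -
  have "abelian_group (regular_module R)"
  proof (rule abelian_groupI)
    fix x assume "x \<in> carrier (regular_module R)"
    then show "\<exists>y\<in>carrier (regular_module R). y \<oplus>\<^bsub>regular_module R\<^esub> x = \<zero>\<^bsub>regular_module R\<^esub>"
      by (intro bexI[of _ "\<ominus> x"]) (auto simp: l_neg)
  qed (auto simp: a_ac)
  then have "module R (regular_module R)"
    by (intro moduleI is_cring) (auto simp: l_distr r_distr m_assoc)
  then show ?thesis
    using noetherian_cring_axioms by (simp add: noetherian_module_def)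
qed

text \<open>Modulo \<open>c\<close> and locally at \<open>Q\<close>, the symbolic powers of \<open>q\<close> at \<open>H\<close> stabilise; Nakayama's lemma
  then removes \<open>c\<close>.\<close>

theorem principal_ideal_theorem:
  assumes c: "c \<in> carrier R" and Q: "primeideal Q R" "c \<in> Q"
    and Qmin: "\<And>P. primeideal P R \<Longrightarrow> c \<in> P \<Longrightarrow> P \<subseteq> Q \<Longrightarrow> P = Q"
    and H: "primeideal H R" "H \<subset> Q"
    and q: "q \<in> H" "\<And>r. r \<in> carrier R \<Longrightarrow> q \<otimes> r = \<zero> \<Longrightarrow> r = \<zero>"
  shows False
proof -
  interpret M: noetherian_module R "regular_module R" by (rule regular_module)
  note QD = primeD[OF Q(1)] and HD = primeD[OF H(1)]
  define T where "T = carrier R - Q"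
  have qc: "q \<in> carrier R" using q HD(2) by blast
  have cH: "c \<notin> H" using Qmin[OF H(1)] H(2) by blast
  have T: "\<one> \<in> T" "T \<subseteq> carrier R" "\<And>s t. s \<in> T \<Longrightarrow> t \<in> T \<Longrightarrow> s \<otimes> t \<in> T"
    using QD(3,4) unfolding T_def by auto
  define J where "J = adjoin {\<zero>} c"
  have Z: "ideal {\<zero>} R" by (rule zeroideal)
  have J: "ideal J R" "c \<in> J" using adjoin_ideal[OF Z c] unfolding J_def by auto
  \<comment> \<open>For a prime \<open>P\<close> over \<open>c\<close> there are two cases. If every
    chain member meets \<open>T\<close>, they are all the whole ring locally. Otherwise one lies in
    \<open>Q\<close>; minimality of \<open>Q\<close> forces \<open>P = Q\<close>, and the chain is
    constant from there on.\<close>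
  have "dcc_mod T J"
  proof (rule dcc_mod_of_primes[OF T J(1)])
    fix P assume P: "primeideal P R" "J \<subseteq> P"
    show "dcc_mod T P"
      unfolding dcc_mod_def
    proof (intro allI impI)
      fix I :: "nat \<Rightarrow> 'a set"
      assume I: "\<forall>n. ideal (I n) R \<and> P \<subseteq> I n \<and> I (Suc n) \<subseteq> I n"
      have dec: "I k \<subseteq> I n" if "n \<le> k" for n k
        using lift_Suc_antimono_le[of I] I that by blast
      have IR: "x \<in> I n \<Longrightarrow> x \<in> carrier R" for x n using I idealD(1) by blast
      show "\<exists>n. \<forall>k\<ge>n. \<forall>x\<in>I n. \<exists>t\<in>T. t \<otimes> x \<in> I k"
      proof (cases "\<forall>n. \<exists>t\<in>T. t \<in> I n")
        case True
        have "\<exists>t\<in>T. t \<otimes> x \<in> I k" if "x \<in> I 0" for x k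
        proof -
          obtain t where "t \<in> T" "t \<in> I k" using True by blast
          then show ?thesis using idealD(5)[of "I k" t x] I IR[OF that] by blast
        qed
        then show ?thesis by blast
      next
        case False
        then obtain n where n: "I n \<subseteq> Q" using IR unfolding T_def by blast
        have "c \<in> P" using J(2) P(2) by blast
        moreover have "P \<subseteq> Q" using n I by blast
        ultimately have "P = Q" using Qmin P(1) by blast
        have "\<exists>t\<in>T. t \<otimes> x \<in> I k" if "x \<in> I n" for x k
        proof -
          have "x \<in> I k" using that n \<open>P = Q\<close> I by blast
          then show ?thesis using T(1) IR[OF that] by (intro bexI[of _ \<one>]) auto
        qed
        then show ?thesis by blast
      qed
    qed
  qed
  \<comment> \<open>The contraction to \<open>R\<close> of \<open>q\<^sup>n\<close> times the
    localisation at \<open>H\<close>; elements outside \<open>H\<close> can be cancelled modulo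
    it.\<close>
  define I where "I n = {r \<in> carrier R. \<exists>t\<in>carrier R - H. \<exists>s\<in>carrier R. t \<otimes> r = q [^] n \<otimes> s}" for n :: nat
  have I_memI: "r \<in> I n" if "r \<in> carrier R" "t \<in> carrier R" "t \<notin> H" "s \<in> carrier R" "t \<otimes> r = q [^] n \<otimes> s"
    for n r s t using that unfolding I_def by blast
  have qn: "q [^] n \<in> carrier R" for n :: nat using qc by simp
  have I: "ideal (I n) R" for n
    unfolding ideal_iff
  proof (intro conjI ballI)
    show "I n \<subseteq> carrier R" unfolding I_def by blast
    show "\<zero> \<in> I n" 
      using HD(3) qn[of n] by (intro I_memI[of _ \<one> \<zero>]) auto
  next
    fix a b assume "a \<in> I n" "b \<in> I n"
    then obtain t s t' s' where *: "a \<in> carrier R" "b \<in> carrier R" "t \<in> carrier R" "t \<notin> H" "s \<in> carrier R"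
      "t \<otimes> a = q [^] n \<otimes> s" "t' \<in> carrier R" "t' \<notin> H" "s' \<in> carrier R" "t' \<otimes> b = q [^] n \<otimes> s'"
      unfolding I_def by blast
    have "(t \<otimes> t') \<otimes> (a \<oplus> b) = t' \<otimes> (t \<otimes> a) \<oplus> t \<otimes> (t' \<otimes> b)"
      using *(1,2,3,7) by algebra
    also have "\<dots> = q [^] n \<otimes> (t' \<otimes> s \<oplus> t \<otimes> s')" unfolding *(6,10)
      using *(3,5,7,9) qn[of n] by algebra
    finally show "a \<oplus> b \<in> I n" using *(1-5,7-9) HD(4)[of t t']
      by (intro I_memI[of _ "t \<otimes> t'" "t' \<otimes> s \<oplus> t \<otimes> s'"]) auto
  next
    fix r a assume r: "r \<in> carrier R" and "a \<in> I n"
    then obtain t s where *: "a \<in> carrier R" "t \<in> carrier R" "t \<notin> H" "s \<in> carrier R"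
      "t \<otimes> a = q [^] n \<otimes> s" unfolding I_def by blast
    have "t \<otimes> (r \<otimes> a) = r \<otimes> (t \<otimes> a)" using *(1,2) r by algebra
    also have "\<dots> = q [^] n \<otimes> (r \<otimes> s)" unfolding *(5) using *(4) r qn[of n] by algebra
    finally show "r \<otimes> a \<in> I n" using * r
      by (intro I_memI[of _ t "r \<otimes> s"]) auto
  qed
  have dec: "I (Suc n) \<subseteq> I n" for n
  proof
    fix a assume "a \<in> I (Suc n)"
    then obtain t s where *: "a \<in> carrier R" "t \<in> carrier R" "t \<notin> H" "s \<in> carrier R"
      "t \<otimes> a = q [^] Suc n \<otimes> s" unfolding I_def by blast
    have "q [^] Suc n \<otimes> s = q [^] n \<otimes> (q \<otimes> s)" using * qc by (simp add: m_assoc)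
    then show "a \<in> I n" using * qc
      by (intro I_memI[of _ t "q \<otimes> s"]) auto
  qed
  have "\<forall>n. ideal (adjoin (I n) c) R \<and> J \<subseteq> adjoin (I n) c \<and> adjoin (I (Suc n)) c \<subseteq> adjoin (I n) c"
  proof (intro allI conjI)
    fix n
    show "ideal (adjoin (I n) c) R" using adjoin_ideal(1)[OF I c] .
    show "J \<subseteq> adjoin (I n) c" unfolding J_def adjoin_def using idealD(2)[OF I[of n]] by blast
    show "adjoin (I (Suc n)) c \<subseteq> adjoin (I n) c" unfolding adjoin_def using dec[of n] by blast
  qed
  then obtain n where n: "\<forall>k\<ge>n. \<forall>x\<in>adjoin (I n) c. \<exists>t\<in>T. t \<otimes> x \<in> adjoin (I k) c"
    using spec[OF \<open>dcc_mod T J\<close>[unfolded dcc_mod_def], of "\<lambda>n. adjoin (I n) c"] by blast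
  obtain xs where xs: "set xs \<subseteq> I n" "\<forall>J. ideal J R \<longrightarrow> set xs \<subseteq> J \<longrightarrow> I n \<subseteq> J"
    using ideal_list_generators[OF I] by blast
  have xsc: "set xs \<subseteq> carrier (regular_module R)" using xs(1) idealD(1)[OF I[of n]] by auto
  have rs: "M.rsub N \<longleftrightarrow> ideal N R" for N
    unfolding M.rsub_def ideal_iff by simp
  have "\<exists>t\<in>carrier R - Q. \<forall>x\<in>set xs. t \<odot>\<^bsub>regular_module R\<^esub> x \<in> I (Suc n)"
  proof (rule M.nakayama[OF _ Q(1) xsc])
    show "M.rsub (I (Suc n))" unfolding rs by (rule I)
    fix x assume x: "x \<in> set xs"
    then have "x \<in> adjoin (I n) c" using xs(1) adjoin_ideal(2)[OF I c] by blast
    then obtain t where t: "t \<in> T" "t \<otimes> x \<in> adjoin (I (Suc n)) c" using n by (meson le_Suc_eq order_refl)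
    then obtain y r where yr: "y \<in> I (Suc n)" "r \<in> carrier R" "t \<otimes> x = y \<oplus> c \<otimes> r"
      unfolding adjoin_def by blast
    have tc: "t \<in> carrier R" "y \<in> carrier R" "x \<in> carrier R" "y \<in> I n"
      using t T(2) yr idealD(1)[OF I] x xs(1) dec by blast+
    have "c \<otimes> r = t \<otimes> x \<ominus> y" unfolding yr(3) using tc yr(2) c by algebra
    moreover have "t \<otimes> x \<ominus> y \<in> I n" using x xs(1) tc by (auto intro!: idealD(4,6)[OF I])
    ultimately have "c \<otimes> r \<in> I n" by simp
    then obtain t' s where *: "t' \<in> carrier R" "t' \<notin> H" "s \<in> carrier R" "t' \<otimes> (c \<otimes> r) = q [^] n \<otimes> s"
      unfolding I_def by blast
    \<comment> \<open>Since \<open>c\<close> is outside \<open>H\<close> it joins the multiplier,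
      and \<open>r\<close> itself lies in \<open>I n\<close>. So \<open>c r\<close> lies in
      \<open>Q\<close> times \<open>I n\<close>, the form that Nakayama's lemma requires.\<close>
    then have "(t' \<otimes> c) \<otimes> r = q [^] n \<otimes> s" "t' \<otimes> c \<notin> H" using c yr(2) HD(4)[of t' c] cH by (auto simp: m_assoc)
    then have rI: "r \<in> I n" using yr(2) * c by (intro I_memI[of _ "t' \<otimes> c" s]) auto
    let ?L = "M.lspan Q xs"
    have L: "ideal ?L R" using M.lspan_rsub[OF QD(1) xsc] rs by simp
    have "ideal (colon ?L c) R" using colon_ideal(1)[OF L c] .
    moreover have "set xs \<subseteq> colon ?L c"
      using M.lspan_memI[OF QD(1) xsc _ Q(2)] xsc unfolding colon_def by auto
    ultimately have "r \<in> colon ?L c" using xs(2) rI by blast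
    then have "c \<otimes> r \<in> ?L" unfolding colon_def by blast
    then have "t \<otimes> x \<in> M.msum (I (Suc n)) ?L" unfolding M.msum_def yr(3) using yr(1) by auto
    then show "\<exists>t\<in>carrier R - Q. t \<odot>\<^bsub>regular_module R\<^esub> x \<in> M.msum (I (Suc n)) ?L"
      using t(1) unfolding T_def by auto
  qed
  then obtain t where t: "t \<in> carrier R" "t \<notin> Q" "\<forall>x\<in>set xs. t \<otimes> x \<in> I (Suc n)" by auto
  have "set xs \<subseteq> colon (I (Suc n)) t" using t(3) xsc unfolding colon_def by auto
  then have "I n \<subseteq> colon (I (Suc n)) t" using xs(2) colon_ideal(1)[OF I t(1)] by blast
  moreover have "q [^] n \<in> I n" 
    using HD(3) qn[of n] by (intro I_memI[of _ \<one> \<one>]) auto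
  ultimately have "t \<otimes> q [^] n \<in> I (Suc n)" unfolding colon_def by blast
  then obtain t' s where *: "t' \<in> carrier R" "t' \<notin> H" "s \<in> carrier R"
    "t' \<otimes> (t \<otimes> q [^] n) = q [^] Suc n \<otimes> s" unfolding I_def by blast
  \<comment> \<open>Regularity of \<open>q\<close> cancels its power and leaves
    \<open>t' t = q s\<close> in \<open>H\<close>, although neither factor on the left lies in
    \<open>H\<close>.\<close>
  have "q [^] n \<otimes> (t' \<otimes> t \<ominus> q \<otimes> s) = t' \<otimes> (t \<otimes> q [^] n) \<ominus> (q [^] n \<otimes> q) \<otimes> s"
    using *(1,3) t(1) qn[of n] qc by algebra
  also have "\<dots> = \<zero>" unfolding *(4) using qn qc *(3) by (simp add: r_neg a_minus_def)
  finally have z: "q [^] n \<otimes> (t' \<otimes> t \<ominus> q \<otimes> s) = \<zero>" .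
  have canc: "r = \<zero>" if "q [^] m \<otimes> r = \<zero>" "r \<in> carrier R" for m :: nat and r
    using that
  proof (induction m)
    case (Suc m)
    have "q \<otimes> (q [^] m \<otimes> r) = \<zero>" using Suc.prems qc by (simp add: m_assoc m_comm[of q] m_lcomm)
    then show ?case using Suc q(2)[of "q [^] m \<otimes> r"] qc by auto
  qed auto
  have cc: "t' \<otimes> t \<in> carrier R" "q \<otimes> s \<in> carrier R" using * t qc by auto
  have "t' \<otimes> t \<ominus> q \<otimes> s = \<zero>" using canc[OF z] cc by simp
  then have "t' \<otimes> t = q \<otimes> s" using cc by simp
  moreover have "q \<otimes> s \<in> H" using idealD(5)[OF HD(1) q(1) *(3)] .
  ultimately have "t' \<in> H \<or> t \<in> H" using HD(4) *(1) t(1) by simp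
  then show False using *(2) t(2) H(2) by blast
qed

end

subsection \<open>Automorphisms and skew modules\<close>

definition ring_vimage :: "('a, 'b) ring_scheme \<Rightarrow> ('a \<Rightarrow> 'a) \<Rightarrow> 'a set \<Rightarrow> 'a set" where
  "ring_vimage R \<sigma> I = {r \<in> carrier R. \<sigma> r \<in> I}"

context noetherian_cring
begin

lemma isoD:
  assumes "\<sigma> \<in> ring_iso R R"
  shows "\<And>r. r \<in> carrier R \<Longrightarrow> \<sigma> r \<in> carrier R"
    "\<And>r s. r \<in> carrier R \<Longrightarrow> s \<in> carrier R \<Longrightarrow> \<sigma> (r \<oplus> s) = \<sigma> r \<oplus> \<sigma> s"
    "\<And>r s. r \<in> carrier R \<Longrightarrow> s \<in> carrier R \<Longrightarrow> \<sigma> (r \<otimes> s) = \<sigma> r \<otimes> \<sigma> s"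
    "\<sigma> \<one> = \<one>" "\<sigma> \<zero> = \<zero>" "bij_betw \<sigma> (carrier R) (carrier R)"
proof -
  have h: "\<sigma> \<in> ring_hom R R" using assms ring_iso_memE(5) unfolding ring_iso_def by blast
  show "\<And>r. r \<in> carrier R \<Longrightarrow> \<sigma> r \<in> carrier R"
    "\<And>r s. r \<in> carrier R \<Longrightarrow> s \<in> carrier R \<Longrightarrow> \<sigma> (r \<oplus> s) = \<sigma> r \<oplus> \<sigma> s"
    "\<And>r s. r \<in> carrier R \<Longrightarrow> s \<in> carrier R \<Longrightarrow> \<sigma> (r \<otimes> s) = \<sigma> r \<otimes> \<sigma> s"
    "\<sigma> \<one> = \<one>" "bij_betw \<sigma> (carrier R) (carrier R)"
    using ring_iso_memE[OF assms] by auto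
  show "\<sigma> \<zero> = \<zero>" using ring_hom_zero[OF h ring_axioms ring_axioms] .
qed

lemma iso_funpow:
  assumes "\<sigma> \<in> ring_iso R R"
  shows "\<sigma> ^^ n \<in> ring_iso R R"
proof (induction n)
  case 0
  show ?case by (auto simp: ring_iso_def ring_hom_def bij_betw_def)
next
  case (Suc n)
  then show ?case using ring_iso_set_trans[OF Suc assms] by (simp add: comp_def)
qed

lemma ring_vimage_ideal:
  assumes "\<sigma> \<in> ring_iso R R" "ideal I R"
  shows "ideal (ring_vimage R \<sigma> I) R"
  using idealD[OF assms(2)] isoD[OF assms(1)] unfolding ideal_iff ring_vimage_def by auto

lemma ring_vimage_prime:
  assumes s: "\<sigma> \<in> ring_iso R R" and P: "primeideal P R"
  shows "primeideal (ring_vimage R \<sigma> P) R"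
proof (rule primeidealI)
  show "ideal (ring_vimage R \<sigma> P) R" using ring_vimage_ideal[OF s primeD(1)[OF P]] .
  show "cring R" by (rule is_cring)
  have "\<one> \<notin> ring_vimage R \<sigma> P" unfolding ring_vimage_def using isoD(4)[OF s] primeD(3)[OF P] by simp
  then show "carrier R \<noteq> ring_vimage R \<sigma> P" by blast
  show "a \<in> ring_vimage R \<sigma> P \<or> b \<in> ring_vimage R \<sigma> P"
    if "a \<in> carrier R" "b \<in> carrier R" "a \<otimes> b \<in> ring_vimage R \<sigma> P" for a b
    using that primeD(4)[OF P, of "\<sigma> a" "\<sigma> b"] isoD(1,3)[OF s] unfolding ring_vimage_def by auto
qed

text \<open>The inverse images of \<open>I\<close> under powers of \<sigma> ascend, hence stabilise;
  surjectivity of the stabilising power pulls the equality back to the first step.\<close>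

lemma ring_vimage_eq_of_subset:
  assumes s: "\<sigma> \<in> ring_iso R R" and I: "ideal I R" and sub: "I \<subseteq> ring_vimage R \<sigma> I"
  shows "ring_vimage R \<sigma> I = I"
proof
  show "I \<subseteq> ring_vimage R \<sigma> I" by fact
  define C where "C k = ring_vimage R (\<sigma> ^^ k) I" for k
  have "\<exists>n. \<forall>k\<ge>n. C k = C n"
  proof (rule ideal_ascending_chain)
    show "ideal (C n) R" for n unfolding C_def using ring_vimage_ideal[OF iso_funpow[OF s] I] .
    show "C n \<subseteq> C (Suc n)" for n using sub unfolding C_def ring_vimage_def by auto
  qed
  then obtain n where n: "C (Suc n) = C n" by (meson le_Suc_eq order_refl)
  show "ring_vimage R \<sigma> I \<subseteq> I"
  proof
    fix r assume r: "r \<in> ring_vimage R \<sigma> I"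
    then obtain r' where r': "r' \<in> carrier R" "(\<sigma> ^^ n) r' = r"
      using isoD(6)[OF iso_funpow[OF s, of n]] unfolding bij_betw_def ring_vimage_def by (smt (verit) image_iff mem_Collect_eq)
    then have "r' \<in> C (Suc n)" using r unfolding C_def ring_vimage_def by simp
    then have "r' \<in> C n" using n by simp
    then show "r \<in> I" using r' unfolding C_def ring_vimage_def by simp
  qed
qed

text \<open>A prime containing a finite intersection contains one of the ideals. The intersection is
  expressed by its elements, so no ideal is formed; for \<open>n = 0\<close> the hypothesis would
  put \<open>\<one>\<close> into \<open>Q\<close>.\<close>

lemma prime_contains_component:
  assumes Q: "primeideal Q R" and "\<And>i. i < (n::nat) \<Longrightarrow> ideal (J i) R"
    and "\<And>r. r \<in> carrier R \<Longrightarrow> (\<And>i. i < n \<Longrightarrow> r \<in> J i) \<Longrightarrow> r \<in> Q"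
  shows "\<exists>i<n. J i \<subseteq> Q"
  using assms(2,3)
proof (induction n)
  case 0
  then show ?case using primeD(3)[OF Q] by auto
next
  case (Suc n)
  show ?case
  proof (cases "J n \<subseteq> Q")
    case False
    then obtain a where a: "a \<in> J n" "a \<notin> Q" by blast
    have ac: "a \<in> carrier R" using a idealD(1)[OF Suc.prems(1)[of n]] by blast
    have "\<exists>i<n. J i \<subseteq> Q"
    proof (rule Suc.IH)
      show "ideal (J i) R" if "i < n" for i using Suc.prems(1)[of i] that by simp
      fix r assume r: "r \<in> carrier R" "\<And>i. i < n \<Longrightarrow> r \<in> J i"
      have "a \<otimes> r \<in> Q"
      proof (rule Suc.prems(2))
        fix i assume "i < Suc n"
        then show "a \<otimes> r \<in> J i"
          using idealD(4,5)[OF Suc.prems(1)[of i]] a(1) r ac by (cases "i = n") auto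
      qed (use ac r in simp)
      then show "r \<in> Q" using primeD(4)[OF Q ac r(1)] a by blast
    qed
    then show ?thesis by (auto intro: less_SucI)
  qed blast
qed

end

section \<open>Inverse images of ideals under powers of the automorphism\<close>

locale automorphism_ring = noetherian_cring R for R (structure) +
  fixes \<alpha> :: "'a \<Rightarrow> 'a"
  assumes alpha: "\<alpha> \<in> ring_iso R R"
begin

definition \<beta> where "\<beta> = inv_into (carrier R) \<alpha>"

text \<open>Inverse images are the right direction: \<open>r\<close> annihilates
  \<open>x \<theta>\<^sup>n\<close> as soon as \<open>\<alpha>\<^sup>n r\<close> annihilates
  \<open>x\<close>, because the constant passes through \<open>\<theta>\<^sup>n\<close>.\<close>

definition pb :: "nat \<Rightarrow> 'a set \<Rightarrow> 'a set" where "pb n P = ring_vimage R (\<alpha> ^^ n) P"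

lemma beta: "\<beta> \<in> ring_iso R R"
  unfolding \<beta>_def by (rule ring_iso_set_sym[OF ring_axioms alpha])

lemmas alphaD = isoD[OF alpha] and betaD = isoD[OF beta]
  and alpha_powD = isoD[OF iso_funpow[OF alpha]] and beta_powD = isoD[OF iso_funpow[OF beta]]

lemma alpha_beta [simp]: "r \<in> carrier R \<Longrightarrow> \<alpha> (\<beta> r) = r" "r \<in> carrier R \<Longrightarrow> \<beta> (\<alpha> r) = r"
  using alphaD(6) unfolding \<beta>_def by (auto simp: bij_betw_inv_into_right bij_betw_inv_into_left)

lemma alpha_beta_pow [simp]:
  assumes "r \<in> carrier R"
  shows "(\<alpha> ^^ n) ((\<beta> ^^ n) r) = r" "(\<beta> ^^ n) ((\<alpha> ^^ n) r) = r"
proof -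
  show "(\<alpha> ^^ n) ((\<beta> ^^ n) r) = r"
    using assms
  proof (induction n arbitrary: r)
    case (Suc n)
    have "(\<alpha> ^^ Suc n) ((\<beta> ^^ Suc n) r) = (\<alpha> ^^ n) (\<alpha> (\<beta> ((\<beta> ^^ n) r)))"
      by (simp add: funpow_swap1)
    then show ?case using Suc beta_powD(1) by simp
  qed simp
  show "(\<beta> ^^ n) ((\<alpha> ^^ n) r) = r"
    using assms
  proof (induction n arbitrary: r)
    case (Suc n)
    have "(\<beta> ^^ Suc n) ((\<alpha> ^^ Suc n) r) = (\<beta> ^^ n) (\<beta> (\<alpha> ((\<alpha> ^^ n) r)))"
      by (simp add: funpow_swap1)
    then show ?case using Suc alpha_powD(1) by simp
  qed simp
qed

lemma mem_pb_iff: "r \<in> pb n P \<longleftrightarrow> r \<in> carrier R \<and> (\<alpha> ^^ n) r \<in> P"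
  unfolding pb_def ring_vimage_def by simp

lemma pb_ideal: "ideal P R \<Longrightarrow> ideal (pb n P) R"
  unfolding pb_def using ring_vimage_ideal[OF iso_funpow[OF alpha]] .

lemma pb_prime: "primeideal P R \<Longrightarrow> primeideal (pb n P) R"
  unfolding pb_def using ring_vimage_prime[OF iso_funpow[OF alpha]] .

lemma pb_pb: "pb m (pb n P) = pb (n + m) P"
  by (auto simp: mem_pb_iff funpow_add alpha_powD(1))

lemma pb_0: "P \<subseteq> carrier R \<Longrightarrow> pb 0 P = P"
  by (auto simp: mem_pb_iff)

lemma pb_subset_iff:
  assumes "P \<subseteq> carrier R"
  shows "pb n P \<subseteq> pb n Q \<longleftrightarrow> P \<subseteq> Q"
proof
  assume L: "pb n P \<subseteq> pb n Q"
  show "P \<subseteq> Q"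
  proof
    fix r assume r: "r \<in> P"
    then have "(\<beta> ^^ n) r \<in> pb n P" using assms beta_powD(1) by (auto simp: mem_pb_iff subset_iff)
    then have "(\<beta> ^^ n) r \<in> pb n Q" using L by blast
    then show "r \<in> Q" using r assms by (auto simp: mem_pb_iff subset_iff)
  qed
qed (auto simp: mem_pb_iff)

text \<open>One inclusion gives an ascending chain under \<alpha>; the other becomes an ascending
  chain under the inverse \<beta>.\<close>

lemma pb_comparable_imp_eq:
  assumes P: "ideal P R" and "pb m P \<subseteq> P \<or> P \<subseteq> pb m P"
  shows "pb m P = P"
  using assms(2)
proof
  assume "P \<subseteq> pb m P"
  then show ?thesis unfolding pb_def using ring_vimage_eq_of_subset[OF iso_funpow[OF alpha] P] by blast
next
  note sub = idealD(1)[OF P]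
  assume L: "pb m P \<subseteq> P"
  have "P \<subseteq> ring_vimage R (\<beta> ^^ m) P"
  proof
    fix r assume r: "r \<in> P"
    then have rc: "r \<in> carrier R" using sub by blast
    then have "(\<beta> ^^ m) r \<in> pb m P" using r beta_powD(1) by (simp add: mem_pb_iff)
    then show "r \<in> ring_vimage R (\<beta> ^^ m) P" using L rc unfolding ring_vimage_def by blast
  qed
  then have eq: "ring_vimage R (\<beta> ^^ m) P = P"
    using ring_vimage_eq_of_subset[OF iso_funpow[OF beta] P] by blast
  have "P \<subseteq> pb m P"
  proof
    fix r assume r: "r \<in> P"
    then have "(\<alpha> ^^ m) r \<in> ring_vimage R (\<beta> ^^ m) P"
      using sub alpha_powD(1) by (auto simp: ring_vimage_def subset_iff)
    then have "(\<alpha> ^^ m) r \<in> P" unfolding eq .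
    then show "r \<in> pb m P" using r sub unfolding mem_pb_iff by blast
  qed
  with L show ?thesis by blast
qed

lemma pb_incomparable:
  assumes P: "ideal P R" and "pb i P \<subseteq> pb k P"
  shows "pb i P = pb k P"
proof -
  note sub = idealD(1)[OF P]
  have pbs: "pb m P \<subseteq> carrier R" for m using idealD(1)[OF pb_ideal[OF P]] .
  consider "i \<le> k" | "k \<le> i" by linarith
  then show ?thesis
  proof cases
    case 1
    then have eq: "pb k P = pb i (pb (k - i) P)" by (simp add: pb_pb)
    then have "P \<subseteq> pb (k - i) P" using assms(2) pb_subset_iff[OF sub] by simp
    then have "pb (k - i) P = P" using pb_comparable_imp_eq[OF P] by blast
    then show ?thesis using eq by simp
  next
    case 2
    then have eq: "pb i P = pb k (pb (i - k) P)" by (simp add: pb_pb)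
    then have "pb (i - k) P \<subseteq> P" using assms(2) pb_subset_iff[OF pbs] by simp
    then have "pb (i - k) P = P" using pb_comparable_imp_eq[OF P] by blast
    then show ?thesis using eq by simp
  qed
qed

end

text \<open>A right module over \<open>R[\<theta>; \<alpha>]\<close> is an \<open>R\<close>-module \<open>M\<close> with an additive operator \<open>T\<close>
  (right multiplication by \<open>\<theta>\<close>) such that \<open>T (\<alpha> r x) = r T x\<close>.\<close>

locale skew_module = automorphism_ring R \<alpha> + noetherian_module R M
  for R (structure) and \<alpha> :: "'a \<Rightarrow> 'a" and M (structure) +
  fixes T :: "'c \<Rightarrow> 'c"
  assumes T_closed [simp]: "x \<in> carrier M \<Longrightarrow> T x \<in> carrier M"
    and T_add: "x \<in> carrier M \<Longrightarrow> y \<in> carrier M \<Longrightarrow> T (x \<oplus>\<^bsub>M\<^esub> y) = T x \<oplus>\<^bsub>M\<^esub> T y"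
    and T_smult: "r \<in> carrier R \<Longrightarrow> x \<in> carrier M \<Longrightarrow> T (\<alpha> r \<odot>\<^bsub>M\<^esub> x) = r \<odot>\<^bsub>M\<^esub> T x"
begin

definition ssub :: "'c set \<Rightarrow> bool" where
  "ssub N \<longleftrightarrow> rsub N \<and> (\<forall>x\<in>N. T x \<in> N)"

text \<open>Lists \<open>x \<theta>\<^sup>i\<close> for \<open>i < n\<close> with the highest power
  at the head, so that unfolding \<open>lspan\<close> once splits off the leading term.\<close>

primrec gens :: "'c \<Rightarrow> nat \<Rightarrow> 'c list" where
  "gens x 0 = []"
| "gens x (Suc n) = (T ^^ n) x # gens x n"

text \<open>For \<open>A = carrier R\<close> this is the cyclic submodule \<open>x S\<close>. It is
  also a submodule for any \<beta>-stable ideal \<open>A\<close>, which is how an \<alpha>-stable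
  ideal acts on a simple module later.\<close>

definition orbit_span :: "'a set \<Rightarrow> 'c \<Rightarrow> 'c set" where
  "orbit_span A x = (\<Union>n. lspan A (gens x n))"

lemma T_pow_closed [simp]: "x \<in> carrier M \<Longrightarrow> (T ^^ n) x \<in> carrier M"
  by (induction n) auto

lemma T_zero [simp]: "T \<zero>\<^bsub>M\<^esub> = \<zero>\<^bsub>M\<^esub>"
proof -
  have "T (\<zero>\<^bsub>M\<^esub> \<oplus>\<^bsub>M\<^esub> \<zero>\<^bsub>M\<^esub>) = T \<zero>\<^bsub>M\<^esub> \<oplus>\<^bsub>M\<^esub> T \<zero>\<^bsub>M\<^esub>" by (rule T_add) auto
  then show ?thesis by (simp add: M.add.l_cancel_one')
qed

lemma T_pow_zero [simp]: "(T ^^ n) \<zero>\<^bsub>M\<^esub> = \<zero>\<^bsub>M\<^esub>"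
  by (induction n) auto

lemma T_smult_beta: "r \<in> carrier R \<Longrightarrow> x \<in> carrier M \<Longrightarrow> T (r \<odot>\<^bsub>M\<^esub> x) = \<beta> r \<odot>\<^bsub>M\<^esub> T x"
  using T_smult[of "\<beta> r" x] betaD(1) by simp

lemma T_pow_smult_beta:
  "r \<in> carrier R \<Longrightarrow> x \<in> carrier M \<Longrightarrow> (T ^^ n) (r \<odot>\<^bsub>M\<^esub> x) = (\<beta> ^^ n) r \<odot>\<^bsub>M\<^esub> (T ^^ n) x"
  by (induction n) (auto simp: T_smult_beta beta_powD(1))

lemma T_pow_smult:
  assumes "r \<in> carrier R" "x \<in> carrier M"
  shows "(T ^^ n) ((\<alpha> ^^ n) r \<odot>\<^bsub>M\<^esub> x) = r \<odot>\<^bsub>M\<^esub> (T ^^ n) x"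
  using T_pow_smult_beta[of "(\<alpha> ^^ n) r" x n] alpha_powD(1) assms by simp

lemma T_pow_add: "x \<in> carrier M \<Longrightarrow> y \<in> carrier M \<Longrightarrow> (T ^^ n) (x \<oplus>\<^bsub>M\<^esub> y) = (T ^^ n) x \<oplus>\<^bsub>M\<^esub> (T ^^ n) y"
  by (induction n) (auto simp: T_add)

lemma T_diff:
  assumes "x \<in> carrier M" "y \<in> carrier M"
  shows "T (x \<ominus>\<^bsub>M\<^esub> y) = T x \<ominus>\<^bsub>M\<^esub> T y"
proof -
  have "T (y \<oplus>\<^bsub>M\<^esub> (x \<ominus>\<^bsub>M\<^esub> y)) = T y \<oplus>\<^bsub>M\<^esub> T (x \<ominus>\<^bsub>M\<^esub> y)" using assms T_add by simp
  moreover have "y \<oplus>\<^bsub>M\<^esub> (x \<ominus>\<^bsub>M\<^esub> y) = x" using assms by (simp add: a_minus_def M.a_ac M.r_neg1 M.r_neg)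
  ultimately show ?thesis using add_diff_cancel[of "T y" "T (x \<ominus>\<^bsub>M\<^esub> y)"] assms by simp
qed

lemma set_gens: "set (gens x n) = (\<lambda>i. (T ^^ i) x) ` {..<n}"
  by (induction n) (auto simp: lessThan_Suc)

lemma mem_gens_self: "x \<in> set (gens x (Suc n))"
proof -
  have "(T ^^ 0) x \<in> set (gens x (Suc n))" unfolding set_gens by blast
  then show ?thesis by simp
qed

lemma gens_closed [simp]: "x \<in> carrier M \<Longrightarrow> set (gens x n) \<subseteq> carrier M"
  by (auto simp: set_gens)

lemma ssubD:
  assumes "ssub N"
  shows "rsub N" "\<And>x. x \<in> N \<Longrightarrow> T x \<in> N" "\<And>x n. x \<in> N \<Longrightarrow> (T ^^ n) x \<in> N"
proof -
  show "rsub N" and T: "\<And>x. x \<in> N \<Longrightarrow> T x \<in> N" using assms unfolding ssub_def by auto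
  show "(T ^^ n) x \<in> N" if "x \<in> N" for x n using that T by (induction n) auto
qed

lemma T_vimage_rsub:
  assumes "rsub N"
  shows "rsub {u \<in> carrier M. (T ^^ n) u \<in> N}"
  unfolding rsub_def using rsubD[OF assms] beta_powD(1)
  by (auto simp: T_pow_add T_pow_smult_beta)

lemma T_image_rsub:
  assumes N: "rsub N"
  shows "rsub ((T ^^ n) ` N)"
  unfolding rsub_def
proof (intro conjI ballI)
  note D = rsubD[OF N]
  show "(T ^^ n) ` N \<subseteq> carrier M" using D(1) by auto
  show "\<zero>\<^bsub>M\<^esub> \<in> (T ^^ n) ` N" using D(2) T_pow_zero[of n] by (metis image_eqI)
  fix x assume "x \<in> (T ^^ n) ` N"
  then obtain x' where x': "x' \<in> N" "x = (T ^^ n) x'" by blast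
  then have xc: "x' \<in> carrier M" using D(1) by blast
  show "x \<oplus>\<^bsub>M\<^esub> y \<in> (T ^^ n) ` N" if "y \<in> (T ^^ n) ` N" for y
  proof -
    obtain y' where y': "y' \<in> N" "y = (T ^^ n) y'" using \<open>y \<in> (T ^^ n) ` N\<close> by blast
    then have "x \<oplus>\<^bsub>M\<^esub> y = (T ^^ n) (x' \<oplus>\<^bsub>M\<^esub> y')" using x' xc D(1) by (simp add: T_pow_add subset_iff)
    then show ?thesis using D(3) x'(1) y'(1) by blast
  qed
  fix r assume r: "r \<in> carrier R"
  have "r \<odot>\<^bsub>M\<^esub> x = (T ^^ n) ((\<alpha> ^^ n) r \<odot>\<^bsub>M\<^esub> x')" using x' xc r T_pow_smult by simp
  then show "r \<odot>\<^bsub>M\<^esub> x \<in> (T ^^ n) ` N" using D(4)[OF alpha_powD(1)[OF r] x'(1)] by blast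
qed

lemma lspan_gens_mono:
  assumes "ideal A R" "x \<in> carrier M" "m \<le> n"
  shows "lspan A (gens x m) \<subseteq> lspan A (gens x n)"
  using assms by (intro lspan_list_mono) (auto simp: set_gens)

text \<open>Moving \<theta> past a coefficient applies \<beta> to it, which is why \<open>A\<close>
  must be \<beta>-stable; the bound on the exponents grows by \<open>k\<close>.\<close>

lemma T_pow_lspan_gens:
  assumes A: "ideal A R" and x: "x \<in> carrier M" and st: "\<And>a. a \<in> A \<Longrightarrow> \<beta> a \<in> A"
    and u: "u \<in> lspan A (gens x n)"
  shows "(T ^^ k) u \<in> lspan A (gens x (n + k))"
proof -
  have stk: "(\<beta> ^^ k) a \<in> A" if "a \<in> A" for a k using that st by (induction k) auto
  let ?L = "lspan A (gens x (n + k))"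
  have "lspan A (gens x n) \<subseteq> {u \<in> carrier M. (T ^^ k) u \<in> ?L}"
  proof (rule lspan_subset)
    show "rsub {u \<in> carrier M. (T ^^ k) u \<in> ?L}"
      using T_vimage_rsub[OF lspan_rsub[OF A]] x by simp
    fix y a assume "y \<in> set (gens x n)" and a: "a \<in> A"
    then obtain i where i: "i < n" "y = (T ^^ i) x" by (auto simp: set_gens)
    have ac: "a \<in> carrier R" using a idealD(1)[OF A] by blast
    have "(T ^^ k) (a \<odot>\<^bsub>M\<^esub> y) = (\<beta> ^^ k) a \<odot>\<^bsub>M\<^esub> (T ^^ (k + i)) x"
      using ac x i by (simp add: T_pow_smult_beta funpow_add)
    moreover have "(T ^^ (k + i)) x \<in> set (gens x (n + k))" using i by (auto simp: set_gens)
    ultimately show "a \<odot>\<^bsub>M\<^esub> y \<in> {u \<in> carrier M. (T ^^ k) u \<in> ?L}"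
      using lspan_memI[OF A _ _ stk[OF a]] ac x i by simp
  qed
  then show ?thesis using u by blast
qed

lemma orbit_span_ssub:
  assumes A: "ideal A R" and x: "x \<in> carrier M" and st: "\<And>a. a \<in> A \<Longrightarrow> \<beta> a \<in> A"
  shows "ssub (orbit_span A x)"
proof -
  have L: "rsub (lspan A (gens x n))" for n using lspan_rsub[OF A] x by simp
  have common: "\<exists>n. u \<in> lspan A (gens x n) \<and> v \<in> lspan A (gens x n)"
    if uv: "u \<in> orbit_span A x" "v \<in> orbit_span A x" for u v
  proof -
    obtain m n where "u \<in> lspan A (gens x m)" "v \<in> lspan A (gens x n)"
      using uv unfolding orbit_span_def by blast
    then show ?thesis
      using lspan_gens_mono[OF A x, of m "max m n"] lspan_gens_mono[OF A x, of n "max m n"] by auto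
  qed
  have "rsub (orbit_span A x)"
    unfolding rsub_def
  proof (intro conjI ballI)
    show "orbit_span A x \<subseteq> carrier M" unfolding orbit_span_def using rsubD(1)[OF L] by blast
    show "\<zero>\<^bsub>M\<^esub> \<in> orbit_span A x" unfolding orbit_span_def using rsubD(2)[OF L] by blast
    show "u \<oplus>\<^bsub>M\<^esub> v \<in> orbit_span A x" if "u \<in> orbit_span A x" "v \<in> orbit_span A x" for u v
      using common[OF that] rsubD(3)[OF L] unfolding orbit_span_def by blast
    show "r \<odot>\<^bsub>M\<^esub> u \<in> orbit_span A x" if "r \<in> carrier R" "u \<in> orbit_span A x" for r u
      using that rsubD(4)[OF L] unfolding orbit_span_def by blast
  qed
  moreover have "T u \<in> orbit_span A x" if "u \<in> orbit_span A x" for u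
  proof -
    obtain n where "u \<in> lspan A (gens x n)" using \<open>u \<in> orbit_span A x\<close> unfolding orbit_span_def by blast
    then have "(T ^^ Suc 0) u \<in> lspan A (gens x (n + Suc 0))" using T_pow_lspan_gens[OF A x st] by blast
    then have "\<exists>m. T u \<in> lspan A (gens x m)" unfolding funpow.simps comp_def id_def by blast
    then show ?thesis unfolding orbit_span_def by blast
  qed
  ultimately show ?thesis unfolding ssub_def by blast
qed

lemma cyclic_ssub: "x \<in> carrier M \<Longrightarrow> ssub (orbit_span (carrier R) x)"
  using orbit_span_ssub[OF carrier_ideal] betaD(1) by blast

lemma mem_orbit_span:
  assumes "x \<in> carrier M" shows "(T ^^ k) x \<in> orbit_span (carrier R) x"
proof -
  have "(T ^^ k) x \<in> lspan (carrier R) (gens x (Suc k))"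
    using assms by (intro lspan_carrier_memI) (auto simp: set_gens)
  then show ?thesis unfolding orbit_span_def by blast
qed

lemma orbit_span_subset:
  assumes N: "ssub N" and x: "x \<in> N"
  shows "orbit_span (carrier R) x \<subseteq> N"
proof -
  have "lspan (carrier R) (gens x n) \<subseteq> N" for n
    using rsubD(4)[OF ssubD(1)[OF N]] ssubD(3)[OF N x]
    by (intro lspan_subset[OF ssubD(1)[OF N]]) (auto simp: set_gens)
  then show ?thesis unfolding orbit_span_def by blast
qed

end

subsection \<open>Faithful simple modules\<close>

text \<open>Faithfulness over the skew polynomial ring is recorded through its effect on constants
  and on \<theta>, the two kinds of generators of the ring.\<close>

locale faithful_simple = skew_module +
  assumes simple: "ssub N \<Longrightarrow> N = {\<zero>\<^bsub>M\<^esub>} \<or> N = carrier M"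
    and nontrivial: "carrier M \<noteq> {\<zero>\<^bsub>M\<^esub>}"
    and faithful_R: "r \<in> carrier R \<Longrightarrow> (\<And>x. x \<in> carrier M \<Longrightarrow> r \<odot>\<^bsub>M\<^esub> x = \<zero>\<^bsub>M\<^esub>) \<Longrightarrow> r = \<zero>"
    and faithful_T: "\<exists>x\<in>carrier M. T x \<noteq> \<zero>\<^bsub>M\<^esub>"
begin

lemma orbit_span_eq_carrier:
  assumes "x \<in> carrier M" "x \<noteq> \<zero>\<^bsub>M\<^esub>"
  shows "orbit_span (carrier R) x = carrier M"
  using simple[OF cyclic_ssub[OF assms(1)]] mem_orbit_span[OF assms(1), of 0] assms(2) by auto

text \<open>The kernel of \<theta> is a submodule by semilinearity, so simplicity makes it zero. The
  same argument for the image in \<open>T_surj\<close> shows that \<theta> acts bijectively.\<close>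

lemma T_eq_zeroD:
  assumes "x \<in> carrier M" "T x = \<zero>\<^bsub>M\<^esub>"
  shows "x = \<zero>\<^bsub>M\<^esub>"
proof -
  let ?K = "{x \<in> carrier M. T x = \<zero>\<^bsub>M\<^esub>}"
  have "rsub {x \<in> carrier M. (T ^^ 1) x \<in> {\<zero>\<^bsub>M\<^esub>}}" by (rule T_vimage_rsub[OF zero_rsub])
  then have "ssub ?K" unfolding ssub_def by auto
  then have "?K = {\<zero>\<^bsub>M\<^esub>} \<or> ?K = carrier M" by (rule simple)
  then show ?thesis using assms faithful_T by blast
qed

lemma T_pow_eq_zeroD:
  assumes "x \<in> carrier M" "(T ^^ n) x = \<zero>\<^bsub>M\<^esub>"
  shows "x = \<zero>\<^bsub>M\<^esub>"
  using assms by (induction n) (auto dest: T_eq_zeroD[rotated])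

lemma T_surj:
  assumes "y \<in> carrier M"
  shows "\<exists>x\<in>carrier M. T x = y"
proof -
  have c: "rsub (carrier M)" by (auto simp: rsub_def)
  have "rsub ((T ^^ 1) ` carrier M)" by (rule T_image_rsub[OF c])
  then have "ssub (T ` carrier M)" unfolding ssub_def by auto
  then have or: "T ` carrier M = {\<zero>\<^bsub>M\<^esub>} \<or> T ` carrier M = carrier M" by (rule simple)
  obtain x where "x \<in> carrier M" "T x \<noteq> \<zero>\<^bsub>M\<^esub>" using faithful_T by blast
  then have "T ` carrier M \<noteq> {\<zero>\<^bsub>M\<^esub>}" by blast
  then have "y \<in> T ` carrier M" using or assms by simp
  then show ?thesis by blast
qed

definition ann :: "'c \<Rightarrow> 'a set" where "ann x = {r \<in> carrier R. r \<odot>\<^bsub>M\<^esub> x = \<zero>\<^bsub>M\<^esub>}"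

lemma ann_ideal: "x \<in> carrier M \<Longrightarrow> ideal (ann x) R"
  unfolding ann_def ideal_iff by (auto simp: smult_l_distr smult_assoc1)

text \<open>The classical existence of an associated prime: an annihilator that is maximal among
  those of nonzero elements is prime.\<close>

lemma exists_prime_annihilator: "\<exists>w\<in>carrier M. w \<noteq> \<zero>\<^bsub>M\<^esub> \<and> primeideal (ann w) R"
proof -
  obtain w where w: "w \<in> carrier M" "w \<noteq> \<zero>\<^bsub>M\<^esub>" using nontrivial M.zero_closed by blast
  let ?F = "{ann x | x. x \<in> carrier M \<and> x \<noteq> \<zero>\<^bsub>M\<^esub>}"
  have "ann w \<in> ?F" using w by blast
  then obtain A where A: "A \<in> ?F" "\<forall>J\<in>?F. A \<subseteq> J \<longrightarrow> J = A"
    using exists_maximal_ideal_in[of "ann w" ?F] ann_ideal by blast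
  then obtain x where x: "x \<in> carrier M" "x \<noteq> \<zero>\<^bsub>M\<^esub>" "A = ann x" by blast
  have "primeideal (ann x) R"
  proof (rule primeidealI[OF ann_ideal[OF x(1)] is_cring])
    have "\<one> \<notin> ann x" using x unfolding ann_def by simp
    then show "carrier R \<noteq> ann x" by blast
    fix a b assume ab: "a \<in> carrier R" "b \<in> carrier R" "a \<otimes> b \<in> ann x"
    show "a \<in> ann x \<or> b \<in> ann x"
    proof (cases "a \<odot>\<^bsub>M\<^esub> x = \<zero>\<^bsub>M\<^esub>")
      case False
      have "ann x \<subseteq> ann (a \<odot>\<^bsub>M\<^esub> x)"
        unfolding ann_def using x ab by (auto simp: smult_ac[of _ a])
      moreover have "ann (a \<odot>\<^bsub>M\<^esub> x) \<in> ?F" using False x ab by blast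
      ultimately have "ann (a \<odot>\<^bsub>M\<^esub> x) = ann x" using A(2) x(3) by blast
      moreover have "b \<in> ann (a \<odot>\<^bsub>M\<^esub> x)"
        using ab x unfolding ann_def by (simp add: smult_assoc1 smult_ac[of b a])
      ultimately show ?thesis by blast
    qed (use ab in \<open>auto simp: ann_def\<close>)
  qed
  then show ?thesis using x by blast
qed

end

locale faithful_simple_point = faithful_simple +
  fixes w :: 'c
  assumes w: "w \<in> carrier M" "w \<noteq> \<zero>\<^bsub>M\<^esub>" and ann_w: "primeideal (ann w) R"
begin

text \<open>Defined as an inverse image, so that primality and incomparability are inherited.
  Injectivity of \<theta> identifies it in \<open>mem_Pr_iff\<close> with the annihilator of
  \<open>w \<theta>\<^sup>i\<close>.\<close>

definition Pr :: "nat \<Rightarrow> 'a set" where "Pr i = pb i (ann w)"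

lemma mem_Pr_iff: "r \<in> Pr i \<longleftrightarrow> r \<in> carrier R \<and> r \<odot>\<^bsub>M\<^esub> (T ^^ i) w = \<zero>\<^bsub>M\<^esub>"
proof -
  have "r \<odot>\<^bsub>M\<^esub> (T ^^ i) w = \<zero>\<^bsub>M\<^esub> \<longleftrightarrow> (\<alpha> ^^ i) r \<odot>\<^bsub>M\<^esub> w = \<zero>\<^bsub>M\<^esub>" if "r \<in> carrier R"
    using T_pow_smult[OF that w(1), of i] T_pow_eq_zeroD[of "(\<alpha> ^^ i) r \<odot>\<^bsub>M\<^esub> w" i]
      alpha_powD(1)[OF that, of i] w(1) by auto
  then show ?thesis unfolding Pr_def mem_pb_iff ann_def using alpha_powD(1) by auto
qed

lemma Pr_prime: "primeideal (Pr i) R"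
  unfolding Pr_def using pb_prime[OF ann_w] .

lemma Pr_ideal: "ideal (Pr i) R"
  using primeD(1)[OF Pr_prime] .

lemma Pr_incomparable: "Pr i \<subseteq> Pr k \<Longrightarrow> Pr i = Pr k"
  unfolding Pr_def by (rule pb_incomparable[OF primeD(1)[OF ann_w]])

lemma Pr_shift: "r \<in> carrier R \<Longrightarrow> (\<alpha> ^^ k) r \<in> Pr i \<longleftrightarrow> r \<in> Pr (i + k)"
  unfolding Pr_def mem_pb_iff by (simp add: funpow_add alpha_powD(1))

lemma zero_if_annihilates_orbit:
  assumes r: "r \<in> carrier R" and "\<And>i. r \<in> Pr i"
  shows "r = \<zero>"
proof (rule faithful_R[OF r])
  fix x assume "x \<in> carrier M"
  then have x: "x \<in> orbit_span (carrier R) w" using orbit_span_eq_carrier w by simp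
  have V: "rsub {u \<in> carrier M. r \<odot>\<^bsub>M\<^esub> u \<in> {\<zero>\<^bsub>M\<^esub>}}" by (rule rsub_smult_vimage[OF zero_rsub r])
  have "lspan (carrier R) (gens w n) \<subseteq> {u \<in> carrier M. r \<odot>\<^bsub>M\<^esub> u \<in> {\<zero>\<^bsub>M\<^esub>}}" for n
    using assms(2) w(1) by (intro lspan_subset[OF V] rsubD(4)[OF V]) (auto simp: set_gens mem_Pr_iff)
  then show "r \<odot>\<^bsub>M\<^esub> x = \<zero>\<^bsub>M\<^esub>" using x unfolding orbit_span_def by blast
qed

text \<open>By simplicity \<open>w\<close> lies in the span of \<open>w \<theta>\<close>, ...,
  \<open>w \<theta>\<^sup>N\<close>, so whatever lies in \<open>Pr 1\<close>, ...,
  \<open>Pr N\<close> also lies in \<open>Pr 0\<close>. Hence the intersection \<open>I\<close> of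
  the first \<open>N\<close> primes contains its inverse image under \<alpha>, equals it, and lies
  in every \<open>Pr i\<close>.\<close>

lemma exists_finite_faithful_orbit:
  "\<exists>N. \<forall>r\<in>carrier R. (\<forall>i<N. r \<in> Pr i) \<longrightarrow> r = \<zero>"
proof -
  have Tw: "T w \<in> carrier M" "T w \<noteq> \<zero>\<^bsub>M\<^esub>" using w T_eq_zeroD by auto
  then obtain N where N: "w \<in> lspan (carrier R) (gens (T w) N)"
    using orbit_span_eq_carrier[OF Tw] w unfolding orbit_span_def by blast
  have N0: "N \<noteq> 0" using N w by (auto intro: ccontr)
  define I where "I = {r \<in> carrier R. \<forall>i<N. r \<in> Pr i}"
  have I: "ideal I R"
    unfolding ideal_iff I_def using idealD[OF Pr_ideal] by auto
  have "pb 1 I \<subseteq> I"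
  proof
    fix r assume "r \<in> pb 1 I"
    then have r: "r \<in> carrier R" and *: "\<And>i. i < N \<Longrightarrow> (\<alpha> ^^ 1) r \<in> Pr i"
      unfolding mem_pb_iff I_def by auto
    have **: "r \<in> Pr (Suc i)" if "i < N" for i using *[OF that] Pr_shift[OF r, of 1 i] by simp
    have V: "rsub {u \<in> carrier M. r \<odot>\<^bsub>M\<^esub> u \<in> {\<zero>\<^bsub>M\<^esub>}}" by (rule rsub_smult_vimage[OF zero_rsub r])
    have "lspan (carrier R) (gens (T w) N) \<subseteq> {u \<in> carrier M. r \<odot>\<^bsub>M\<^esub> u \<in> {\<zero>\<^bsub>M\<^esub>}}"
    proof (rule lspan_subset[OF V])
      fix y a assume "y \<in> set (gens (T w) N)" and a: "a \<in> carrier R"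
      then obtain i where i: "i < N" "y = (T ^^ i) (T w)" by (auto simp: set_gens)
      then have y: "y = (T ^^ Suc i) w" by (simp add: funpow_swap1)
      then have "r \<odot>\<^bsub>M\<^esub> y = \<zero>\<^bsub>M\<^esub>" using **[OF i(1)] mem_Pr_iff by blast
      then show "a \<odot>\<^bsub>M\<^esub> y \<in> {u \<in> carrier M. r \<odot>\<^bsub>M\<^esub> u \<in> {\<zero>\<^bsub>M\<^esub>}}"
        using w(1) y by (intro rsubD(4)[OF V a]) auto
    qed
    then have "r \<in> Pr 0" using N r by (auto simp: mem_Pr_iff)
    then have "r \<in> Pr i" if "i < N" for i using that **[of "i - 1"] by (cases i) auto
    then show "r \<in> I" unfolding I_def using r by blast
  qed
  then have pb1: "pb 1 I = I" using pb_comparable_imp_eq[OF I] by blast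
  have pbi: "pb i I = I" for i
  proof (induction i)
    case 0
    then show ?case using pb_0 idealD(1)[OF I] by simp
  next
    case (Suc i)
    have "pb (Suc i) I = pb 1 (pb i I)" by (simp add: pb_pb)
    then show ?case using Suc pb1 by simp
  qed
  have "r = \<zero>" if "r \<in> I" for r
  proof (rule zero_if_annihilates_orbit)
    show r: "r \<in> carrier R" using that idealD(1)[OF I] by blast
    fix i
    have "(\<alpha> ^^ i) r \<in> I" using that pbi[of i] mem_pb_iff by blast
    then have "(\<alpha> ^^ i) r \<in> Pr 0" unfolding I_def using N0 by blast
    then show "r \<in> Pr i" using Pr_shift[OF r, of i 0] by simp
  qed
  then show ?thesis unfolding I_def by blast
qed

lemma prime_contains_Pr:
  assumes "primeideal Q R"
  shows "\<exists>i. Pr i \<subseteq> Q"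
proof -
  obtain N where "\<forall>r\<in>carrier R. (\<forall>i<N. r \<in> Pr i) \<longrightarrow> r = \<zero>" using exists_finite_faithful_orbit by blast
  then have "\<exists>i<N. Pr i \<subseteq> Q"
    using prime_contains_component[OF assms, of N Pr] Pr_ideal idealD(2)[OF primeD(1)[OF assms]] by metis
  then show ?thesis by blast
qed

text \<open>\<open>Pr N\<close> contains the zero intersection of its predecessors, hence one of
  them, and comparable members of an orbit are equal. Cancelling the common inverse image makes the
  sequence periodic from the start.\<close>

lemma Pr_periodic: "\<exists>j>0. \<forall>i. Pr (i + j) = Pr i"
proof -
  obtain N where "\<forall>r\<in>carrier R. (\<forall>i<N. r \<in> Pr i) \<longrightarrow> r = \<zero>" using exists_finite_faithful_orbit by blast
  then have "\<exists>i<N. Pr i \<subseteq> Pr N"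
    using prime_contains_component[OF Pr_prime, of N Pr N] Pr_ideal idealD(2)[OF Pr_ideal] by metis
  then obtain i where i: "i < N" "Pr i \<subseteq> Pr N" by blast
  have aI: "ideal (ann w) R" using primeD(1)[OF ann_w] .
  have "Pr N = pb i (pb (N - i) (ann w))" using i unfolding Pr_def by (simp add: pb_pb)
  then have "ann w \<subseteq> pb (N - i) (ann w)" using i(2) pb_subset_iff[OF idealD(1)[OF aI]] unfolding Pr_def by simp
  then have eq: "pb (N - i) (ann w) = ann w" using pb_comparable_imp_eq[OF aI] by blast
  have "Pr (k + (N - i)) = Pr k" for k
    using arg_cong[OF eq, of "pb k"] unfolding Pr_def pb_pb by (simp add: add.commute)
  then show ?thesis using i(1) by (intro exI[of _ "N - i"]) simp
qed

text \<open>The complement of the union of the minimal primes. As the \<open>Pr i\<close> intersect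
  in zero, its elements are regular; periodicity of the orbit makes it stable under \<beta>.\<close>

definition D :: "'a set" where "D = {d \<in> carrier R. \<forall>i. d \<notin> Pr i}"

lemma D_closed: "d \<in> D \<Longrightarrow> d \<in> carrier R"
  unfolding D_def by blast

lemma D_one: "\<one> \<in> D"
  unfolding D_def using primeD(3)[OF Pr_prime] by blast

lemma D_mult: "c \<in> D \<Longrightarrow> d \<in> D \<Longrightarrow> c \<otimes> d \<in> D"
  unfolding D_def using primeD(4)[OF Pr_prime] by blast

lemma D_beta: "d \<in> D \<Longrightarrow> \<beta> d \<in> D"
proof -
  assume d: "d \<in> D"
  have dc: "d \<in> carrier R" "\<beta> d \<in> carrier R" using d D_closed betaD(1) by auto
  obtain j where j: "j > 0" "\<And>i. Pr (i + j) = Pr i" using Pr_periodic by blast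
  have "\<beta> d \<notin> Pr i" for i
  proof
    assume "\<beta> d \<in> Pr i"
    \<comment> \<open>Undoing \<beta> lowers the index by one. Adding the period
      \<open>j > 0\<close> first provides a predecessor even for \<open>i = 0\<close>.\<close>
    then have "\<beta> d \<in> Pr ((i + j - 1) + 1)" using j by simp
    then have "(\<alpha> ^^ 1) (\<beta> d) \<in> Pr (i + j - 1)" using Pr_shift[OF dc(2), of 1] by blast
    then show False using d dc unfolding D_def by simp
  qed
  then show "\<beta> d \<in> D" unfolding D_def using dc by blast
qed

lemma D_beta_pow: "d \<in> D \<Longrightarrow> (\<beta> ^^ n) d \<in> D"
  by (induction n) (auto intro: D_beta)

lemma D_regular:
  assumes "d \<in> D" "r \<in> carrier R" "d \<otimes> r = \<zero>"
  shows "r = \<zero>"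
proof (rule zero_if_annihilates_orbit[OF assms(2)])
  fix i
  have "d \<otimes> r \<in> Pr i" using assms(3) idealD(2)[OF Pr_ideal] by simp
  then show "r \<in> Pr i" using primeD(4)[OF Pr_prime, of d r i] assms unfolding D_def by blast
qed

lemma reduced:
  assumes r: "r \<in> carrier R" and "r \<otimes> r = \<zero>"
  shows "r = \<zero>"
proof (rule zero_if_annihilates_orbit[OF r])
  fix i
  have "r \<otimes> r \<in> Pr i" using assms(2) idealD(2)[OF Pr_ideal] by simp
  then show "r \<in> Pr i" using primeD(4)[OF Pr_prime r r] by blast
qed

text \<open>In dimension zero \<open>Q\<close> is itself one of the \<open>Pr i\<close>. An
  \<open>e\<close> outside \<open>Q\<close> but in all the other minimal primes multiplies
  \<open>Q\<close> into every \<open>Pr i\<close>, hence to zero.\<close>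

lemma maximal_prime_annihilated:
  assumes dim0: "\<And>P Q. primeideal P R \<Longrightarrow> primeideal Q R \<Longrightarrow> P \<subseteq> Q \<Longrightarrow> P = Q"
    and Q: "primeideal Q R"
  shows "\<exists>e\<in>carrier R - Q. \<forall>r\<in>Q. e \<otimes> r = \<zero>"
proof -
  obtain N where N: "\<forall>r\<in>carrier R. (\<forall>i<N. r \<in> Pr i) \<longrightarrow> r = \<zero>" using exists_finite_faithful_orbit by blast
  \<comment> \<open>Replacing \<open>Q\<close> by the whole ring leaves the intersection of the
    other minimal primes; were it inside \<open>Q\<close>, one of them would be contained in
    \<open>Q\<close> and so equal to it.\<close>
  define J where "J i = (if Pr i = Q then carrier R else Pr i)" for i
  have "\<not> (\<exists>i<N. J i \<subseteq> Q)"
    using dim0[OF Pr_prime Q] primeD(3)[OF Q] unfolding J_def by auto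
  moreover have "ideal (J i) R" for i unfolding J_def using Pr_ideal carrier_ideal by auto
  ultimately obtain e where e: "e \<in> carrier R" "e \<notin> Q" "\<And>i. i < N \<Longrightarrow> e \<in> J i"
    using prime_contains_component[OF Q, of N J] by blast
  have "e \<otimes> r = \<zero>" if r: "r \<in> Q" for r
  proof -
    have rc: "r \<in> carrier R" using r primeD(2)[OF Q] by blast
    have "e \<otimes> r \<in> Pr i" if "i < N" for i
      using e(3)[OF that] r rc e(1) idealD(4,5)[OF Pr_ideal[of i]] unfolding J_def
      by (cases "Pr i = Q") auto
    then show ?thesis using N e(1) rc by simp
  qed
  then show ?thesis using e by blast
qed

end

subsection \<open>Primes avoiding the orbit of a relation\<close>

context noetherian_cring
begin

definition minimal_over :: "'a \<Rightarrow> 'a set \<Rightarrow> bool" where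
  "minimal_over c P \<longleftrightarrow> primeideal P R \<and> c \<in> P \<and>
     (\<forall>P'. primeideal P' R \<longrightarrow> c \<in> P' \<longrightarrow> P' \<subseteq> P \<longrightarrow> P' = P)"

lemma minimal_over_iff:
  assumes c: "c \<in> carrier R"
  shows "minimal_over c P \<longleftrightarrow> minimal_prime_over (adjoin {\<zero>} c) P"
proof -
  have "adjoin {\<zero>} c \<subseteq> P' \<longleftrightarrow> c \<in> P'" if "primeideal P' R" for P'
  proof
    assume "c \<in> P'"
    then show "adjoin {\<zero>} c \<subseteq> P'"
      using c idealD(2)[OF primeD(1)[OF that]] unfolding adjoin_def
      by (auto intro!: idealD(3,5)[OF primeD(1)[OF that]])
  qed (use adjoin_ideal(3)[OF zeroideal c] in blast)
  then show ?thesis unfolding minimal_over_def minimal_prime_over_def by blast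
qed

lemma finite_minimal_over:
  assumes "c \<in> carrier R"
  shows "finite {P. minimal_over c P}"
  using minimal_primes(1)[OF adjoin_ideal(1)[OF zeroideal assms]] minimal_over_iff[OF assms] by simp

lemma exists_minimal_over:
  assumes c: "c \<in> Q" and Q: "primeideal Q R"
  shows "\<exists>P. minimal_over c P \<and> P \<subseteq> Q"
proof -
  have cc: "c \<in> carrier R" using c primeD(2)[OF Q] by blast
  have "adjoin {\<zero>} c \<subseteq> Q"
    using c idealD(2)[OF primeD(1)[OF Q]] unfolding adjoin_def
    by (auto intro!: idealD(3,5)[OF primeD(1)[OF Q]])
  then show ?thesis
    using minimal_primes(2)[OF adjoin_ideal(1)[OF zeroideal cc] Q] minimal_over_iff[OF cc] by blast
qed

text \<open>A regular \<open>q\<close> in \<open>H\<close> prevents \<open>H\<close> from being a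
  minimal prime of \<open>R\<close>, so \<open>Q\<close> would have height at least two, against
  \<open>principal_ideal_theorem\<close>.\<close>

lemma minimal_over_no_smaller:
  assumes "minimal_over c Q" "primeideal H R" "H \<subset> Q" "q \<in> H"
    and "\<And>r. r \<in> carrier R \<Longrightarrow> q \<otimes> r = \<zero> \<Longrightarrow> r = \<zero>"
  shows False
proof -
  have "primeideal Q R" "c \<in> Q" using assms(1) unfolding minimal_over_def by auto
  moreover have "c \<in> carrier R" using calculation primeD(2) by blast
  ultimately show False
    using principal_ideal_theorem[of c Q H q] assms unfolding minimal_over_def by blast
qed

end

context faithful_simple_point
begin

text \<open>Without a relation, every coefficient bringing \<open>w \<theta>\<^sup>n\<close> into
  the span of lower powers would annihilate it. Then \<open>w\<close> could not be a combination of
  \<open>w \<theta>\<close>, \<open>w \<theta>\<^sup>2\<close>, ..., contrary to simplicity.\<close>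

lemma exists_relation:
  assumes K: "subfield K R" "uncountable K"
  shows "\<exists>N. \<exists>a\<in>D. a \<odot>\<^bsub>M\<^esub> (T ^^ N) w \<in> lspan (carrier R) (gens w N) \<and>
    (\<forall>r\<in>carrier R. (\<forall>i<N. r \<in> Pr i) \<longrightarrow> r = \<zero>)"
proof -
  let ?L = "\<lambda>n. lspan (carrier R) (gens w n)"
  have L: "rsub (?L n)" for n using lspan_rsub[OF carrier_ideal] w(1) by simp
  have "\<exists>n. \<exists>a\<in>D. a \<odot>\<^bsub>M\<^esub> (T ^^ n) w \<in> ?L n"
  proof (rule ccontr)
    assume no: "\<not> (\<exists>n. \<exists>a\<in>D. a \<odot>\<^bsub>M\<^esub> (T ^^ n) w \<in> ?L n)"
    \<comment> \<open>The ideal of such coefficients misses \<open>D\<close>, so the countably many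
      \<open>Pr j\<close> cover it and one of them contains it. It also contains
      \<open>Pr n\<close>, and incomparability identifies the two.\<close>
    have LPr: "r \<in> Pr n" if r: "r \<in> carrier R" "r \<odot>\<^bsub>M\<^esub> (T ^^ n) w \<in> ?L n" for r n
    proof -
      define I where "I = {r \<in> carrier R. r \<odot>\<^bsub>M\<^esub> (T ^^ n) w \<in> ?L n}"
      have I: "ideal I R"
        unfolding ideal_iff I_def using rsubD[OF L[of n]] w(1)
        by (auto simp: smult_l_distr smult_assoc1)
      have "I \<subseteq> \<Union>(range Pr)" using no unfolding I_def D_def by blast
      then have "\<exists>J\<in>range Pr. I \<subseteq> J"
        using Pr_ideal by (intro countable_avoidance[OF K I]) auto
      then obtain j where j: "I \<subseteq> Pr j" by blast
      have "Pr n \<subseteq> I" unfolding I_def using mem_Pr_iff rsubD(2)[OF L] by auto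
      then have "Pr n = Pr j" using Pr_incomparable j by blast
      then show ?thesis using j r unfolding I_def by blast
    qed
    \<comment> \<open>In an expression of \<open>w\<close> by higher powers, the leading term lies
      in the span of the lower powers, \<open>w\<close> included. By \<open>LPr\<close> it vanishes,
      which shortens the expression.\<close>
    have notin: "w \<notin> lspan (carrier R) (gens (T w) m)" for m
    proof (induction m)
      case 0
      then show ?case using w by simp
    next
      case (Suc m)
      show ?case
      proof
        assume "w \<in> lspan (carrier R) (gens (T w) (Suc m))"
        then obtain r u where ru: "r \<in> carrier R" "u \<in> lspan (carrier R) (gens (T w) m)"
          "w = r \<odot>\<^bsub>M\<^esub> (T ^^ m) (T w) \<oplus>\<^bsub>M\<^esub> u" by auto
        have "lspan (carrier R) (gens (T w) m) \<subseteq> ?L (Suc m)"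
        proof (rule lspan_list_mono[OF carrier_ideal])
          show "set (gens (T w) m) \<subseteq> set (gens w (Suc m))"
          proof
            fix y assume "y \<in> set (gens (T w) m)"
            then obtain i where "i < m" "y = (T ^^ i) (T w)" by (auto simp: set_gens)
            then have "Suc i < Suc m" "y = (T ^^ Suc i) w" by (auto simp: funpow_swap1)
            then show "y \<in> set (gens w (Suc m))" unfolding set_gens by blast
          qed
        qed (use w in simp)
        then have u: "u \<in> ?L (Suc m)" "u \<in> carrier M" using ru(2) rsubD(1)[OF L] by blast+
        have wL: "w \<in> ?L (Suc m)"
          by (rule lspan_carrier_memI[OF gens_closed[OF w(1)] mem_gens_self])
        have e: "(T ^^ m) (T w) = (T ^^ Suc m) w" by (simp add: funpow_swap1)
        have rT: "r \<odot>\<^bsub>M\<^esub> (T ^^ Suc m) w \<in> carrier M" using ru(1) T_pow_closed[OF w(1), of "Suc m"] by blast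
        have "w = u \<oplus>\<^bsub>M\<^esub> r \<odot>\<^bsub>M\<^esub> (T ^^ Suc m) w"
          using ru(3) rT u(2) unfolding e by (simp only: M.a_comm)
        then have "r \<odot>\<^bsub>M\<^esub> (T ^^ Suc m) w = w \<ominus>\<^bsub>M\<^esub> u" using add_diff_cancel[OF u(2) rT] by metis
        then have "r \<odot>\<^bsub>M\<^esub> (T ^^ Suc m) w \<in> ?L (Suc m)" using rsubD(6)[OF L wL u(1)] by simp
        then have "r \<in> Pr (Suc m)" using LPr ru(1) by blast
        then have "r \<odot>\<^bsub>M\<^esub> (T ^^ m) (T w) = \<zero>\<^bsub>M\<^esub>" unfolding e mem_Pr_iff by blast
        then have "w = u" using ru(3) u(2) by simp
        then show False using Suc ru(2) by blast
      qed
    qed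
    have "T w \<in> carrier M" "T w \<noteq> \<zero>\<^bsub>M\<^esub>" using w T_eq_zeroD by auto
    then show False using orbit_span_eq_carrier notin w(1) unfolding orbit_span_def by blast
  qed
  then obtain n a where na: "a \<in> D" "a \<odot>\<^bsub>M\<^esub> (T ^^ n) w \<in> ?L n" by blast
  \<comment> \<open>Raising the exponent by \<open>k\<close> lets a single \<open>N\<close> serve
    both the relation and the vanishing of the intersection of the \<open>Pr i\<close> with
    \<open>i < N\<close>; the coefficient becomes \<open>\<beta>\<^sup>k a\<close>, still in
    \<open>D\<close>.\<close>
  obtain k where k: "\<forall>r\<in>carrier R. (\<forall>i<k. r \<in> Pr i) \<longrightarrow> r = \<zero>"
    using exists_finite_faithful_orbit by blast
  have "(T ^^ k) (a \<odot>\<^bsub>M\<^esub> (T ^^ n) w) \<in> ?L (n + k)"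
    using T_pow_lspan_gens[OF carrier_ideal w(1) betaD(1) na(2)] by blast
  moreover have "(T ^^ k) (a \<odot>\<^bsub>M\<^esub> (T ^^ n) w) = (\<beta> ^^ k) a \<odot>\<^bsub>M\<^esub> (T ^^ (n + k)) w"
    using T_pow_smult_beta[OF D_closed[OF na(1)] T_pow_closed[OF w(1)]]
    by (simp add: add.commute[of n k] funpow_add)
  moreover have "\<forall>r\<in>carrier R. (\<forall>i<n+k. r \<in> Pr i) \<longrightarrow> r = \<zero>" using k by simp
  ultimately show ?thesis using D_beta_pow[OF na(1)] by metis
qed

end

section \<open>Local finite generation of the simple module\<close>

locale faithful_simple_relation = faithful_simple_point +
  fixes N :: nat and a :: 'a
  assumes a: "a \<in> D" and relation: "a \<odot>\<^bsub>M\<^esub> (T ^^ N) w \<in> lspan (carrier R) (gens w N)"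
    and N_faithful: "\<And>r. r \<in> carrier R \<Longrightarrow> (\<And>i. i < N \<Longrightarrow> r \<in> Pr i) \<Longrightarrow> r = \<zero>"
begin

text \<open>Applying \<open>\<theta>\<^sup>k\<close> to the relation gives one for the generator of
  exponent \<open>N + k\<close> with coefficient \<open>\<beta>\<^sup>k a\<close>, which is outside
  \<open>P\<close>. Up to that multiplier the generator is redundant; \<open>b\<close> is the
  product of the multipliers met on the way down.\<close>

lemma push_down:
  assumes P: "primeideal P R" and aP: "\<And>n. (\<beta> ^^ n) a \<notin> P"
  shows "\<exists>b\<in>carrier R - P. \<forall>u\<in>lspan P (gens w (N + k)). b \<odot>\<^bsub>M\<^esub> u \<in> lspan P (gens w N)"
proof (induction k)
  case 0
  have "rsub (lspan P (gens w N))" using lspan_rsub[OF primeD(1)[OF P]] w(1) by simp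
  then show ?case using primeD(3)[OF P] rsubD(4) by (intro bexI[of _ \<one>]) auto
next
  case (Suc k)
  note PI = primeD(1)[OF P]
  have L: "rsub (lspan P (gens w m))" for m using lspan_rsub[OF PI] w(1) by simp
  obtain b where b: "b \<in> carrier R - P" "\<forall>u\<in>lspan P (gens w (N + k)). b \<odot>\<^bsub>M\<^esub> u \<in> lspan P (gens w N)"
    using Suc by blast
  define c where "c = (\<beta> ^^ k) a"
  have c: "c \<in> carrier R" "c \<notin> P" using aP beta_powD(1) D_closed[OF a] unfolding c_def by auto
  have Tw: "(T ^^ (N + k)) w \<in> carrier M" using w(1) by simp
  have "c \<odot>\<^bsub>M\<^esub> (T ^^ (N + k)) w = (T ^^ k) (a \<odot>\<^bsub>M\<^esub> (T ^^ N) w)"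
    using T_pow_smult_beta[OF D_closed[OF a] T_pow_closed[OF w(1)]] unfolding c_def
    by (simp add: add.commute[of N k] funpow_add)
  then have cT: "c \<odot>\<^bsub>M\<^esub> (T ^^ (N + k)) w \<in> lspan (carrier R) (gens w (N + k))"
    using T_pow_lspan_gens[OF carrier_ideal w(1) betaD(1) relation] by simp
  have "(b \<otimes> c) \<odot>\<^bsub>M\<^esub> u \<in> lspan P (gens w N)" if u: "u \<in> lspan P (gens w (N + Suc k))" for u
  proof -
    obtain p v where pv: "p \<in> P" "v \<in> lspan P (gens w (N + k))" "u = p \<odot>\<^bsub>M\<^esub> (T ^^ (N + k)) w \<oplus>\<^bsub>M\<^esub> v"
      using u by auto
    have cc: "p \<in> carrier R" "v \<in> carrier M" using pv primeD(2)[OF P] rsubD(1)[OF L] by blast+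
    have "c \<odot>\<^bsub>M\<^esub> u = p \<odot>\<^bsub>M\<^esub> (c \<odot>\<^bsub>M\<^esub> (T ^^ (N + k)) w) \<oplus>\<^bsub>M\<^esub> c \<odot>\<^bsub>M\<^esub> v"
      unfolding pv(3) using cc c(1) Tw by (simp add: smult_r_distr smult_ac[of c p])
    moreover have "p \<odot>\<^bsub>M\<^esub> (c \<odot>\<^bsub>M\<^esub> (T ^^ (N + k)) w) \<in> lspan P (gens w (N + k))"
      using smult_lspan_mem[OF PI gens_closed[OF w(1)] pv(1) cT] .
    ultimately have "c \<odot>\<^bsub>M\<^esub> u \<in> lspan P (gens w (N + k))"
      using rsubD(3,4)[OF L] pv(2) c(1) by simp
    moreover have "u \<in> carrier M" using u rsubD(1)[OF L] by blast
    ultimately show ?thesis using b c(1) by (simp add: smult_assoc1)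
  qed
  moreover have "b \<otimes> c \<in> carrier R - P" using b c primeD(4)[OF P, of b c] by auto
  ultimately show ?case by blast
qed

text \<open>Otherwise \<open>push_down\<close> carries the first \<open>N\<close> generators, up to
  multipliers, into \<open>P\<close> times their own span. Nakayama's lemma then yields an element
  outside \<open>P\<close> killing them all, and \<open>N_faithful\<close> makes that element
  zero.\<close>

lemma not_all_divisible:
  assumes P: "primeideal P R" and aP: "\<And>n. (\<beta> ^^ n) a \<notin> P"
  shows "\<exists>i<N. \<forall>t\<in>carrier R - P. \<forall>n. t \<odot>\<^bsub>M\<^esub> (T ^^ i) w \<notin> lspan P (gens w n)"
proof (rule ccontr)
  note PI = primeD(1)[OF P]
  have L: "rsub (lspan P (gens w m))" for m using lspan_rsub[OF PI] w(1) by simp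
  assume "\<not> ?thesis"
  then have no: "\<exists>t\<in>carrier R - P. \<exists>n. t \<odot>\<^bsub>M\<^esub> (T ^^ i) w \<in> lspan P (gens w n)" if "i < N" for i
    using that by blast
  have "\<exists>t\<in>carrier R - P. \<forall>x\<in>set (gens w N). t \<odot>\<^bsub>M\<^esub> x \<in> {\<zero>\<^bsub>M\<^esub>}"
  proof (rule nakayama[OF zero_rsub P gens_closed[OF w(1)]])
    fix x assume "x \<in> set (gens w N)"
    then obtain i where i: "i < N" "x = (T ^^ i) w" by (auto simp: set_gens)
    obtain t n where t: "t \<in> carrier R - P" "t \<odot>\<^bsub>M\<^esub> x \<in> lspan P (gens w n)" using no i by blast
    obtain b where b: "b \<in> carrier R - P" "\<forall>u\<in>lspan P (gens w (N + n)). b \<odot>\<^bsub>M\<^esub> u \<in> lspan P (gens w N)"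
      using push_down[OF P aP] by blast
    have "t \<odot>\<^bsub>M\<^esub> x \<in> lspan P (gens w (N + n))"
      using t(2) lspan_gens_mono[OF PI w(1), of n "N + n"] by auto
    then have "b \<odot>\<^bsub>M\<^esub> (t \<odot>\<^bsub>M\<^esub> x) \<in> lspan P (gens w N)" using b(2) by blast
    moreover have "(b \<otimes> t) \<odot>\<^bsub>M\<^esub> x = b \<odot>\<^bsub>M\<^esub> (t \<odot>\<^bsub>M\<^esub> x)" using b t i w(1) by (simp add: smult_assoc1)
    ultimately have "(b \<otimes> t) \<odot>\<^bsub>M\<^esub> x \<in> msum {\<zero>\<^bsub>M\<^esub>} (lspan P (gens w N))"
      using msum_rsub(3)[OF zero_rsub L] by auto
    moreover have "b \<otimes> t \<in> carrier R - P" using b t primeD(4)[OF P, of b t] by auto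
    ultimately show "\<exists>t\<in>carrier R - P. t \<odot>\<^bsub>M\<^esub> x \<in> msum {\<zero>\<^bsub>M\<^esub>} (lspan P (gens w N))" by blast
  qed
  then obtain t where t: "t \<in> carrier R" "t \<notin> P" "\<forall>x\<in>set (gens w N). t \<odot>\<^bsub>M\<^esub> x = \<zero>\<^bsub>M\<^esub>" by blast
  have "t = \<zero>"
    using t(1,3) by (intro N_faithful) (auto simp: mem_Pr_iff set_gens)
  then show False using t(2) idealD(2)[OF PI] by blast
qed

text \<open>If every prime meeting \<open>D\<close> contained some \<open>\<beta>\<^sup>n a\<close>,
  such primes would all lie in the countable set \<open>MP\<close>, while primes missing
  \<open>D\<close> are among the \<open>Pr i\<close>. So the spectrum would be countable. A chain of
  length two is excluded too: its middle prime contains a regular element and lies strictly below a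
  member of \<open>MP\<close>.\<close>

lemma exists_avoiding_prime:
  assumes K: "subfield K R" "uncountable K"
    and big: "krull_dim_ge R 2 \<or> uncountable {P. primeideal P R}"
  shows "\<exists>Q. primeideal Q R \<and> (\<exists>c\<in>Q. c \<in> D) \<and> (\<forall>n. (\<beta> ^^ n) a \<notin> Q)"
proof (rule ccontr)
  assume no: "\<not> ?thesis"
  have aD: "(\<beta> ^^ n) a \<in> D" for n using D_beta_pow[OF a] .
  define MP where "MP = (\<Union>n. {P. minimal_over ((\<beta> ^^ n) a) P})"
  have cMP: "countable MP"
    unfolding MP_def using finite_minimal_over D_closed[OF aD] by (intro countable_UN) (auto intro: countable_finite)
  have inMP: "Q \<in> MP" if Q: "primeideal Q R" and QD: "\<exists>c\<in>Q. c \<in> D" for Q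
  proof -
    \<comment> \<open>An element \<open>c\<close> of \<open>Q\<close> outside all these primes lies
      in \<open>D\<close>. A prime minimal over \<open>c\<close> then contains some
      \<open>\<beta>\<^sup>n a\<close>, and a prime minimal over that element sits strictly inside
      it, against Krull's theorem.\<close>
    have "Q \<subseteq> \<Union>(MP \<union> range Pr)"
    proof (rule ccontr)
      assume "\<not> Q \<subseteq> \<Union>(MP \<union> range Pr)"
      then obtain c where c: "c \<in> Q" "\<And>P. P \<in> MP \<Longrightarrow> c \<notin> P" "\<And>i. c \<notin> Pr i" by blast
      have cD: "c \<in> D" unfolding D_def using c primeD(2)[OF Q] by blast
      obtain Q' where Q': "minimal_over c Q'" "Q' \<subseteq> Q" using exists_minimal_over[OF c(1) Q] by blast
      then have Q'p: "primeideal Q' R" "c \<in> Q'" unfolding minimal_over_def by auto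
      then obtain n where n: "(\<beta> ^^ n) a \<in> Q'" using no cD by blast
      obtain H where H: "minimal_over ((\<beta> ^^ n) a) H" "H \<subseteq> Q'"
        using exists_minimal_over[OF n Q'p(1)] by blast
      have "H \<in> MP" using H(1) unfolding MP_def by blast
      then have "H \<subset> Q'" using c(2) Q'p(2) H(2) by blast
      have "primeideal H R" "(\<beta> ^^ n) a \<in> H" using H(1) unfolding minimal_over_def by auto
      then show False
        using minimal_over_no_smaller[OF Q'(1) _ \<open>H \<subset> Q'\<close> _ D_regular[OF aD]] by simp
    qed
    moreover have "countable (MP \<union> range Pr)" using cMP by simp
    moreover have "ideal J R" if "J \<in> MP \<union> range Pr" for J
      using that Pr_ideal primeD(1) unfolding MP_def minimal_over_def by blast
    ultimately have "\<exists>J\<in>MP \<union> range Pr. Q \<subseteq> J"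
      using countable_avoidance[OF K primeD(1)[OF Q], of "MP \<union> range Pr"] by blast
    moreover have "\<not> Q \<subseteq> Pr i" for i using QD unfolding D_def by blast
    ultimately obtain H where H: "H \<in> MP" "Q \<subseteq> H" by blast
    then obtain n where n: "minimal_over ((\<beta> ^^ n) a) H" unfolding MP_def by blast
    obtain m where m: "(\<beta> ^^ m) a \<in> Q" using no Q QD by blast
    have "\<not> Q \<subset> H"
    proof
      assume "Q \<subset> H"
      then show False by (rule minimal_over_no_smaller[OF n Q _ m]) (rule D_regular[OF aD])
    qed
    then show ?thesis using H by blast
  qed
  have notD: "Q \<in> range Pr" if Q: "primeideal Q R" and QD: "\<not> (\<exists>c\<in>Q. c \<in> D)" for Q
  proof -
    have "Q \<subseteq> \<Union>(range Pr)" using QD primeD(2)[OF Q] unfolding D_def by blast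
    then have "\<exists>J\<in>range Pr. Q \<subseteq> J"
      using countable_avoidance[OF K primeD(1)[OF Q], of "range Pr"] Pr_ideal by blast
    then obtain k where k: "Q \<subseteq> Pr k" by blast
    obtain i where i: "Pr i \<subseteq> Q" using prime_contains_Pr[OF Q] by blast
    then have "Pr i = Pr k" using k Pr_incomparable by blast
    then show ?thesis using i k by blast
  qed
  have "{P. primeideal P R} \<subseteq> MP \<union> range Pr" using inMP notD by blast
  moreover have "countable (MP \<union> range Pr)" using cMP by simp
  ultimately have "countable {P. primeideal P R}" using countable_subset by blast
  then have "krull_dim_ge R 2" using big by blast
  then obtain P where P: "\<forall>i\<le>2. primeideal (P i) R" "\<forall>i<2. P i \<subset> P (Suc i)"
    unfolding krull_dim_ge_def by blast
  have P012: "primeideal (P 0) R" "primeideal (P 1) R" "primeideal (P 2) R" "P 0 \<subset> P 1" "P 1 \<subset> P 2"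
    using P(1) P(2)[rule_format, of 0] P(2)[rule_format, of 1] by (auto simp: numeral_2_eq_2)
  have "P 1 \<notin> range Pr"
  proof
    assume "P 1 \<in> range Pr"
    then obtain k where k: "P 1 = Pr k" by blast
    obtain i where "Pr i \<subseteq> P 0" using prime_contains_Pr[OF P012(1)] by blast
    then show False using Pr_incomparable[of i k] k P012(4) by blast
  qed
  then obtain d where d: "d \<in> P 1" "d \<in> D" using notD[OF P012(2)] by blast
  then have "P 2 \<in> MP" using inMP[OF P012(3)] P012(5) by blast
  then obtain n where "minimal_over ((\<beta> ^^ n) a) (P 2)" unfolding MP_def by blast
  then show False by (rule minimal_over_no_smaller[OF _ P012(2,5) d(1)]) (rule D_regular[OF d(2)])
qed

text \<open>For a periodic \<open>P\<close>, the intersection \<open>I\<close> of its finitely many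
  inverse images is \<alpha>-stable and meets \<open>D\<close>. Then \<open>W I\<close> is a nonzero
  submodule, hence all of \<open>W\<close>, so every generator lies in the \<open>P\<close>-span,
  against \<open>not_all_divisible\<close> with multiplier one.\<close>

lemma avoiding_prime_not_periodic:
  assumes P: "primeideal P R" and aP: "\<And>n. (\<beta> ^^ n) a \<notin> P" and c: "c \<in> P" "c \<in> D" and m: "m > 0"
  shows "pb m P \<noteq> P"
proof
  assume per: "pb m P = P"
  note PI = primeD(1)[OF P] and PD = primeD(2)[OF P]
  have cc: "c \<in> carrier R" using c PD by blast
  define I where "I = {r \<in> carrier R. \<forall>i. (\<alpha> ^^ i) r \<in> P}"
  have I: "ideal I R" unfolding ideal_iff I_def
    using idealD[OF PI] alpha_powD by auto
  have "I \<subseteq> pb 1 I"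
  proof
    fix r assume r: "r \<in> I"
    then have "(\<alpha> ^^ i) (\<alpha> r) \<in> P" for i
      unfolding I_def using funpow_swap1[of \<alpha> i r] by (metis (mono_tags, lifting) comp_apply funpow.simps(2) mem_Collect_eq)
    then show "r \<in> pb 1 I" using r alphaD(1) unfolding I_def mem_pb_iff by simp
  qed
  then have pbI: "pb 1 I = I" using pb_comparable_imp_eq[OF I] by blast
  have Ib: "\<beta> r \<in> I" if r: "r \<in> I" for r
  proof -
    have "r \<in> carrier R" using r unfolding I_def by blast
    then have "\<beta> r \<in> pb 1 I" using r betaD(1) by (simp add: mem_pb_iff)
    then show ?thesis using pbI by simp
  qed
  \<comment> \<open>The witness is the product of the \<open>\<beta>\<^sup>i c\<close> for
    \<open>i < k\<close>: the factor with index \<open>i\<close> is sent to \<open>c\<close> by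
    \<open>\<alpha>\<^sup>i\<close>.\<close>
  have "\<exists>d\<in>D. \<forall>i<k. (\<alpha> ^^ i) d \<in> P" for k
  proof (induction k)
    case 0
    then show ?case using D_one by blast
  next
    case (Suc k)
    then obtain d where d: "d \<in> D" "\<forall>i<k. (\<alpha> ^^ i) d \<in> P" by blast
    define e where "e = (\<beta> ^^ k) c"
    have e: "e \<in> D" "e \<in> carrier R" "d \<in> carrier R" "(\<alpha> ^^ k) e = c"
      unfolding e_def using D_beta_pow[OF c(2)] D_closed d(1) cc by auto
    have "(\<alpha> ^^ i) (d \<otimes> e) \<in> P" if "i < Suc k" for i
    proof (cases "i = k")
      case True
      then show ?thesis using e c(1) alpha_powD(1,3) idealD(4)[OF PI] by simp
    next
      case False
      then have "(\<alpha> ^^ i) d \<in> P" using d that by simp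
      then show ?thesis using e alpha_powD(1,3) idealD(5)[OF PI] by simp
    qed
    then show ?case using D_mult[OF d(1) e(1)] by blast
  qed
  then obtain d where d: "d \<in> D" "\<forall>i<m. (\<alpha> ^^ i) d \<in> P" by blast
  have dc: "d \<in> carrier R" using d D_closed by blast
  have pbq: "pb (q * m + r) P = pb r P" for q r
  proof (induction q)
    case (Suc q)
    have "pb (Suc q * m + r) P = pb (q * m + r) (pb m P)" unfolding pb_pb by (simp add: add_ac)
    then show ?case using Suc per by simp
  qed simp
  have "d \<in> I"
    unfolding I_def
  proof (intro CollectI conjI allI dc)
    fix i
    have "d \<in> pb (i mod m) P" using d(2) m dc unfolding mem_pb_iff by simp
    then have "d \<in> pb ((i div m) * m + i mod m) P" unfolding pbq .
    then show "(\<alpha> ^^ i) d \<in> P" unfolding mem_pb_iff by simp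
  qed
  have S: "ssub (orbit_span I w)" by (rule orbit_span_ssub[OF I w(1) Ib])
  have "orbit_span I w \<noteq> {\<zero>\<^bsub>M\<^esub>}"
  proof
    assume z: "orbit_span I w = {\<zero>\<^bsub>M\<^esub>}"
    have "d = \<zero>"
    proof (rule zero_if_annihilates_orbit[OF dc])
      fix i
      have "d \<odot>\<^bsub>M\<^esub> (T ^^ i) w \<in> lspan I (gens w (Suc i))"
        by (rule lspan_memI[OF I gens_closed[OF w(1)] _ \<open>d \<in> I\<close>]) (auto simp: set_gens)
      then have "d \<odot>\<^bsub>M\<^esub> (T ^^ i) w = \<zero>\<^bsub>M\<^esub>" using z unfolding orbit_span_def by blast
      then show "d \<in> Pr i" using mem_Pr_iff dc by blast
    qed
    then show False using d(1) idealD(2)[OF Pr_ideal] unfolding D_def by blast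
  qed
  then have all: "orbit_span I w = carrier M" using simple[OF S] by blast
  obtain i where i: "\<forall>t\<in>carrier R - P. \<forall>n. t \<odot>\<^bsub>M\<^esub> (T ^^ i) w \<notin> lspan P (gens w n)"
    using not_all_divisible[OF P aP] by blast
  have "(T ^^ i) w \<in> orbit_span I w" using all w(1) by simp
  then obtain n where "(T ^^ i) w \<in> lspan I (gens w n)" unfolding orbit_span_def by blast
  moreover have "I \<subseteq> P"
  proof
    fix r assume "r \<in> I"
    then have "(\<alpha> ^^ 0) r \<in> P" unfolding I_def by blast
    then show "r \<in> P" by simp
  qed
  ultimately have "(T ^^ i) w \<in> lspan P (gens w n)" using lspan_mono by blast
  then have "\<one> \<odot>\<^bsub>M\<^esub> (T ^^ i) w \<in> lspan P (gens w n)" using w(1) by simp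
  then show False using i primeD(3)[OF P] by blast
qed

end

text \<open>Packages what the hull argument uses. With \<open>x = w \<theta>\<^sup>i\<close>, local
  indivisibility by \<open>c\<close> holds because every \<open>c v\<close> lies in the
  \<open>Q\<close>-span of the orbit of \<open>w\<close>. A prime inside \<open>Q\<close> avoids the
  elements \<open>\<beta>\<^sup>n a\<close> as well, so aperiodicity extends to it.\<close>

lemma (in faithful_simple) exists_aperiodic_prime:
  assumes K: "subfield K R" "uncountable K"
    and big: "krull_dim_ge R 2 \<or> uncountable {P. primeideal P R}"
  shows "\<exists>Q c x. primeideal Q R \<and> c \<in> Q \<and> (\<forall>r\<in>carrier R. c \<otimes> r = \<zero> \<longrightarrow> r = \<zero>) \<and> x \<in> carrier M \<and>
    (\<forall>t\<in>carrier R - Q. \<forall>v\<in>carrier M. t \<odot>\<^bsub>M\<^esub> x \<noteq> c \<odot>\<^bsub>M\<^esub> v) \<and>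
    (\<forall>P. primeideal P R \<longrightarrow> c \<in> P \<longrightarrow> P \<subseteq> Q \<longrightarrow> (\<forall>m>0. pb m P \<noteq> P))"
proof -
  obtain w where w: "w \<in> carrier M" "w \<noteq> \<zero>\<^bsub>M\<^esub>" "primeideal (ann w) R"
    using exists_prime_annihilator by blast
  interpret P: faithful_simple_point R \<alpha> M T w
    by (intro faithful_simple_point.intro faithful_simple_axioms faithful_simple_point_axioms.intro w)
  obtain N a where Na: "a \<in> P.D" "a \<odot>\<^bsub>M\<^esub> (T ^^ N) w \<in> lspan (carrier R) (gens w N)"
    "\<forall>r\<in>carrier R. (\<forall>i<N. r \<in> P.Pr i) \<longrightarrow> r = \<zero>" using P.exists_relation[OF K] by blast
  interpret F: faithful_simple_relation R \<alpha> M T w N a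
    using Na by (intro faithful_simple_relation.intro P.faithful_simple_point_axioms
        faithful_simple_relation_axioms.intro) simp_all
  obtain Q c where Q: "primeideal Q R" "c \<in> Q" "c \<in> P.D" "\<forall>n. (\<beta> ^^ n) a \<notin> Q"
    using F.exists_avoiding_prime[OF K big] by blast
  obtain i where i: "\<forall>t\<in>carrier R - Q. \<forall>n. t \<odot>\<^bsub>M\<^esub> (T ^^ i) w \<notin> lspan Q (gens w n)"
    using F.not_all_divisible[OF Q(1)] Q(4) by blast
  have nd: "t \<odot>\<^bsub>M\<^esub> (T ^^ i) w \<noteq> c \<odot>\<^bsub>M\<^esub> v" if t: "t \<in> carrier R - Q" and v: "v \<in> carrier M" for t v
  proof
    assume e: "t \<odot>\<^bsub>M\<^esub> (T ^^ i) w = c \<odot>\<^bsub>M\<^esub> v"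
    obtain n where "v \<in> lspan (carrier R) (gens w n)"
      using v orbit_span_eq_carrier w unfolding orbit_span_def by blast
    then have "c \<odot>\<^bsub>M\<^esub> v \<in> lspan Q (gens w n)"
      using smult_lspan_mem[OF primeD(1)[OF Q(1)] gens_closed[OF w(1)] Q(2)] by blast
    then show False using i t e by metis
  qed
  have np: "pb m P \<noteq> P" if "primeideal P R" "c \<in> P" "P \<subseteq> Q" "m > 0" for P m
    using F.avoiding_prime_not_periodic[OF that(1) _ that(2) Q(3) that(4)] that(3) Q(4) by blast
  have "(T ^^ i) w \<in> carrier M" using w(1) by simp
  then show ?thesis using Q(1,2) P.D_regular[OF Q(3)] nd np
    by (intro exI[of _ Q] exI[of _ c] exI[of _ "(T ^^ i) w"] conjI ballI allI impI) simp_all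
qed

subsection \<open>Modules over the skew polynomial ring\<close>

lemma rmoduleD:
  assumes "rmodule Q M"
  shows "ring Q" "mzero M \<in> mcarrier M"
    "\<And>x y. x \<in> mcarrier M \<Longrightarrow> y \<in> mcarrier M \<Longrightarrow> madd M x y \<in> mcarrier M"
    "\<And>x y z. x \<in> mcarrier M \<Longrightarrow> y \<in> mcarrier M \<Longrightarrow> z \<in> mcarrier M \<Longrightarrow>
        madd M (madd M x y) z = madd M x (madd M y z)"
    "\<And>x y. x \<in> mcarrier M \<Longrightarrow> y \<in> mcarrier M \<Longrightarrow> madd M x y = madd M y x"
    "\<And>x. x \<in> mcarrier M \<Longrightarrow> madd M (mzero M) x = x"
    "\<And>x. x \<in> mcarrier M \<Longrightarrow> \<exists>y \<in> mcarrier M. madd M x y = mzero M"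
    "\<And>x s. x \<in> mcarrier M \<Longrightarrow> s \<in> carrier Q \<Longrightarrow> mact M x s \<in> mcarrier M"
    "\<And>x s t. x \<in> mcarrier M \<Longrightarrow> s \<in> carrier Q \<Longrightarrow> t \<in> carrier Q \<Longrightarrow>
        mact M x (s \<oplus>\<^bsub>Q\<^esub> t) = madd M (mact M x s) (mact M x t)"
    "\<And>x y s. x \<in> mcarrier M \<Longrightarrow> y \<in> mcarrier M \<Longrightarrow> s \<in> carrier Q \<Longrightarrow>
        mact M (madd M x y) s = madd M (mact M x s) (mact M y s)"
    "\<And>x s t. x \<in> mcarrier M \<Longrightarrow> s \<in> carrier Q \<Longrightarrow> t \<in> carrier Q \<Longrightarrow>
        mact M x (s \<otimes>\<^bsub>Q\<^esub> t) = mact M (mact M x s) t"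
    "\<And>x. x \<in> mcarrier M \<Longrightarrow> mact M x \<one>\<^bsub>Q\<^esub> = x"
  by (insert assms[unfolded rmodule_def]) ((simp; fail) | metis)+

context automorphism_ring
begin

abbreviation S where "S \<equiv> skew_poly_ring R \<alpha>"

definition cst :: "'a \<Rightarrow> nat \<Rightarrow> 'a" where "cst r = (\<lambda>n. if n = 0 then r else \<zero>)"

definition X :: "nat \<Rightarrow> 'a" where "X = (\<lambda>n. if n = 1 then \<one> else \<zero>)"

lemma S_simps:
  "carrier S = {f. (\<forall>n. f n \<in> carrier R) \<and> finite {n. f n \<noteq> \<zero>}}"
  "f \<otimes>\<^bsub>S\<^esub> g = (\<lambda>n. \<Oplus>i\<in>{..n}. f i \<otimes> (\<alpha> ^^ i) (g (n - i)))"
  "\<one>\<^bsub>S\<^esub> = cst \<one>" "\<zero>\<^bsub>S\<^esub> = (\<lambda>n. \<zero>)" "f \<oplus>\<^bsub>S\<^esub> g = (\<lambda>n. f n \<oplus> g n)"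
  by (simp_all add: skew_poly_ring_def cst_def)

lemma S_coeff: "f \<in> carrier S \<Longrightarrow> f n \<in> carrier R"
  by (simp add: S_simps(1))

lemma cst_closed [simp]: "r \<in> carrier R \<Longrightarrow> cst r \<in> carrier S"
  by (auto simp: S_simps(1) cst_def)

lemma X_closed [simp]: "X \<in> carrier S"
  by (auto simp: S_simps(1) X_def)

lemma cst_add: "r \<in> carrier R \<Longrightarrow> s \<in> carrier R \<Longrightarrow> cst (r \<oplus> s) = cst r \<oplus>\<^bsub>S\<^esub> cst s"
  by (auto simp: S_simps cst_def)

lemma finsum_single:
  assumes "i \<le> n" "\<And>j. j \<le> n \<Longrightarrow> j \<noteq> i \<Longrightarrow> h j = \<zero>" "h i \<in> carrier R"
  shows "(\<Oplus>j\<in>{..n::nat}. h j) = h i"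
proof -
  have "(\<Oplus>j\<in>{..n}. h j) = (\<Oplus>j\<in>{..n}. if i = j then h i else \<zero>)"
    using assms by (intro finsum_cong') auto
  also have "\<dots> = h i"
    using assms add.finprod_singleton[of i "{..n}" "\<lambda>_. h i"] by (simp add: finsum_def)
  finally show ?thesis .
qed

lemma cst_mult_coeff:
  assumes "r \<in> carrier R" "f \<in> carrier S"
  shows "(cst r \<otimes>\<^bsub>S\<^esub> f) n = r \<otimes> f n"
  using assms S_coeff[OF assms(2)] alpha_powD(1)
  unfolding S_simps(2) by (subst finsum_single[of 0]) (auto simp: cst_def)

lemma mult_X_coeff:
  assumes "f \<in> carrier S"
  shows "(f \<otimes>\<^bsub>S\<^esub> X) n = (if n = 0 then \<zero> else f (n - 1))"
proof (cases n)
  case 0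
  then show ?thesis using S_coeff[OF assms] unfolding S_simps(2) by (simp add: X_def)
next
  case (Suc m)
  show ?thesis using S_coeff[OF assms] unfolding S_simps(2) Suc
    by (subst finsum_single[of m]) (auto simp: X_def alpha_powD(4,5))
qed

lemma cst_mult: "r \<in> carrier R \<Longrightarrow> s \<in> carrier R \<Longrightarrow> cst (r \<otimes> s) = cst r \<otimes>\<^bsub>S\<^esub> cst s"
  by (rule ext) (simp add: cst_mult_coeff, simp add: cst_def)

lemma X_mult_cst:
  assumes r: "r \<in> carrier R"
  shows "X \<otimes>\<^bsub>S\<^esub> cst r = cst (\<alpha> r) \<otimes>\<^bsub>S\<^esub> X"
proof
  fix n
  have "(X \<otimes>\<^bsub>S\<^esub> cst r) n = (if n = 1 then \<alpha> r else \<zero>)"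
  proof (cases "n = 0")
    case False
    then show ?thesis using r alphaD(1)[OF r] alpha_powD(1)[OF r] unfolding S_simps(2)
      by (subst finsum_single[of 1]) (auto simp: X_def cst_def alphaD(5) alpha_powD(5))
  qed (use alpha_powD(1) r in \<open>simp add: S_simps(2) X_def cst_def\<close>)
  then show "(X \<otimes>\<^bsub>S\<^esub> cst r) n = (cst (\<alpha> r) \<otimes>\<^bsub>S\<^esub> X) n"
    using alphaD(1)[OF r] by (simp add: cst_mult_coeff) (simp add: X_def)
qed

lemma S_shift_closed: "f \<in> carrier S \<Longrightarrow> (\<lambda>n. f (Suc n)) \<in> carrier S"
proof -
  assume f: "f \<in> carrier S"
  have "{n. f (Suc n) \<noteq> \<zero>} = Suc -` {n. f n \<noteq> \<zero>}" by auto
  moreover have "finite (Suc -` {n. f n \<noteq> \<zero>})" using f by (intro finite_vimageI) (auto simp: S_simps(1))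
  ultimately show ?thesis using f by (simp add: S_simps(1))
qed

text \<open>Horner form. With coefficients on the left, right multiplication by \<theta> is a plain
  shift without any twist, so peeling \<theta> off on the right is the convenient recursion.\<close>

lemma S_decomp:
  assumes "f \<in> carrier S"
  shows "f = cst (f 0) \<oplus>\<^bsub>S\<^esub> (\<lambda>n. f (Suc n)) \<otimes>\<^bsub>S\<^esub> X"
proof
  fix n
  show "f n = (cst (f 0) \<oplus>\<^bsub>S\<^esub> (\<lambda>n. f (Suc n)) \<otimes>\<^bsub>S\<^esub> X) n"
    unfolding S_simps(5) mult_X_coeff[OF S_shift_closed[OF assms]]
    using S_coeff[OF assms] by (auto simp: cst_def)
qed

lemma S_bounded: "f \<in> carrier S \<Longrightarrow> \<exists>n. \<forall>i>n. f i = \<zero>"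
proof -
  assume "f \<in> carrier S"
  then have "finite {n. f n \<noteq> \<zero>}" by (simp add: S_simps(1))
  then obtain n where "\<forall>i\<in>{n. f n \<noteq> \<zero>}. i \<le> n" using finite_nat_set_iff_bounded_le by blast
  then show ?thesis by (metis mem_Collect_eq not_le)
qed

text \<open>Commutativity of \<open>R\<close> turns the right action of constants into a left module
  structure. The fields \<open>mult\<close> and \<open>one\<close> are fillers demanded by the
  record type.\<close>

definition rm :: "(nat \<Rightarrow> 'a, 'm) rmod \<Rightarrow> ('a, 'm) module" where
  "rm M = \<lparr>carrier = mcarrier M, mult = madd M, one = mzero M, zero = mzero M,
     add = madd M, smult = (\<lambda>r x. mact M x (cst r))\<rparr>"

lemma rm_simps [simp]:
  "carrier (rm M) = mcarrier M" "zero (rm M) = mzero M" "add (rm M) = madd M"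
  "smult (rm M) r x = mact M x (cst r)"
  by (simp_all add: rm_def)

abbreviation TX :: "(nat \<Rightarrow> 'a, 'm) rmod \<Rightarrow> 'm \<Rightarrow> 'm" where "TX M x \<equiv> mact M x X"

lemma skew_module_rm:
  assumes M: "rmodule S M"
  shows "skew_module R \<alpha> (rm M) (TX M)"
proof -
  note D = rmoduleD[OF M]
  have "abelian_group (rm M)"
  proof (rule abelian_groupI)
    fix x assume "x \<in> carrier (rm M)"
    then show "\<exists>y\<in>carrier (rm M). y \<oplus>\<^bsub>rm M\<^esub> x = \<zero>\<^bsub>rm M\<^esub>" using D(5,7) by simp metis
  qed (use D(2-6) in simp_all)
  moreover have "mact M x (cst (a \<otimes> b)) = mact M (mact M x (cst b)) (cst a)"
    if "a \<in> carrier R" "b \<in> carrier R" "x \<in> mcarrier M" for a b x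
    using D(11)[of x "cst b" "cst a"] that by (simp add: m_comm[of a b] cst_mult)
  ultimately have "module R (rm M)"
    using D(8-10,12) by (intro moduleI is_cring) (simp_all add: cst_add S_simps(3))
  then have nm: "noetherian_module R (rm M)"
    using noetherian_cring_axioms by (simp add: noetherian_module_def)
  have "skew_module_axioms R \<alpha> (rm M) (TX M)"
  proof
    fix x r assume "r \<in> carrier R" "x \<in> carrier (rm M)"
    then show "TX M (\<alpha> r \<odot>\<^bsub>rm M\<^esub> x) = r \<odot>\<^bsub>rm M\<^esub> TX M x"
      using D(11)[of x X "cst r"] D(11)[of x "cst (\<alpha> r)" X] X_mult_cst alphaD(1) by simp
  qed (use D(8,10) in simp_all)
  then show ?thesis
    using nm automorphism_ring_axioms by (simp add: skew_module_def)
qed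

lemma act_decomp:
  assumes M: "rmodule S M" and x: "x \<in> mcarrier M" and s: "s \<in> carrier S"
  shows "mact M x s = madd M (mact M x (cst (s 0))) (TX M (mact M x (\<lambda>n. s (Suc n))))"
proof -
  note D = rmoduleD[OF M]
  interpret Sr: ring S using D(1) .
  have "mact M x s = mact M x (cst (s 0) \<oplus>\<^bsub>S\<^esub> (\<lambda>n. s (Suc n)) \<otimes>\<^bsub>S\<^esub> X)"
    using S_decomp[OF s] by simp
  also have "\<dots> = madd M (mact M x (cst (s 0))) (mact M x ((\<lambda>n. s (Suc n)) \<otimes>\<^bsub>S\<^esub> X))"
    using x S_coeff[OF s] S_shift_closed[OF s] by (intro D(9)) simp_all
  also have "mact M x ((\<lambda>n. s (Suc n)) \<otimes>\<^bsub>S\<^esub> X) = TX M (mact M x (\<lambda>n. s (Suc n)))"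
    using x S_shift_closed[OF s] by (intro D(11)) simp_all
  finally show ?thesis .
qed

lemma act_zero:
  assumes M: "rmodule S M" and x: "x \<in> mcarrier M"
  shows "mact M x (cst \<zero>) = mzero M" "mact M x \<zero>\<^bsub>S\<^esub> = mzero M"
proof -
  interpret skew_module R \<alpha> "rm M" "TX M" by (rule skew_module_rm[OF M])
  show z: "mact M x (cst \<zero>) = mzero M" using smult_l_null[of x] x by simp
  have "cst \<zero> = \<zero>\<^bsub>S\<^esub>" by (auto simp: cst_def S_simps(4))
  then show "mact M x \<zero>\<^bsub>S\<^esub> = mzero M" using z by simp
qed

text \<open>Constants and \<theta> generate the ring: closure under both gives closure under any
  polynomial by induction on a degree bound through the Horner form.\<close>

lemma submod_iff_ssub:
  assumes M: "rmodule S M"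
  shows "submod S M N \<longleftrightarrow> skew_module.ssub R (rm M) (TX M) N"
proof -
  interpret skew_module R \<alpha> "rm M" "TX M" by (rule skew_module_rm[OF M])
  note D = rmoduleD[OF M]
  show ?thesis
  proof
    assume "submod S M N"
    then show "ssub N" unfolding submod_def ssub_def rsub_def by simp
  next
    assume N: "ssub N"
    note ND = rsubD[OF ssubD(1)[OF N]] and NT = ssubD(2)[OF N]
    have act: "mact M x s \<in> N" if "s \<in> carrier S" "\<forall>i>n. s i = \<zero>" "x \<in> N" for x s n
      using that
    proof (induction n arbitrary: s)
      case 0
      then have "s = cst (s 0)" unfolding cst_def by auto
      then show ?case using ND(4)[of "s 0" x] 0 S_coeff[OF 0(1)] by simp
    next
      case (Suc n)
      have "mact M x (\<lambda>n. s (Suc n)) \<in> N" using Suc.IH[OF S_shift_closed[OF Suc.prems(1)]] Suc.prems by simp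
      then have "TX M (mact M x (\<lambda>n. s (Suc n))) \<in> N" using NT by simp
      moreover have "mact M x (cst (s 0)) \<in> N"
        using ND(4)[of "s 0" x] Suc.prems S_coeff[OF Suc.prems(1)] by simp
      ultimately have "madd M (mact M x (cst (s 0))) (TX M (mact M x (\<lambda>n. s (Suc n)))) \<in> N"
        using ND(3) by simp
      moreover have "x \<in> mcarrier M" using ND(1) Suc.prems by auto
      ultimately show ?case using act_decomp[OF M _ Suc.prems(1)] by simp
    qed
    show "submod S M N"
      unfolding submod_def
    proof (intro conjI ballI)
      show "mact M x s \<in> N" if "x \<in> N" "s \<in> carrier S" for x s
        using S_bounded[OF that(2)] act[OF that(2) _ that(1)] by blast
    qed (use ND(1-3) in simp_all)
  qed
qed

text \<open>\<open>x s\<close> is the sum of the \<open>x s\<^sub>i \<theta>\<^sup>i\<close>. The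
  top term keeps its coefficient to the left of \<theta>; in the others \<beta> moves it past
  \<theta>, which puts them into the span of lower powers.\<close>

lemma act_leading:
  assumes M: "rmodule S M" and x: "x \<in> mcarrier M" and "s \<in> carrier S" "\<forall>i>n. s i = \<zero>"
  shows "\<exists>u\<in>noetherian_module.lspan (rm M) (carrier R) (skew_module.gens (TX M) x n).
    mact M x s = madd M ((TX M ^^ n) (mact M x (cst (s n)))) u"
proof -
  interpret skew_module R \<alpha> "rm M" "TX M" by (rule skew_module_rm[OF M])
  note D = rmoduleD[OF M]
  have xc: "x \<in> carrier (rm M)" using x by simp
  have L: "rsub (lspan (carrier R) (gens x n))" for n using lspan_rsub[OF carrier_ideal gens_closed[OF xc]] .
  show ?thesis
    using assms(3,4)
  proof (induction n arbitrary: s)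
    case 0
    then have "s = cst (s 0)" unfolding cst_def by auto
    moreover have "mact M x (cst (s 0)) \<in> mcarrier M" using x S_coeff[OF 0(1)] D(8) by simp
    ultimately show ?case using D(5,6) D(2) by (simp, metis)
  next
    case (Suc n)
    let ?s = "\<lambda>n. s (Suc n)"
    note sc = S_coeff[OF Suc.prems(1)]
    obtain u where u: "u \<in> lspan (carrier R) (gens x n)"
      "mact M x ?s = madd M ((TX M ^^ n) (mact M x (cst (?s n)))) u"
      using Suc.IH[OF S_shift_closed[OF Suc.prems(1)]] Suc.prems by auto
    have uc: "u \<in> carrier (rm M)" using u rsubD(1)[OF L] by blast
    have lc: "mact M x (cst (s (Suc n))) \<in> carrier (rm M)" using sc x D(8) by simp
    have Tlc: "(TX M ^^ n) (mact M x (cst (s (Suc n)))) \<in> carrier (rm M)" using T_pow_closed[OF lc] .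
    have T: "TX M (mact M x ?s) = madd M ((TX M ^^ Suc n) (mact M x (cst (s (Suc n))))) (TX M u)"
      unfolding u(2) using T_add[OF Tlc uc] by simp
    have "(TX M ^^ 1) u \<in> lspan (carrier R) (gens x (n + 1))"
      using T_pow_lspan_gens[OF carrier_ideal xc betaD(1) u(1), of 1] by blast
    then have Tu: "TX M u \<in> lspan (carrier R) (gens x (Suc n))" by (simp del: gens.simps)
    have "mact M x (cst (s 0)) \<in> lspan (carrier R) (gens x (Suc n))"
      using lspan_memI[OF carrier_ideal gens_closed[OF xc] mem_gens_self[of x n] sc[of 0]]
      unfolding rm_simps .
    then have v: "madd M (mact M x (cst (s 0))) (TX M u) \<in> lspan (carrier R) (gens x (Suc n))"
      using rsubD(3)[OF L] Tu by (simp del: gens.simps)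
    have "mact M x s = madd M ((TX M ^^ Suc n) (mact M x (cst (s (Suc n))))) (madd M (mact M x (cst (s 0))) (TX M u))"
    proof -
      have c1: "mact M x (cst (s 0)) \<in> carrier (rm M)" using sc x D(8) by simp
      have c2: "(TX M ^^ Suc n) (mact M x (cst (s (Suc n)))) \<in> carrier (rm M)" using T_pow_closed[OF lc] .
      have c3: "TX M u \<in> carrier (rm M)" using uc T_closed by blast
      show ?thesis unfolding act_decomp[OF M x Suc.prems(1)] T
        using M.a_lcomm[OF c1 c2 c3] by simp
    qed
    then show ?case using v by blast
  qed
qed

lemma faithful_simple_rm:
  assumes W: "simple_module S W" "faithful S W"
  shows "faithful_simple R \<alpha> (rm W) (TX W)"
proof -
  have M: "rmodule S W" and sim: "simple_submod S W (mcarrier W)"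
    using W(1) unfolding simple_module_def by auto
  interpret skew_module R \<alpha> "rm W" "TX W" by (rule skew_module_rm[OF M])
  note D = rmoduleD[OF M]
  have nt: "mcarrier W \<noteq> {mzero W}" using sim unfolding simple_submod_def by blast
  have "faithful_simple_axioms R (rm W) (TX W)"
  proof
    show "N = {\<zero>\<^bsub>rm W\<^esub>} \<or> N = carrier (rm W)" if "ssub N" for N
      using that sim submod_iff_ssub[OF M] rsubD(1)[OF ssubD(1)[OF that]] unfolding simple_submod_def by simp
    show "carrier (rm W) \<noteq> {\<zero>\<^bsub>rm W\<^esub>}" using nt by simp
    show "r = \<zero>" if "r \<in> carrier R" "\<And>x. x \<in> carrier (rm W) \<Longrightarrow> r \<odot>\<^bsub>rm W\<^esub> x = \<zero>\<^bsub>rm W\<^esub>" for r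
    proof -
      have "cst r = \<zero>\<^bsub>S\<^esub>" using W(2) that unfolding faithful_def by simp
      then show ?thesis unfolding S_simps(4) cst_def by meson
    qed
    show "\<exists>x\<in>carrier (rm W). TX W x \<noteq> \<zero>\<^bsub>rm W\<^esub>"
    proof (rule ccontr)
      assume "\<not> ?thesis"
      then have "X = \<zero>\<^bsub>S\<^esub>" using W(2) unfolding faithful_def by simp
      then have "\<one> = \<zero>" unfolding S_simps(4) X_def by meson
      then have "x = mzero W" if "x \<in> mcarrier W" for x
        using D(12)[OF that] act_zero(1)[OF M that] unfolding S_simps(3) by simp
      then show False using nt D(2) by blast
    qed
  qed
  then show ?thesis by (simp add: faithful_simple_def skew_module_axioms)
qed

end

subsection \<open>Krull dimension zero\<close>

context noetherian_cring
begin

lemma exists_prime_above: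
  assumes "ideal L R" "L \<noteq> carrier R"
  shows "\<exists>Q. primeideal Q R \<and> L \<subseteq> Q"
proof -
  let ?F = "{I. ideal I R \<and> I \<noteq> carrier R}"
  have "\<exists>Q\<in>?F. L \<subseteq> Q \<and> (\<forall>J\<in>?F. Q \<subseteq> J \<longrightarrow> J = Q)"
    by (rule exists_maximal_ideal_in) (use assms in simp_all)
  then obtain Q where Q: "Q \<in> ?F" "L \<subseteq> Q" "\<forall>J\<in>?F. Q \<subseteq> J \<longrightarrow> J = Q" by blast
  have "maximalideal Q R"
    using Q(1,3) by (intro maximalidealI) auto
  then show ?thesis using maximalideal_prime Q(2) by blast
qed

text \<open>Only \<open>Q\<close> and \<open>R\<close> lie above a prime \<open>Q\<close>, so a
  chain over \<open>Q\<close> drops at most once. \<open>dcc_mod_of_primes\<close> with the trivial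
  set of multipliers passes from primes to the zero ideal.\<close>

lemma dimension_zero_dcc:
  assumes dim0: "\<And>P Q. primeideal P R \<Longrightarrow> primeideal Q R \<Longrightarrow> P \<subseteq> Q \<Longrightarrow> P = Q"
  shows "dcc_mod {\<one>} {\<zero>}"
proof (rule dcc_mod_of_primes[OF _ _ _ zeroideal])
  fix Q assume Q: "primeideal Q R"
  show "dcc_mod {\<one>} Q"
    unfolding dcc_mod_def
  proof (intro allI impI)
    fix I :: "nat \<Rightarrow> 'a set"
    assume I: "\<forall>n. ideal (I n) R \<and> Q \<subseteq> I n \<and> I (Suc n) \<subseteq> I n"
    have or: "I n = Q \<or> I n = carrier R" for n
    proof (rule ccontr)
      assume n: "\<not> (I n = Q \<or> I n = carrier R)"
      then obtain P where "primeideal P R" "I n \<subseteq> P" using exists_prime_above[of "I n"] I by blast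
      then show False using dim0[OF Q, of P] I n by blast
    qed
    have "\<exists>n. \<forall>k\<ge>n. I n \<subseteq> I k"
    proof (cases "\<exists>n. I n = Q")
      case True
      then obtain n where "I n = Q" by blast
      then show ?thesis using I by blast
    next
      case False
      then show ?thesis using or by blast
    qed
    then obtain n where n: "\<forall>k\<ge>n. I n \<subseteq> I k" by blast
    have "\<one> \<otimes> x \<in> I k" if "k \<ge> n" "x \<in> I n" for k x
      using n that idealD(1)[of "I n"] I by (metis l_one subsetD)
    then show "\<exists>n. \<forall>k\<ge>n. \<forall>x\<in>I n. \<exists>t\<in>{\<one>}. t \<otimes> x \<in> I k" by blast
  qed
qed auto

end

context automorphism_ring
begin

text \<open>The coefficient of index \<open>n\<close> on the right involves only coefficients of
  \<open>p\<close> of smaller index, so \<open>p\<close> vanishes from the bottom up.\<close>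

lemma eq_zero_of_factor:
  assumes p: "p \<in> carrier S" and t: "t \<in> carrier S" and eq: "p = (p \<otimes>\<^bsub>S\<^esub> X) \<otimes>\<^bsub>S\<^esub> t"
  shows "p = \<zero>\<^bsub>S\<^esub>"
proof -
  have "p n = \<zero>" for n
  proof (induction n rule: less_induct)
    case (less n)
    have "p n = (\<Oplus>i\<in>{..n}. (p \<otimes>\<^bsub>S\<^esub> X) i \<otimes> (\<alpha> ^^ i) (t (n - i)))"
      using fun_cong[OF eq, of n] unfolding S_simps(2)[of "p \<otimes>\<^bsub>S\<^esub> X" t] .
    also have "\<dots> = (\<Oplus>i\<in>{..n}. \<zero>)"
    proof (rule finsum_cong')
      fix i assume "i \<in> {..n}"
      then have "(p \<otimes>\<^bsub>S\<^esub> X) i = \<zero>" using less[of "i - 1"] unfolding mult_X_coeff[OF p] by auto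
      then show "(p \<otimes>\<^bsub>S\<^esub> X) i \<otimes> (\<alpha> ^^ i) (t (n - i)) = \<zero>"
        using alpha_powD(1)[OF S_coeff[OF t]] by simp
    qed auto
    finally show ?case by simp
  qed
  then show ?thesis unfolding S_simps(4) by blast
qed

lemma cyclic_submod:
  assumes M: "rmodule S M" and y: "y \<in> mcarrier M"
  shows "submod S M {mact M y s | s. s \<in> carrier S}" "y \<in> {mact M y s | s. s \<in> carrier S}"
proof -
  note D = rmoduleD[OF M]
  interpret Sr: ring S using D(1) .
  show "y \<in> {mact M y s | s. s \<in> carrier S}" using D(12)[OF y] Sr.one_closed by force
  show "submod S M {mact M y s | s. s \<in> carrier S}"
    unfolding submod_def
  proof (intro conjI ballI)
    show "{mact M y s | s. s \<in> carrier S} \<subseteq> mcarrier M" using D(8)[OF y] by blast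
    show "mzero M \<in> {mact M y s | s. s \<in> carrier S}" using act_zero(2)[OF M y] Sr.zero_closed by force
    show "madd M u v \<in> {mact M y s | s. s \<in> carrier S}"
      if "u \<in> {mact M y s | s. s \<in> carrier S}" "v \<in> {mact M y s | s. s \<in> carrier S}" for u v
      using that D(9)[OF y, symmetric] Sr.add.m_closed by blast
    show "mact M u t \<in> {mact M y s | s. s \<in> carrier S}"
      if "u \<in> {mact M y s | s. s \<in> carrier S}" "t \<in> carrier S" for u t
      using that D(11)[OF y, symmetric] Sr.m_closed by blast
  qed
qed

lemma act_diff_zero:
  assumes M: "rmodule S M" and x: "x \<in> mcarrier M" and s: "s \<in> carrier S" "t \<in> carrier S"
    and eq: "mact M x s = mact M x t"
  shows "mact M x (s \<ominus>\<^bsub>S\<^esub> t) = mzero M"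
proof -
  interpret skew_module R \<alpha> "rm M" "TX M" by (rule skew_module_rm[OF M])
  note D = rmoduleD[OF M]
  interpret Sr: ring S using D(1) .
  have st: "s \<ominus>\<^bsub>S\<^esub> t \<in> carrier S" using s by simp
  have c: "mact M x t \<in> carrier (rm M)" "mact M x (s \<ominus>\<^bsub>S\<^esub> t) \<in> carrier (rm M)"
    using D(8) x s st by auto
  have "t \<oplus>\<^bsub>S\<^esub> (s \<ominus>\<^bsub>S\<^esub> t) = s"
    using s by (simp add: a_minus_def Sr.a_lcomm Sr.r_neg)
  then have "madd M (mact M x t) (mact M x (s \<ominus>\<^bsub>S\<^esub> t)) = mact M x t"
    using D(9)[OF x s(2) st] eq by simp
  then show ?thesis using M.add.l_cancel_one'[OF c] by (metis rm_simps(2,3))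
qed

lemma exists_monic_relation:
  assumes E: "rmodule S E" and V: "simple_submod S E V" and ess: "essential_submod S E V"
    and x: "x \<in> mcarrier E"
    and ann: "\<And>Q. primeideal Q R \<Longrightarrow> \<exists>e\<in>carrier R - Q. \<forall>r\<in>Q. e \<otimes> r = \<zero>"
    and red: "\<And>r. r \<in> carrier R \<Longrightarrow> r \<otimes> r = \<zero> \<Longrightarrow> r = \<zero>"
  shows "\<exists>n. (TX E ^^ n) x \<in> noetherian_module.lspan (rm E) (carrier R) (skew_module.gens (TX E) x n)"
proof -
  interpret skew_module R \<alpha> "rm E" "TX E" by (rule skew_module_rm[OF E])
  note D = rmoduleD[OF E]
  interpret Sr: ring S using D(1) .
  have xc: "x \<in> carrier (rm E)" using x by simp
  let ?U = "\<lambda>n. lspan (carrier R) (gens x n)"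
  have U: "rsub (?U n)" for n using lspan_rsub[OF carrier_ideal gens_closed[OF xc]] .
  \<comment> \<open>Leading coefficients of elements annihilating \<open>x\<close>, with the
    coefficient placed before the power of \<theta>. Different degrees are brought together by a
    further power of \<theta>, and \<open>\<one>\<close> in \<open>L\<close> is the monic relation
    sought.\<close>
  define L where "L = {c \<in> carrier R. \<exists>n. (TX E ^^ n) (c \<odot>\<^bsub>rm E\<^esub> x) \<in> ?U n}"
  have shift: "(TX E ^^ k) (c \<odot>\<^bsub>rm E\<^esub> x) \<in> ?U k"
    if "(TX E ^^ n) (c \<odot>\<^bsub>rm E\<^esub> x) \<in> ?U n" "n \<le> k" for n k c
  proof -
    have "(TX E ^^ (k - n)) ((TX E ^^ n) (c \<odot>\<^bsub>rm E\<^esub> x)) \<in> ?U (n + (k - n))"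
      using T_pow_lspan_gens[OF carrier_ideal xc betaD(1) that(1)] by blast
    moreover have "(TX E ^^ (k - n)) ((TX E ^^ n) (c \<odot>\<^bsub>rm E\<^esub> x)) = (TX E ^^ k) (c \<odot>\<^bsub>rm E\<^esub> x)"
      using that(2) funpow_add[of "k - n" n "TX E"] by simp
    ultimately show ?thesis using that(2) by simp
  qed
  have L: "ideal L R"
    unfolding ideal_iff
  proof (intro conjI ballI)
    show "L \<subseteq> carrier R" unfolding L_def by blast
    have "(TX E ^^ 0) (\<zero> \<odot>\<^bsub>rm E\<^esub> x) \<in> ?U 0" using smult_l_null[OF xc] by simp
    then show "\<zero> \<in> L" unfolding L_def by blast
  next
    fix c d assume cd: "c \<in> L" "d \<in> L"
    then obtain m n where mn: "(TX E ^^ m) (c \<odot>\<^bsub>rm E\<^esub> x) \<in> ?U m" "(TX E ^^ n) (d \<odot>\<^bsub>rm E\<^esub> x) \<in> ?U n"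
      unfolding L_def by blast
    have cdc: "c \<in> carrier R" "d \<in> carrier R" using cd unfolding L_def by auto
    let ?k = "max m n"
    have "(TX E ^^ ?k) ((c \<oplus> d) \<odot>\<^bsub>rm E\<^esub> x)
        = (TX E ^^ ?k) (c \<odot>\<^bsub>rm E\<^esub> x) \<oplus>\<^bsub>rm E\<^esub> (TX E ^^ ?k) (d \<odot>\<^bsub>rm E\<^esub> x)"
      unfolding smult_l_distr[OF cdc xc] using cdc xc by (intro T_pow_add smult_closed)
    moreover have "\<dots> \<in> ?U ?k"
      by (rule rsubD(3)[OF U shift[OF mn(1)] shift[OF mn(2)]]) auto
    ultimately have "(TX E ^^ ?k) ((c \<oplus> d) \<odot>\<^bsub>rm E\<^esub> x) \<in> ?U ?k" by metis
    then show "c \<oplus> d \<in> L" unfolding L_def using cdc by blast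
  next
    fix r c assume r: "r \<in> carrier R" and c: "c \<in> L"
    then obtain n where n: "(TX E ^^ n) (c \<odot>\<^bsub>rm E\<^esub> x) \<in> ?U n" unfolding L_def by blast
    have cc: "c \<in> carrier R" using c unfolding L_def by auto
    have "(TX E ^^ n) ((r \<otimes> c) \<odot>\<^bsub>rm E\<^esub> x) = (\<beta> ^^ n) r \<odot>\<^bsub>rm E\<^esub> (TX E ^^ n) (c \<odot>\<^bsub>rm E\<^esub> x)"
      unfolding smult_assoc1[OF r cc xc] using r cc xc by (intro T_pow_smult_beta smult_closed)
    moreover have "\<dots> \<in> ?U n" by (rule rsubD(4)[OF U beta_powD(1)[OF r] n])
    ultimately have "(TX E ^^ n) ((r \<otimes> c) \<odot>\<^bsub>rm E\<^esub> x) \<in> ?U n" by metis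
    then show "r \<otimes> c \<in> L" unfolding L_def using r cc by blast
  qed
  have "L = carrier R"
  proof (rule ccontr)
    assume "L \<noteq> carrier R"
    then obtain Q where Q: "primeideal Q R" "L \<subseteq> Q" using exists_prime_above[OF L] by blast
    then obtain e where e: "e \<in> carrier R" "e \<notin> Q" "\<forall>r\<in>Q. e \<otimes> r = \<zero>" using ann by blast
    have ne: "e \<noteq> \<zero>" using e(2) idealD(2)[OF primeD(1)[OF Q(1)]] by blast
    have ec: "cst e \<in> carrier S" using e(1) by simp
    have "\<exists>s\<in>carrier S. cst e \<otimes>\<^bsub>S\<^esub> s \<noteq> \<zero>\<^bsub>S\<^esub> \<and> mact E x (cst e \<otimes>\<^bsub>S\<^esub> s) = mzero E"
    proof (rule ccontr)
      assume "\<not> ?thesis"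
      then have inj: "cst e \<otimes>\<^bsub>S\<^esub> s = \<zero>\<^bsub>S\<^esub>" if "s \<in> carrier S" "mact E x (cst e \<otimes>\<^bsub>S\<^esub> s) = mzero E" for s
        using that by blast
      define y where "y = mact E x (cst e)"
      have y: "y \<in> mcarrier E" unfolding y_def using D(8)[OF x ec] .
      have ys: "mact E y s = mact E x (cst e \<otimes>\<^bsub>S\<^esub> s)" if "s \<in> carrier S" for s
        unfolding y_def using D(11)[OF x ec that] by simp
      have "cst e \<noteq> \<zero>\<^bsub>S\<^esub>" using ne unfolding S_simps(4) cst_def by metis
      then have "y \<noteq> mzero E" using inj[OF Sr.one_closed] Sr.r_one[OF ec] unfolding y_def by auto
      then have "{mact E y s | s. s \<in> carrier S} \<noteq> {mzero E}" using cyclic_submod(2)[OF E y] by blast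
      then have "{mact E y s | s. s \<in> carrier S} \<inter> V \<noteq> {mzero E}"
        using ess cyclic_submod(1)[OF E y] unfolding essential_submod_def by blast
      moreover have "mzero E \<in> {mact E y s | s. s \<in> carrier S} \<inter> V"
        using cyclic_submod(1)[OF E y] V unfolding simple_submod_def submod_def by blast
      ultimately obtain s where s: "s \<in> carrier S" "mact E y s \<in> V" "mact E y s \<noteq> mzero E" by blast
      define v where "v = mact E y s"
      define p where "p = cst e \<otimes>\<^bsub>S\<^esub> s"
      have p: "p \<in> carrier S" unfolding p_def using ec s(1) by simp
      have v: "v \<in> mcarrier E" "v \<in> V" "v \<noteq> mzero E" unfolding v_def using D(8)[OF y s(1)] s by auto
      have vt: "mact E v t = mact E x (p \<otimes>\<^bsub>S\<^esub> t)" if "t \<in> carrier S" for t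
        unfolding v_def ys[OF s(1)] p_def[symmetric] using D(11)[OF x p that] by simp
      have injp: "p \<otimes>\<^bsub>S\<^esub> t = \<zero>\<^bsub>S\<^esub>" if t: "t \<in> carrier S" "mact E v t = mzero E" for t
        using inj[of "s \<otimes>\<^bsub>S\<^esub> t"] vt[OF t(1)] t s(1) ec unfolding p_def by (simp add: Sr.m_assoc)
      have pnz: "p \<noteq> \<zero>\<^bsub>S\<^esub>"
        using v(3) ys[OF s(1)] act_zero(2)[OF E x] unfolding v_def p_def by auto
      define v' where "v' = mact E v X"
      have v': "v' \<in> mcarrier E" "v' \<in> V"
        unfolding v'_def using D(8)[OF v(1) X_closed] v(2) V unfolding simple_submod_def submod_def by auto
      have "v' \<noteq> mzero E"
      proof
        assume "v' = mzero E"
        then have z: "p \<otimes>\<^bsub>S\<^esub> X = \<zero>\<^bsub>S\<^esub>" using injp[OF X_closed] unfolding v'_def by simp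
        have "p n = \<zero>" for n using fun_cong[OF z, of "Suc n"] unfolding mult_X_coeff[OF p] S_simps(4) by simp
        then show False using pnz unfolding S_simps(4) by blast
      qed
      moreover have "{mact E v' s | s. s \<in> carrier S} \<subseteq> V"
        using v'(2) V unfolding simple_submod_def submod_def by blast
      ultimately have "{mact E v' s | s. s \<in> carrier S} = V"
        using V cyclic_submod[OF E v'(1)] unfolding simple_submod_def by blast
      then obtain t where t: "t \<in> carrier S" "v = mact E v' t" using v(2) by blast
      then have "v = mact E v (X \<otimes>\<^bsub>S\<^esub> t)" unfolding v'_def using D(11)[OF v(1) X_closed] by simp
      then have "mact E v \<one>\<^bsub>S\<^esub> = mact E v (X \<otimes>\<^bsub>S\<^esub> t)" using D(12)[OF v(1)] by simp
      \<comment> \<open>\<open>v\<close> is \<open>x p\<close> with \<open>p\<close> in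
        \<open>e S\<close>, on which acting on \<open>x\<close> is assumed injective; so
        \<open>v = v \<theta> t\<close> lifts to \<open>p = p \<theta> t\<close> in the
        ring.\<close>
      then have "mact E v (\<one>\<^bsub>S\<^esub> \<ominus>\<^bsub>S\<^esub> X \<otimes>\<^bsub>S\<^esub> t) = mzero E"
        using t(1) by (intro act_diff_zero[OF E v(1)]) simp_all
      then have "p \<otimes>\<^bsub>S\<^esub> (\<one>\<^bsub>S\<^esub> \<ominus>\<^bsub>S\<^esub> X \<otimes>\<^bsub>S\<^esub> t) = \<zero>\<^bsub>S\<^esub>" using t(1) by (intro injp) simp_all
      then have "p \<ominus>\<^bsub>S\<^esub> (p \<otimes>\<^bsub>S\<^esub> X) \<otimes>\<^bsub>S\<^esub> t = \<zero>\<^bsub>S\<^esub>"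
        using p t(1) by (simp add: a_minus_def Sr.r_distr Sr.r_minus Sr.m_assoc)
      then have "p = (p \<otimes>\<^bsub>S\<^esub> X) \<otimes>\<^bsub>S\<^esub> t" using p t(1) by simp
      then show False using eq_zero_of_factor[OF p t(1)] pnz by blast
    qed
    then obtain s where s: "s \<in> carrier S" "cst e \<otimes>\<^bsub>S\<^esub> s \<noteq> \<zero>\<^bsub>S\<^esub>" "mact E x (cst e \<otimes>\<^bsub>S\<^esub> s) = mzero E"
      by blast
    define p where "p = cst e \<otimes>\<^bsub>S\<^esub> s"
    have p: "p \<in> carrier S" unfolding p_def using ec s(1) by simp
    have pn: "p n = e \<otimes> s n" for n unfolding p_def using cst_mult_coeff[OF e(1) s(1)] .
    have fin: "finite {n. p n \<noteq> \<zero>}" using p by (simp add: S_simps(1))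
    have "{n. p n \<noteq> \<zero>} \<noteq> {}" using s(2) unfolding p_def[symmetric] S_simps(4) by blast
    define n where "n = Max {n. p n \<noteq> \<zero>}"
    have n: "p n \<noteq> \<zero>" "\<forall>i>n. p i = \<zero>"
      using Max_in[OF fin \<open>{n. p n \<noteq> \<zero>} \<noteq> {}\<close>] Max_ge[OF fin] unfolding n_def
      by (blast, meson mem_Collect_eq not_le)
    have pc: "p n \<in> carrier R" using S_coeff[OF p] .
    obtain u where u: "u \<in> ?U n" "mact E x p = madd E ((TX E ^^ n) (mact E x (cst (p n)))) u"
      using act_leading[OF E x p n(2)] by blast
    have uc: "u \<in> carrier (rm E)" using u(1) rsubD(1)[OF U] by blast
    have tc: "(TX E ^^ n) (p n \<odot>\<^bsub>rm E\<^esub> x) \<in> carrier (rm E)" using T_pow_closed smult_closed[OF pc xc] by blast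
    have "(TX E ^^ n) (p n \<odot>\<^bsub>rm E\<^esub> x) \<oplus>\<^bsub>rm E\<^esub> u = \<zero>\<^bsub>rm E\<^esub>"
      using u(2) s(3) unfolding p_def[symmetric] by simp
    then have "(TX E ^^ n) (p n \<odot>\<^bsub>rm E\<^esub> x) = \<ominus>\<^bsub>rm E\<^esub> u" using M.minus_equality[OF _ uc tc] by metis
    then have "(TX E ^^ n) (p n \<odot>\<^bsub>rm E\<^esub> x) \<in> ?U n" using rsubD(5)[OF U u(1)] by metis
    then have "p n \<in> Q" using Q(2) pc unfolding L_def by blast
    then have "e \<otimes> p n = \<zero>" using e(3) by blast
    \<comment> \<open>The leading coefficient is \<open>e \<otimes> s n\<close> and lies in
      \<open>L\<close>, hence in \<open>Q\<close>, so \<open>e\<close> kills it. Its square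
      therefore vanishes, and reducedness contradicts the choice of the degree
      \<open>n\<close>.\<close>
    moreover have "p n \<otimes> p n = s n \<otimes> (e \<otimes> p n)"
      using pc e(1) S_coeff[OF s(1), of n] pn[of n] by (metis m_assoc m_comm)
    ultimately have "p n \<otimes> p n = \<zero>" using S_coeff[OF s(1), of n] by simp
    then show False using red[OF pc] n(1) by blast
  qed
  then have "\<one> \<in> L" by simp
  then show ?thesis unfolding L_def using smult_one[OF xc] by auto
qed

text \<open>Monic relations for finitely many generators make the \<open>R\<close>-span of finitely
  many powers stable under \<theta>. The module then sits in a finitely generated
  \<open>R\<close>-module over a ring with descending chain condition.\<close>

lemma artinian_if_monic_relations:
  fixes E :: "(nat \<Rightarrow> 'a, 'm) rmod"
  assumes E: "rmodule S E" and dcc: "dcc_mod {\<one>} {\<zero>}"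
    and rel: "\<And>x. x \<in> mcarrier E \<Longrightarrow>
       \<exists>n. (TX E ^^ n) x \<in> noetherian_module.lspan (rm E) (carrier R) (skew_module.gens (TX E) x n)"
    and N: "fin_gen_submod S E N"
  shows "artinian_submod S E N"
proof -
  interpret skew_module R \<alpha> "rm E" "TX E" by (rule skew_module_rm[OF E])
  obtain A where A: "finite A" "A \<subseteq> N" "\<forall>L. submod S E L \<and> A \<subseteq> L \<longrightarrow> N \<subseteq> L"
    and Ns: "submod S E N" using N unfolding fin_gen_submod_def by blast
  have Ac: "A \<subseteq> carrier (rm E)" using A(2) Ns unfolding submod_def by auto
  have "\<forall>x\<in>A. \<exists>n. (TX E ^^ n) x \<in> lspan (carrier R) (gens x n)"
    using rel Ac by auto
  then obtain d where d: "\<And>x. x \<in> A \<Longrightarrow> (TX E ^^ d x) x \<in> lspan (carrier R) (gens x (d x))"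
    by (metis (full_types))
  obtain as where as: "set as = A" using finite_list[OF A(1)] by blast
  define xs where "xs = concat (map (\<lambda>x. gens x (d x)) as)"
  have sxs: "set xs = (\<Union>x\<in>A. set (gens x (d x)))" unfolding xs_def using as by simp
  have xsc: "set xs \<subseteq> carrier (rm E)" unfolding sxs using Ac gens_closed by blast
  let ?L = "lspan (carrier R) xs"
  have L: "rsub ?L" using lspan_rsub[OF carrier_ideal xsc] .
  have sub: "lspan (carrier R) (gens x (d x)) \<subseteq> ?L" if "x \<in> A" for x
    using that sxs by (intro lspan_list_mono[OF carrier_ideal _ xsc]) blast
  have "?L \<subseteq> {u \<in> carrier (rm E). (TX E ^^ 1) u \<in> ?L}"
  proof (rule lspan_subset[OF T_vimage_rsub[OF L]])
    fix y r assume y: "y \<in> set xs" and r: "r \<in> carrier R"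
    then obtain x i where xi: "x \<in> A" "i < d x" "y = (TX E ^^ i) x" unfolding sxs set_gens by blast
    have yc: "y \<in> carrier (rm E)" using y xsc by blast
    have Ty: "TX E y \<in> ?L"
    proof (cases "Suc i < d x")
      case True
      have "TX E y = (TX E ^^ Suc i) x" using xi(3) by simp
      then have "TX E y \<in> set xs" unfolding sxs set_gens using xi(1) True by blast
      then show ?thesis using lspan_carrier_memI[OF xsc] by blast
    next
      case False
      then have "d x = Suc i" using xi(2) by simp
      then have "TX E y = (TX E ^^ d x) x" using xi(3) by simp
      then show ?thesis using d[OF xi(1)] sub[OF xi(1)] by auto
    qed
    have "TX E (r \<odot>\<^bsub>rm E\<^esub> y) = \<beta> r \<odot>\<^bsub>rm E\<^esub> TX E y" by (rule T_smult_beta[OF r yc])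
    then have "TX E (r \<odot>\<^bsub>rm E\<^esub> y) \<in> ?L" using rsubD(4)[OF L betaD(1)[OF r] Ty] by metis
    moreover have "r \<odot>\<^bsub>rm E\<^esub> y \<in> carrier (rm E)" using r yc by (rule smult_closed)
    ultimately show "r \<odot>\<^bsub>rm E\<^esub> y \<in> {u \<in> carrier (rm E). (TX E ^^ 1) u \<in> ?L}" by simp
  qed
  then have "ssub ?L" unfolding ssub_def using L by auto
  then have Ls: "submod S E ?L" using submod_iff_ssub[OF E] by simp
  have "A \<subseteq> ?L"
  proof
    fix x assume x: "x \<in> A"
    show "x \<in> ?L"
    proof (cases "d x")
      \<comment> \<open>Here the list of powers is empty, so it does not contain \<open>x\<close>;
        the relation of degree zero itself places \<open>x\<close> in the span.\<close>
      case 0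
      then have "x \<in> lspan (carrier R) (gens x (d x))" using d[OF x] by simp
      then show ?thesis using sub[OF x] by blast
    next
      case (Suc m)
      have "x \<in> lspan (carrier R) (gens x (d x))"
        unfolding Suc using Ac x by (intro lspan_carrier_memI gens_closed mem_gens_self) blast
      then show ?thesis using sub[OF x] by blast
    qed
  qed
  then have NL: "N \<subseteq> ?L" using A(3) Ls by blast
  show ?thesis
    unfolding artinian_submod_def
  proof
    assume "\<exists>C :: nat \<Rightarrow> 'm set. \<forall>i. submod S E (C i) \<and> C i \<subseteq> N \<and> C (Suc i) \<subset> C i"
    then obtain C :: "nat \<Rightarrow> 'm set" where C: "\<forall>i. submod S E (C i) \<and> C i \<subseteq> N \<and> C (Suc i) \<subset> C i" by blast
    have "\<exists>n. \<forall>k\<ge>n. C k = C n"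
    proof (rule descending_chain_lspan[OF dcc xsc])
      show "rsub (C n)" for n using C submod_iff_ssub[OF E] ssubD(1) by blast
      show "C (Suc n) \<subseteq> C n" for n using C by blast
      show "C n \<subseteq> ?L" for n using C NL by blast
    qed
    then obtain n where "C (Suc n) = C n" by (meson le_Suc_eq order_refl)
    then show False using C by blast
  qed
qed

theorem diamond_dimension_zero:
  fixes W :: "(nat \<Rightarrow> 'a, 'w) rmod"
  assumes W: "simple_module S W" "faithful S W" and dim: "krull_dim_zero R"
  shows "diamond S TYPE('m)"
proof -
  have dim0: "P = Q" if "primeideal P R" "primeideal Q R" "P \<subseteq> Q" for P Q
  proof (rule ccontr)
    assume "P \<noteq> Q"
    then have "krull_dim_ge R 1" unfolding krull_dim_ge_def using that
      by (intro exI[of _ "\<lambda>i::nat. if i = 0 then P else Q"]) auto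
    then show False using dim unfolding krull_dim_zero_def by blast
  qed
  interpret W: faithful_simple R \<alpha> "rm W" "TX W" by (rule faithful_simple_rm[OF W])
  obtain w where w: "w \<in> carrier (rm W)" "w \<noteq> \<zero>\<^bsub>rm W\<^esub>" "primeideal (W.ann w) R"
    using W.exists_prime_annihilator by blast
  interpret P: faithful_simple_point R \<alpha> "rm W" "TX W" w
    by (intro faithful_simple_point.intro W.faithful_simple_axioms faithful_simple_point_axioms.intro w)
  show ?thesis
    unfolding diamond_def
  proof (intro allI impI, elim conjE)
    fix E :: "(nat \<Rightarrow> 'a, 'm) rmod" and V N
    assume h: "injective_module S E" "simple_submod S E V" "essential_submod S E V" "fin_gen_submod S E N"
    have E: "rmodule S E" using h(1) unfolding injective_module_def by blast
    show "artinian_submod S E N"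
      using exists_monic_relation[OF E h(2,3) _ P.maximal_prime_annihilated[OF dim0] P.reduced]
      by (intro artinian_if_monic_relations[OF E dimension_zero_dcc[OF dim0] _ h(4)]) blast+
  qed
qed

end

subsection \<open>A cyclic non-Artinian submodule of the injective hull\<close>

lemma (in noetherian_module) diff_eq_zeroD:
  assumes "a \<in> carrier M" "b \<in> carrier M" "a \<ominus>\<^bsub>M\<^esub> b = \<zero>\<^bsub>M\<^esub>"
  shows "a = b"
  using assms M.minus_equality[of a "\<ominus>\<^bsub>M\<^esub> b"] by (simp add: a_minus_def)

context automorphism_ring
begin

lemma rmodule_submod:
  assumes M: "rmodule S M" and N: "submod S M N"
  shows "rmodule S (M\<lparr>mcarrier := N\<rparr>)"
proof -
  interpret skew_module R \<alpha> "rm M" "TX M" by (rule skew_module_rm[OF M])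
  note D = rmoduleD[OF M]
  have NC: "x \<in> N \<Longrightarrow> x \<in> mcarrier M" for x using N unfolding submod_def by blast
  have rs: "rsub N" using N submod_iff_ssub[OF M] ssubD(1) by blast
  have "\<exists>y\<in>N. madd M x y = mzero M" if x: "x \<in> N" for x
  proof
    show "\<ominus>\<^bsub>rm M\<^esub> x \<in> N" by (rule rsubD(5)[OF rs x])
    show "madd M x (\<ominus>\<^bsub>rm M\<^esub> x) = mzero M" using M.r_neg[of x] NC[OF x] by simp
  qed
  then show ?thesis
    using N D NC unfolding rmodule_def submod_def by simp
qed

lemma submod_submod_iff:
  assumes "submod S M N"
  shows "submod S (M\<lparr>mcarrier := N\<rparr>) L \<longleftrightarrow> submod S M L \<and> L \<subseteq> N"
  using assms unfolding submod_def by auto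

text \<open>Regularity of \<open>c\<close> makes \<open>c s \<mapsto> v s\<close> well defined on
  the right ideal \<open>c S\<close>. An element representing this map takes \<open>c\<close> to
  \<open>v\<close>.\<close>

lemma injective_divisible:
  assumes E: "injective_module S E" and c: "c \<in> carrier R"
    and reg: "\<And>r. r \<in> carrier R \<Longrightarrow> c \<otimes> r = \<zero> \<Longrightarrow> r = \<zero>" and v: "v \<in> mcarrier E"
  shows "\<exists>y\<in>mcarrier E. mact E y (cst c) = v"
proof -
  have M: "rmodule S E" using E unfolding injective_module_def by blast
  note D = rmoduleD[OF M]
  interpret Sr: ring S using D(1) .
  have cc: "cst c \<in> carrier S" using c by simp
  have inj: "s = t" if st: "s \<in> carrier S" "t \<in> carrier S" "cst c \<otimes>\<^bsub>S\<^esub> s = cst c \<otimes>\<^bsub>S\<^esub> t" for s t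
  proof
    fix n
    have sc: "s n \<in> carrier R" "t n \<in> carrier R" using st S_coeff by auto
    have "c \<otimes> s n = c \<otimes> t n"
      using fun_cong[OF st(3), of n] cst_mult_coeff[OF c st(1)] cst_mult_coeff[OF c st(2)] by simp
    then have "c \<otimes> (s n \<ominus> t n) = \<zero>"
      using sc c by (simp add: a_minus_def r_distr r_minus r_neg)
    then show "s n = t n" using reg[of "s n \<ominus> t n"] sc by simp
  qed
  define I where "I = {cst c \<otimes>\<^bsub>S\<^esub> s | s. s \<in> carrier S}"
  define f where "f a = mact E v (THE s. s \<in> carrier S \<and> a = cst c \<otimes>\<^bsub>S\<^esub> s)" for a
  have f: "f (cst c \<otimes>\<^bsub>S\<^esub> s) = mact E v s" if "s \<in> carrier S" for s
  proof -
    have "(THE t. t \<in> carrier S \<and> cst c \<otimes>\<^bsub>S\<^esub> s = cst c \<otimes>\<^bsub>S\<^esub> t) = s"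
      using that inj by (intro the_equality) metis+
    then show ?thesis unfolding f_def by simp
  qed
  have add: "cst c \<otimes>\<^bsub>S\<^esub> s \<oplus>\<^bsub>S\<^esub> cst c \<otimes>\<^bsub>S\<^esub> t = cst c \<otimes>\<^bsub>S\<^esub> (s \<oplus>\<^bsub>S\<^esub> t)"
    if "s \<in> carrier S" "t \<in> carrier S" for s t
    using Sr.r_distr[OF that cc] by simp
  have mul: "cst c \<otimes>\<^bsub>S\<^esub> s \<otimes>\<^bsub>S\<^esub> t = cst c \<otimes>\<^bsub>S\<^esub> (s \<otimes>\<^bsub>S\<^esub> t)"
    if "s \<in> carrier S" "t \<in> carrier S" for s t
    using Sr.m_assoc[OF cc that] .
  have "right_ideal S I"
    unfolding right_ideal_def
  proof (intro conjI ballI)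
    show "I \<subseteq> carrier S" unfolding I_def using cc by auto
    show "\<zero>\<^bsub>S\<^esub> \<in> I" unfolding I_def using Sr.r_null[OF cc] Sr.zero_closed by force
    show "a \<oplus>\<^bsub>S\<^esub> b \<in> I" if "a \<in> I" "b \<in> I" for a b
      using that add Sr.add.m_closed unfolding I_def by blast
    show "a \<otimes>\<^bsub>S\<^esub> s \<in> I" if "a \<in> I" "s \<in> carrier S" for a s
      using that mul Sr.m_closed unfolding I_def by blast
  qed
  moreover have "f \<in> I \<rightarrow> mcarrier E" unfolding I_def using f D(8)[OF v] by auto
  moreover have "\<forall>a\<in>I. \<forall>b\<in>I. f (a \<oplus>\<^bsub>S\<^esub> b) = madd E (f a) (f b)"
    unfolding I_def using f add D(9)[OF v] by auto
  moreover have "\<forall>a\<in>I. \<forall>s\<in>carrier S. f (a \<otimes>\<^bsub>S\<^esub> s) = mact E (f a) s"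
    unfolding I_def using f mul D(11)[OF v] by auto
  ultimately obtain e where e: "e \<in> mcarrier E" "\<forall>a\<in>I. f a = mact E e a"
    using E unfolding injective_module_def by blast
  have "cst c \<otimes>\<^bsub>S\<^esub> \<one>\<^bsub>S\<^esub> \<in> I" unfolding I_def using Sr.one_closed by blast
  then have "mact E e (cst c \<otimes>\<^bsub>S\<^esub> \<one>\<^bsub>S\<^esub>) = mact E v \<one>\<^bsub>S\<^esub>" using e(2) f[OF Sr.one_closed] by metis
  then show ?thesis using e(1) D(12)[OF v] Sr.r_one[OF cc] by auto
qed

theorem exists_cyclic_not_artinian:
  fixes E :: "(nat \<Rightarrow> 'a, 'm) rmod"
  assumes inj: "injective_module S E" and V: "simple_submod S E V" and ess: "essential_submod S E V"
    and faith: "\<And>s. s \<in> carrier S \<Longrightarrow> (\<And>v. v \<in> V \<Longrightarrow> mact E v s = mzero E) \<Longrightarrow> s = \<zero>\<^bsub>S\<^esub>"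
    and K: "subfield K R" "uncountable K"
    and big: "krull_dim_ge R 2 \<or> uncountable {P. primeideal P R}"
  shows "\<exists>N. fin_gen_submod S E N \<and> \<not> artinian_submod S E N"
proof -
  have E: "rmodule S E" using inj unfolding injective_module_def by blast
  note D = rmoduleD[OF E]
  have Vs: "submod S E V" using V unfolding simple_submod_def by blast
  have VE: "v \<in> V \<Longrightarrow> v \<in> mcarrier E" for v using Vs unfolding submod_def by blast
  let ?V = "E\<lparr>mcarrier := V\<rparr>"
  have "simple_module S ?V"
    unfolding simple_module_def simple_submod_def submod_submod_iff[OF Vs]
    using rmodule_submod[OF E Vs] V Vs unfolding simple_submod_def by auto
  moreover have "faithful S ?V" unfolding faithful_def using faith by simp
  ultimately interpret F: faithful_simple R \<alpha> "rm ?V" "TX ?V" by (rule faithful_simple_rm)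
  interpret skew_module R \<alpha> "rm E" "TX E" by (rule skew_module_rm[OF E])
  obtain Q c x where Q: "primeideal Q R" "c \<in> Q" and reg: "\<forall>r\<in>carrier R. c \<otimes> r = \<zero> \<longrightarrow> r = \<zero>"
    and x: "x \<in> V" and nd: "\<forall>t\<in>carrier R - Q. \<forall>v\<in>V. mact E x (cst t) \<noteq> mact E v (cst c)"
    and np: "\<forall>P. primeideal P R \<longrightarrow> c \<in> P \<longrightarrow> P \<subseteq> Q \<longrightarrow> (\<forall>m>0. pb m P \<noteq> P)"
    using F.exists_aperiodic_prime[OF K big] by (simp, metis)
  have c: "c \<in> carrier R" using Q primeD(2) by blast
  have Vsub: "ssub V" using Vs submod_iff_ssub[OF E] by blast
  note VD = rsubD[OF ssubD(1)[OF Vsub]]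
  obtain y0 where y0: "y0 \<in> mcarrier E" "mact E y0 (cst c) = x"
    using injective_divisible[OF inj c _ VE[OF x]] reg by blast
  define A where "A y = {r \<in> carrier R. r \<odot>\<^bsub>rm E\<^esub> y \<in> V}" for y
  have A: "ideal (A y) R" if y: "y \<in> carrier (rm E)" for y
    unfolding ideal_iff A_def
  proof (intro conjI ballI)
    show "\<zero> \<in> {r \<in> carrier R. r \<odot>\<^bsub>rm E\<^esub> y \<in> V}" using smult_l_null[OF y] VD(2) by simp
    show "a \<oplus> b \<in> {r \<in> carrier R. r \<odot>\<^bsub>rm E\<^esub> y \<in> V}"
      if "a \<in> {r \<in> carrier R. r \<odot>\<^bsub>rm E\<^esub> y \<in> V}" "b \<in> {r \<in> carrier R. r \<odot>\<^bsub>rm E\<^esub> y \<in> V}" for a b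
      using that smult_l_distr[of a b y] VD(3) y by simp
    show "r \<otimes> a \<in> {r \<in> carrier R. r \<odot>\<^bsub>rm E\<^esub> y \<in> V}"
      if "r \<in> carrier R" "a \<in> {r \<in> carrier R. r \<odot>\<^bsub>rm E\<^esub> y \<in> V}" for r a
      using that smult_assoc1[of r a y] VD(4)[of r "a \<odot>\<^bsub>rm E\<^esub> y"] y by simp
  qed blast
  have y0c: "y0 \<in> carrier (rm E)" using y0 by simp
  \<comment> \<open>If \<open>r y0\<close> is some \<open>v\<close> in \<open>V\<close>, then
    multiplying by \<open>c\<close> gives \<open>r x = c v\<close>, which indivisibility allows only
    for \<open>r\<close> in \<open>Q\<close>.\<close>
  have A0: "A y0 \<subseteq> Q"
  proof
    fix r assume r: "r \<in> A y0"
    then have rc: "r \<in> carrier R" "r \<odot>\<^bsub>rm E\<^esub> y0 \<in> V" unfolding A_def by auto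
    have "r \<odot>\<^bsub>rm E\<^esub> (c \<odot>\<^bsub>rm E\<^esub> y0) = c \<odot>\<^bsub>rm E\<^esub> (r \<odot>\<^bsub>rm E\<^esub> y0)" by (rule smult_ac[OF rc(1) c y0c])
    then have "mact E x (cst r) = mact E (r \<odot>\<^bsub>rm E\<^esub> y0) (cst c)" using y0(2) by simp
    then show "r \<in> Q" using nd rc by blast
  qed
  have cA0: "c \<in> A y0" unfolding A_def using c y0(2) x by simp
  \<comment> \<open>Maximality is sought among annihilators inside \<open>Q\<close>, above
    \<open>A y0\<close>. This keeps the resulting prime between \<open>c\<close> and
    \<open>Q\<close>, where aperiodicity is known.\<close>
  let ?F = "{A y | y. y \<in> carrier (rm E) \<and> A y \<subseteq> Q}"
  have "\<exists>P\<in>?F. A y0 \<subseteq> P \<and> (\<forall>J\<in>?F. P \<subseteq> J \<longrightarrow> J = P)"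
  proof (rule exists_maximal_ideal_in)
    show "A y0 \<in> ?F" using A0 y0c by blast
    show "ideal I R" if "I \<in> ?F" for I using that A by blast
  qed
  then obtain P' where P': "P' \<in> ?F" "A y0 \<subseteq> P'" "\<forall>J\<in>?F. P' \<subseteq> J \<longrightarrow> J = P'" by blast
  then obtain y where y': "P' = A y" "y \<in> carrier (rm E)" "A y \<subseteq> Q" by blast
  then have y: "y \<in> carrier (rm E)" "A y \<subseteq> Q" "A y0 \<subseteq> A y" using P'(2) by auto
  have max: "A z = A y" if "z \<in> carrier (rm E)" "A z \<subseteq> Q" "A y \<subseteq> A z" for z
    using P'(3) that y'(1) by blast
  define P where "P = A y"
  have mono: "A y \<subseteq> A (a \<odot>\<^bsub>rm E\<^esub> y)" if a: "a \<in> carrier R" for a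
  proof
    fix r assume "r \<in> A y"
    then have r: "r \<in> carrier R" "r \<odot>\<^bsub>rm E\<^esub> y \<in> V" unfolding A_def by auto
    have "r \<odot>\<^bsub>rm E\<^esub> (a \<odot>\<^bsub>rm E\<^esub> y) \<in> V" unfolding smult_ac[OF r(1) a y(1)] by (rule VD(4)[OF a r(2)])
    then show "r \<in> A (a \<odot>\<^bsub>rm E\<^esub> y)" unfolding A_def using r(1) by blast
  qed
  have memA: "a \<in> A (t \<odot>\<^bsub>rm E\<^esub> y) \<longleftrightarrow> a \<otimes> t \<in> A y" if at: "a \<in> carrier R" "t \<in> carrier R" for a t
    using smult_assoc1[OF at y(1)] at unfolding A_def by simp
  have P: "primeideal P R"
  proof (rule primeidealI)
    show "ideal P R" unfolding P_def by (rule A[OF y(1)])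
    show "cring R" by (rule is_cring)
    show "carrier R \<noteq> P" using y(2) primeD(3)[OF Q(1)] unfolding P_def by blast
    fix a b assume ab: "a \<in> carrier R" "b \<in> carrier R" "a \<otimes> b \<in> P"
    \<comment> \<open>If the annihilator of \<open>a y\<close> stays in \<open>Q\<close>, it equals
      \<open>P\<close> and contains \<open>b\<close>. Otherwise some \<open>t\<close> outside
      \<open>Q\<close> brings \<open>a y\<close> into \<open>V\<close>; the annihilator of
      \<open>t y\<close> is still inside the prime \<open>Q\<close>, so it equals \<open>P\<close>,
      and it contains \<open>a\<close>.\<close>
    show "a \<in> P \<or> b \<in> P"
    proof (cases "A (a \<odot>\<^bsub>rm E\<^esub> y) \<subseteq> Q")
      case True
      then have "A (a \<odot>\<^bsub>rm E\<^esub> y) = P" unfolding P_def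
        using ab y(1) by (intro max mono smult_closed)
      moreover have "b \<in> A (a \<odot>\<^bsub>rm E\<^esub> y)" using memA[OF ab(2,1)] ab m_comm unfolding P_def by simp
      ultimately show ?thesis by blast
    next
      case False
      then obtain t where t: "t \<in> A (a \<odot>\<^bsub>rm E\<^esub> y)" "t \<notin> Q" by blast
      then have tc: "t \<in> carrier R" unfolding A_def by blast
      have "A (t \<odot>\<^bsub>rm E\<^esub> y) \<subseteq> Q"
      proof
        fix r assume r: "r \<in> A (t \<odot>\<^bsub>rm E\<^esub> y)"
        then have rc: "r \<in> carrier R" unfolding A_def by blast
        then have "r \<otimes> t \<in> Q" using r memA[OF rc tc] y(2) by blast
        then show "r \<in> Q" using primeD(4)[OF Q(1) rc tc] t(2) by blast
      qed
      then have "A (t \<odot>\<^bsub>rm E\<^esub> y) = P" unfolding P_def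
        using tc y(1) by (intro max mono smult_closed)
      moreover have "a \<in> A (t \<odot>\<^bsub>rm E\<^esub> y)"
        using t(1) memA[OF tc ab(1)] memA[OF ab(1) tc] m_comm[OF tc ab(1)] by simp
      ultimately show ?thesis by blast
    qed
  qed
  have per: "pb m P \<noteq> P" if "m > 0" for m
    using np P cA0 y(2,3) that unfolding P_def by blast
  \<comment> \<open>The kernel of \<theta> on the hull is a submodule meeting \<open>V\<close> in
    zero, so essentiality makes it zero.\<close>
  let ?K = "{z \<in> carrier (rm E). (TX E ^^ 1) z \<in> {\<zero>\<^bsub>rm E\<^esub>}}"
  have "rsub ?K" by (rule T_vimage_rsub[OF zero_rsub])
  then have "ssub ?K" unfolding ssub_def using T_zero M.zero_closed by auto
  then have Ks: "submod S E ?K" using submod_iff_ssub[OF E] by blast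
  have "?K \<inter> V \<subseteq> {mzero E}"
  proof
    fix z assume "z \<in> ?K \<inter> V"
    then show "z \<in> {mzero E}" using F.T_eq_zeroD[of z] by simp
  qed
  moreover have "mzero E \<in> ?K \<inter> V" using Ks Vs unfolding submod_def by blast
  ultimately have "?K \<inter> V = {mzero E}" by blast
  then have K0: "?K = {mzero E}" using ess Ks unfolding essential_submod_def by blast
  \<comment> \<open>As \<theta> is surjective on \<open>V\<close> and injective on the hull, it
    moves nothing from outside \<open>V\<close> into \<open>V\<close>.\<close>
  have TV: "z \<in> V" if z: "z \<in> carrier (rm E)" "TX E z \<in> V" for z
  proof -
    obtain v where v: "v \<in> V" "TX E v = TX E z" using F.T_surj[of "TX E z"] z(2) by auto
    have vc: "v \<in> carrier (rm E)" using VE[OF v(1)] by simp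
    have Tz: "TX E z \<in> carrier (rm E)" by (rule T_closed[OF z(1)])
    have "TX E (z \<ominus>\<^bsub>rm E\<^esub> v) = TX E z \<ominus>\<^bsub>rm E\<^esub> TX E v" by (rule T_diff[OF z(1) vc])
    also have "\<dots> = \<zero>\<^bsub>rm E\<^esub>" unfolding v(2) a_minus_def by (rule M.r_neg[OF Tz])
    finally have "TX E (z \<ominus>\<^bsub>rm E\<^esub> v) = \<zero>\<^bsub>rm E\<^esub>" .
    moreover have "z \<ominus>\<^bsub>rm E\<^esub> v \<in> carrier (rm E)" using z(1) vc by (rule M.minus_closed)
    ultimately have "z \<ominus>\<^bsub>rm E\<^esub> v \<in> ?K" by simp
    then have "z \<ominus>\<^bsub>rm E\<^esub> v = \<zero>\<^bsub>rm E\<^esub>" unfolding K0 by simp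
    then have "z = v" by (rule diff_eq_zeroD[OF z(1) vc])
    then show ?thesis using v(1) by simp
  qed
  have TkV: "z \<in> V" if "z \<in> carrier (rm E)" "(TX E ^^ k) z \<in> V" for z k
    using that
  proof (induction k)
    case (Suc k)
    have "(TX E ^^ k) z \<in> V" using TV[OF T_pow_closed[OF Suc.prems(1)]] Suc.prems(2) by simp
    then show ?case using Suc by blast
  qed simp
  \<comment> \<open>The annihilator of \<open>y \<theta>\<^sup>k\<close> modulo \<open>V\<close> is
    the inverse image of \<open>P\<close> under \<open>\<alpha>\<^sup>k\<close>, the exact analogue
    of \<open>Pr\<close> for the quotient by \<open>V\<close>.\<close>
  have key: "r \<odot>\<^bsub>rm E\<^esub> (TX E ^^ k) y \<in> V \<longleftrightarrow> r \<in> pb k P" if r: "r \<in> carrier R" for r k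
  proof -
    have ac: "(\<alpha> ^^ k) r \<in> carrier R" by (rule alpha_powD(1)[OF r])
    have e: "r \<odot>\<^bsub>rm E\<^esub> (TX E ^^ k) y = (TX E ^^ k) ((\<alpha> ^^ k) r \<odot>\<^bsub>rm E\<^esub> y)"
      by (rule T_pow_smult[OF r y(1), symmetric])
    have "(TX E ^^ k) ((\<alpha> ^^ k) r \<odot>\<^bsub>rm E\<^esub> y) \<in> V \<longleftrightarrow> (\<alpha> ^^ k) r \<odot>\<^bsub>rm E\<^esub> y \<in> V"
      using TkV[OF smult_closed[OF ac y(1)]] ssubD(3)[OF Vsub] by blast
    then show ?thesis unfolding e mem_pb_iff P_def A_def using r ac by blast
  qed
  let ?C = "\<lambda>n. orbit_span (carrier R) ((TX E ^^ n) y)"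
  have Tc: "(TX E ^^ n) y \<in> carrier (rm E)" for n by (rule T_pow_closed[OF y(1)])
  have Cs: "ssub (?C n)" for n by (rule cyclic_ssub[OF Tc])
  have self: "(TX E ^^ n) y \<in> ?C n" for n using mem_orbit_span[OF Tc, of 0] by simp
  have dec: "?C (Suc n) \<subseteq> ?C n" for n
    using ssubD(2)[OF Cs self] by (intro orbit_span_subset[OF Cs]) simp
  have strict: "(TX E ^^ n) y \<notin> ?C (Suc n)" for n
  proof
    assume "(TX E ^^ n) y \<in> ?C (Suc n)"
    then obtain m where m: "(TX E ^^ n) y \<in> lspan (carrier R) (gens ((TX E ^^ Suc n) y) m)"
      unfolding orbit_span_def by blast
    have PI: "ideal P R" by (rule primeD(1)[OF P])
    \<comment> \<open>An inclusion here would cancel to a period of \<open>P\<close>. Hence some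
      \<open>p\<close> brings all the higher powers involved into \<open>V\<close> but not
      \<open>y \<theta>\<^sup>n\<close>.\<close>
    have "\<not> (\<exists>j<m. pb (n + Suc j) P \<subseteq> pb n P)"
    proof
      assume "\<exists>j<m. pb (n + Suc j) P \<subseteq> pb n P"
      then obtain j where j: "pb (n + Suc j) P \<subseteq> pb n P" by blast
      then have "pb n (pb (Suc j) P) \<subseteq> pb n P" unfolding pb_pb by (simp add: add.commute)
      then have "pb (Suc j) P \<subseteq> P"
        using pb_subset_iff[OF idealD(1)[OF pb_ideal[OF PI]]] by blast
      then have "pb (Suc j) P = P" using pb_comparable_imp_eq[OF PI] by blast
      then show False using per[of "Suc j"] by simp
    qed
    then obtain p where p: "p \<in> carrier R" "\<And>j. j < m \<Longrightarrow> p \<in> pb (n + Suc j) P" "p \<notin> pb n P"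
      using prime_contains_component[OF pb_prime[OF P], of m "\<lambda>j. pb (n + Suc j) P" n] pb_ideal[OF PI]
      by blast
    have U: "rsub {u \<in> carrier (rm E). p \<odot>\<^bsub>rm E\<^esub> u \<in> V}"
      by (rule rsub_smult_vimage[OF ssubD(1)[OF Vsub] p(1)])
    have "lspan (carrier R) (gens ((TX E ^^ Suc n) y) m) \<subseteq> {u \<in> carrier (rm E). p \<odot>\<^bsub>rm E\<^esub> u \<in> V}"
    proof (rule lspan_subset[OF U])
      fix u r assume "u \<in> set (gens ((TX E ^^ Suc n) y) m)" and r: "r \<in> carrier R"
      then obtain j where j: "j < m" "u = (TX E ^^ j) ((TX E ^^ Suc n) y)" unfolding set_gens by blast
      have "u = (TX E ^^ (j + Suc n)) y" unfolding j(2) funpow_add comp_def ..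
      then have ue: "u = (TX E ^^ (n + Suc j)) y" by (simp add: add.commute)
      have "p \<odot>\<^bsub>rm E\<^esub> u \<in> V" unfolding ue key[OF p(1)] by (rule p(2)[OF j(1)])
      then show "r \<odot>\<^bsub>rm E\<^esub> u \<in> {u \<in> carrier (rm E). p \<odot>\<^bsub>rm E\<^esub> u \<in> V}"
        using Tc[of "n + Suc j"] unfolding ue[symmetric] by (intro rsubD(4)[OF U r]) blast
    qed
    then have "p \<odot>\<^bsub>rm E\<^esub> (TX E ^^ n) y \<in> V" using m by blast
    then show False using key[OF p(1)] p(3) by blast
  qed
  have Cm: "submod S E (?C n)" for n using Cs submod_iff_ssub[OF E] by blast
  have "fin_gen_submod S E (?C 0)"
    unfolding fin_gen_submod_def
  proof (intro conjI exI[of _ "{y}"] allI impI)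
    show "submod S E (?C 0)" by (rule Cm)
    show "finite {y}" "{y} \<subseteq> ?C 0" using self[of 0] by auto
    show "?C 0 \<subseteq> L" if "submod S E L \<and> {y} \<subseteq> L" for L
      using orbit_span_subset[of L y] that submod_iff_ssub[OF E] by simp
  qed
  moreover have "\<not> artinian_submod S E (?C 0)"
    unfolding artinian_submod_def not_not
  proof (intro exI[of _ ?C] allI conjI)
    fix i
    show "submod S E (?C i)" by (rule Cm)
    show "?C i \<subseteq> ?C 0" using lift_Suc_antimono_le[of ?C 0 i] dec by blast
    show "?C (Suc i) \<subset> ?C i" using dec[of i] strict[of i] self[of i] by blast
  qed
  ultimately show ?thesis by blast
qed

end

subsection \<open>Injective hulls inside a coinduced module\<close>

context noetherian_module
begin

text \<open>The graph of a partially defined \<open>K\<close>-linear map into \<open>R\<close>, a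
  form suited to Zorn's lemma. Over a field, single-valuedness reduces to the last clause, about
  pairs above zero.\<close>

definition functional_graph :: "'a set \<Rightarrow> ('c \<times> 'a) set \<Rightarrow> bool" where
  "functional_graph K G \<longleftrightarrow> G \<subseteq> carrier M \<times> carrier R \<and> (\<zero>\<^bsub>M\<^esub>, \<zero>) \<in> G \<and>
     (\<forall>x r y s. (x, r) \<in> G \<longrightarrow> (y, s) \<in> G \<longrightarrow> (x \<oplus>\<^bsub>M\<^esub> y, r \<oplus> s) \<in> G) \<and>
     (\<forall>k x r. k \<in> K \<longrightarrow> (x, r) \<in> G \<longrightarrow> (k \<odot>\<^bsub>M\<^esub> x, k \<otimes> r) \<in> G) \<and>
     (\<forall>r. (\<zero>\<^bsub>M\<^esub>, r) \<in> G \<longrightarrow> r = \<zero>)"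

lemma functional_graphD:
  assumes "functional_graph K G"
  shows "\<And>x r. (x, r) \<in> G \<Longrightarrow> x \<in> carrier M" "\<And>x r. (x, r) \<in> G \<Longrightarrow> r \<in> carrier R"
    "(\<zero>\<^bsub>M\<^esub>, \<zero>) \<in> G" "\<And>x r y s. (x, r) \<in> G \<Longrightarrow> (y, s) \<in> G \<Longrightarrow> (x \<oplus>\<^bsub>M\<^esub> y, r \<oplus> s) \<in> G"
    "\<And>k x r. k \<in> K \<Longrightarrow> (x, r) \<in> G \<Longrightarrow> (k \<odot>\<^bsub>M\<^esub> x, k \<otimes> r) \<in> G"
    "\<And>r. (\<zero>\<^bsub>M\<^esub>, r) \<in> G \<Longrightarrow> r = \<zero>"
  by (insert assms[unfolded functional_graph_def]) (elim conjE, fast)+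

lemma functional_graph_unique:
  assumes K: "subfield K R" and G: "functional_graph K G" and xr: "(x, r) \<in> G" "(x, s) \<in> G"
  shows "r = s"
proof -
  note D = functional_graphD[OF G]
  have c: "x \<in> carrier M" "r \<in> carrier R" "s \<in> carrier R" using D(1,2) xr by blast+
  have m1: "\<ominus> \<one> \<in> K" using subringE(3,5)[OF subfieldE(1)[OF K]] by blast
  have "(x \<oplus>\<^bsub>M\<^esub> (\<ominus> \<one>) \<odot>\<^bsub>M\<^esub> x, r \<oplus> (\<ominus> \<one>) \<otimes> s) \<in> G" using D(4)[OF xr(1) D(5)[OF m1 xr(2)]] .
  moreover have "x \<oplus>\<^bsub>M\<^esub> (\<ominus> \<one>) \<odot>\<^bsub>M\<^esub> x = \<zero>\<^bsub>M\<^esub>" using c by (simp add: smult_l_minus M.r_neg)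
  moreover have "r \<oplus> (\<ominus> \<one>) \<otimes> s = r \<ominus> s" using c by (simp add: l_minus a_minus_def)
  ultimately have "r \<ominus> s = \<zero>" using D(6) by simp
  then show ?thesis using c by simp
qed

text \<open>Extension of linear maps between vector spaces over \<open>K\<close>, here with values
  in the vector space \<open>R\<close>: a maximal graph has full domain.\<close>

lemma extend_functional:
  assumes K: "subfield K R" and G0: "functional_graph K G0"
  shows "\<exists>h. h \<in> carrier M \<rightarrow> carrier R \<and>
    (\<forall>x\<in>carrier M. \<forall>y\<in>carrier M. h (x \<oplus>\<^bsub>M\<^esub> y) = h x \<oplus> h y) \<and>
    (\<forall>x\<in>carrier M. \<forall>k\<in>K. h (k \<odot>\<^bsub>M\<^esub> x) = k \<otimes> h x) \<and> (\<forall>x r. (x, r) \<in> G0 \<longrightarrow> h x = r)"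
proof -
  have KR: "K \<subseteq> carrier R" using subfieldE(3)[OF K] .
  note Ksub = subringE[OF subfieldE(1)[OF K]]
  let ?A = "{G. functional_graph K G \<and> G0 \<subseteq> G}"
  have "\<exists>G\<in>?A. \<forall>X\<in>?A. G \<subseteq> X \<longrightarrow> X = G"
  proof (rule subset_Zorn_nonempty)
    show "?A \<noteq> {}" using G0 by blast
    fix C assume C: "C \<noteq> {}" "subset.chain ?A C"
    have Cg: "functional_graph K G" "G0 \<subseteq> G" if "G \<in> C" for G
      using C(2) that unfolding subset.chain_def by auto
    have common: "\<exists>G\<in>C. p \<in> G \<and> q \<in> G" if "p \<in> \<Union>C" "q \<in> \<Union>C" for p q
      using that C(2) unfolding subset.chain_def by blast
    have "functional_graph K (\<Union>C)"
      unfolding functional_graph_def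
    proof (intro conjI allI impI)
      show "\<Union>C \<subseteq> carrier M \<times> carrier R" using Cg(1) unfolding functional_graph_def by blast
      show "(\<zero>\<^bsub>M\<^esub>, \<zero>) \<in> \<Union>C" using C(1) Cg(1) functional_graphD(3) by blast
      show "(x \<oplus>\<^bsub>M\<^esub> y, r \<oplus> s) \<in> \<Union>C" if xr: "(x, r) \<in> \<Union>C" "(y, s) \<in> \<Union>C" for x r y s
      proof -
        obtain G where "G \<in> C" "(x, r) \<in> G" "(y, s) \<in> G" using common[OF xr] by blast
        then show ?thesis using functional_graphD(4)[OF Cg(1)] by blast
      qed
      show "(k \<odot>\<^bsub>M\<^esub> x, k \<otimes> r) \<in> \<Union>C" if "k \<in> K" "(x, r) \<in> \<Union>C" for k x r
        using that functional_graphD(5)[OF Cg(1)] by blast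
      show "r = \<zero>" if "(\<zero>\<^bsub>M\<^esub>, r) \<in> \<Union>C" for r
        using that functional_graphD(6)[OF Cg(1)] by blast
    qed
    then show "\<Union>C \<in> ?A" using C(1) Cg(2) by blast
  qed
  then obtain G where G: "functional_graph K G" "G0 \<subseteq> G"
    and max: "\<forall>X\<in>?A. G \<subseteq> X \<longrightarrow> X = G" by blast
  note D = functional_graphD[OF G(1)]
  have total: "\<exists>r. (m, r) \<in> G" if m: "m \<in> carrier M" for m
  proof (rule ccontr)
    assume no: "\<nexists>r. (m, r) \<in> G"
    \<comment> \<open>The functional is extended by zero on the missing vector
      \<open>m\<close>.\<close>
    define G' where "G' = {(x \<oplus>\<^bsub>M\<^esub> k \<odot>\<^bsub>M\<^esub> m, r) | x r k. (x, r) \<in> G \<and> k \<in> K}"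
    have memI: "(x \<oplus>\<^bsub>M\<^esub> k \<odot>\<^bsub>M\<^esub> m, r) \<in> G'" if "(x, r) \<in> G" "k \<in> K" for x r k
      using that unfolding G'_def by blast
    have sub: "(x, r) \<in> G'" if "(x, r) \<in> G" for x r
      using memI[OF that Ksub(2)] D(1)[OF that] m by simp
    have "functional_graph K G'"
      unfolding functional_graph_def
    proof (intro conjI allI impI)
      show "G' \<subseteq> carrier M \<times> carrier R" unfolding G'_def using D(1,2) m KR by auto
      show "(\<zero>\<^bsub>M\<^esub>, \<zero>) \<in> G'" using sub[OF D(3)] .
      show "(u \<oplus>\<^bsub>M\<^esub> v, r \<oplus> s) \<in> G'" if ur: "(u, r) \<in> G'" "(v, s) \<in> G'" for u r v s
      proof -
        obtain x k y l where *: "(x, r) \<in> G" "k \<in> K" "u = x \<oplus>\<^bsub>M\<^esub> k \<odot>\<^bsub>M\<^esub> m"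
          "(y, s) \<in> G" "l \<in> K" "v = y \<oplus>\<^bsub>M\<^esub> l \<odot>\<^bsub>M\<^esub> m" using ur unfolding G'_def by blast
        have c: "x \<in> carrier M" "y \<in> carrier M" "k \<in> carrier R" "l \<in> carrier R"
          using * D(1) KR by auto
        have "u \<oplus>\<^bsub>M\<^esub> v = (x \<oplus>\<^bsub>M\<^esub> y) \<oplus>\<^bsub>M\<^esub> (k \<oplus> l) \<odot>\<^bsub>M\<^esub> m"
          unfolding *(3,6) using c m by (simp add: smult_l_distr M.a_ac)
        then show ?thesis using memI[OF D(4)[OF *(1,4)] Ksub(7)[OF *(2,5)]] by simp
      qed
      show "(k \<odot>\<^bsub>M\<^esub> u, k \<otimes> r) \<in> G'" if k: "k \<in> K" and ur: "(u, r) \<in> G'" for k u r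
      proof -
        obtain x l where *: "(x, r) \<in> G" "l \<in> K" "u = x \<oplus>\<^bsub>M\<^esub> l \<odot>\<^bsub>M\<^esub> m"
          using ur unfolding G'_def by blast
        have c: "x \<in> carrier M" "k \<in> carrier R" "l \<in> carrier R" using * D(1) KR k by auto
        have "k \<odot>\<^bsub>M\<^esub> u = k \<odot>\<^bsub>M\<^esub> x \<oplus>\<^bsub>M\<^esub> (k \<otimes> l) \<odot>\<^bsub>M\<^esub> m"
          unfolding *(3) using c m by (simp add: smult_r_distr smult_assoc1)
        then show ?thesis using memI[OF D(5)[OF k *(1)] Ksub(6)[OF k *(2)]] by simp
      qed
      show "r = \<zero>" if zr: "(\<zero>\<^bsub>M\<^esub>, r) \<in> G'" for r
      proof -
        obtain x k where *: "(x, r) \<in> G" "k \<in> K" "\<zero>\<^bsub>M\<^esub> = x \<oplus>\<^bsub>M\<^esub> k \<odot>\<^bsub>M\<^esub> m"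
          using zr unfolding G'_def by blast
        have c: "x \<in> carrier M" "k \<in> carrier R" using * D(1) KR by auto
        \<comment> \<open>A nonzero \<open>k\<close> is invertible in \<open>K\<close>, and then
          \<open>m\<close> would be a multiple of \<open>x\<close>, already in the domain.\<close>
        have "k = \<zero>"
        proof (rule ccontr)
          assume "k \<noteq> \<zero>"
          then obtain l where l: "l \<in> K" "l \<otimes> k = \<one>" using subfield_m_inv[OF K] *(2) by blast
          have lc: "l \<in> carrier R" using l KR by blast
          have "x = \<ominus>\<^bsub>M\<^esub> (k \<odot>\<^bsub>M\<^esub> m)" using M.minus_equality[of x "k \<odot>\<^bsub>M\<^esub> m"] * c m by simp
          then have "(\<ominus> l) \<odot>\<^bsub>M\<^esub> x = l \<odot>\<^bsub>M\<^esub> (k \<odot>\<^bsub>M\<^esub> m)"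
            using c lc m by (simp add: smult_l_minus smult_r_minus)
          also have "\<dots> = m" using l lc c m by (simp add: smult_assoc1[symmetric])
          finally have "(\<ominus> l) \<odot>\<^bsub>M\<^esub> x = m" .
          then show False using D(5)[OF Ksub(5)[OF l(1)] *(1)] no by metis
        qed
        then have "x = \<zero>\<^bsub>M\<^esub>" using *(3) c m by simp
        then show ?thesis using *(1) D(6) by blast
      qed
    qed
    moreover have "G \<subseteq> G'" using sub by auto
    ultimately have "G' = G" using max G(2) by blast
    moreover have "(m, \<zero>) \<in> G'" using memI[OF D(3) Ksub(3)] m by simp
    ultimately show False using no by blast
  qed
  define h where "h x = (THE r. (x, r) \<in> G)" for x
  have h: "h x = r" if "(x, r) \<in> G" for x r
    unfolding h_def using that functional_graph_unique[OF K G(1)] by blast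
  have hG: "(x, h x) \<in> G" if "x \<in> carrier M" for x
    using total[OF that] h by metis
  have "h \<in> carrier M \<rightarrow> carrier R" using hG D(2) by blast
  moreover have "h (x \<oplus>\<^bsub>M\<^esub> y) = h x \<oplus> h y" if "x \<in> carrier M" "y \<in> carrier M" for x y
    by (rule h[OF D(4)[OF hG hG]]) (use that in auto)
  moreover have "h (k \<odot>\<^bsub>M\<^esub> x) = k \<otimes> h x" if "x \<in> carrier M" "k \<in> K" for x k
    by (rule h[OF D(5)[OF that(2) hG[OF that(1)]]])
  moreover have "h x = r" if "(x, r) \<in> G0" for x r
    using h that G(2) by blast
  ultimately show ?thesis by blast
qed

end

section \<open>Coinduced modules and their injectivity\<close>

definition (in automorphism_ring) slinear ::
    "(nat \<Rightarrow> 'a, 'm) rmod \<Rightarrow> (nat \<Rightarrow> 'a, 'n) rmod \<Rightarrow> ('m \<Rightarrow> 'n) \<Rightarrow> bool" where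
  "slinear M M' F \<longleftrightarrow> (\<forall>m\<in>mcarrier M. F m \<in> mcarrier M') \<and>
     (\<forall>m\<in>mcarrier M. \<forall>n\<in>mcarrier M. F (madd M m n) = madd M' (F m) (F n)) \<and>
     (\<forall>m\<in>mcarrier M. \<forall>s\<in>carrier S. F (mact M m s) = mact M' (F m) s)"

text \<open>That the skew polynomials form a ring is assumed here; it will be read off from the
  given module, since \<open>rmodule\<close> contains it. Associativity is thus never computed from
  coefficients.\<close>

locale coinduced = automorphism_ring R \<alpha> for R (structure) and \<alpha> :: "'a \<Rightarrow> 'a" +
  fixes K :: "'a set"
  assumes K: "subfield K R" and ring_S: "ring S"
begin

sublocale Sr: ring S by (rule ring_S)

lemma KR: "k \<in> K \<Longrightarrow> k \<in> carrier R"
  using subfieldE(3)[OF K] by blast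

text \<open>The right module of functionals on \<open>S\<close> that are linear for the right action of \<open>K\<close>;
  their values lie in \<open>R\<close>. It is injective because functionals over a field extend.\<close>

definition H :: "(nat \<Rightarrow> 'a, (nat \<Rightarrow> 'a) \<Rightarrow> 'a) rmod" where
  "H = \<lparr>mcarrier = {h \<in> carrier S \<rightarrow>\<^sub>E carrier R.
          (\<forall>s\<in>carrier S. \<forall>t\<in>carrier S. h (s \<oplus>\<^bsub>S\<^esub> t) = h s \<oplus> h t) \<and>
          (\<forall>s\<in>carrier S. \<forall>k\<in>K. h (s \<otimes>\<^bsub>S\<^esub> cst k) = k \<otimes> h s)},
        madd = (\<lambda>f g. \<lambda>s\<in>carrier S. f s \<oplus> g s),
        mzero = (\<lambda>s\<in>carrier S. \<zero>),
        mact = (\<lambda>f s. \<lambda>t\<in>carrier S. f (s \<otimes>\<^bsub>S\<^esub> t))\<rparr>"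

lemma H_carrierD:
  assumes "h \<in> mcarrier H"
  shows "\<And>s. s \<in> carrier S \<Longrightarrow> h s \<in> carrier R" "h \<in> extensional (carrier S)"
    "\<And>s t. s \<in> carrier S \<Longrightarrow> t \<in> carrier S \<Longrightarrow> h (s \<oplus>\<^bsub>S\<^esub> t) = h s \<oplus> h t"
    "\<And>s k. s \<in> carrier S \<Longrightarrow> k \<in> K \<Longrightarrow> h (s \<otimes>\<^bsub>S\<^esub> cst k) = k \<otimes> h s"
  using assms by (auto simp: H_def PiE_iff)

lemma H_carrierI:
  assumes "\<And>s. s \<in> carrier S \<Longrightarrow> h s \<in> carrier R" "h \<in> extensional (carrier S)"
    "\<And>s t. s \<in> carrier S \<Longrightarrow> t \<in> carrier S \<Longrightarrow> h (s \<oplus>\<^bsub>S\<^esub> t) = h s \<oplus> h t"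
    "\<And>s k. s \<in> carrier S \<Longrightarrow> k \<in> K \<Longrightarrow> h (s \<otimes>\<^bsub>S\<^esub> cst k) = k \<otimes> h s"
  shows "h \<in> mcarrier H"
  using assms by (auto simp: H_def PiE_iff)

lemma H_ops:
  "madd H f g = (\<lambda>s\<in>carrier S. f s \<oplus> g s)" "mzero H = (\<lambda>s\<in>carrier S. \<zero>)"
  "mact H f s = (\<lambda>t\<in>carrier S. f (s \<otimes>\<^bsub>S\<^esub> t))"
  by (simp_all add: H_def)

lemma H_rmodule: "rmodule S H"
  unfolding rmodule_def
proof (intro conjI ballI)
  show "ring S" by (rule ring_S)
  show "mzero H \<in> mcarrier H"
    by (rule H_carrierI) (auto simp: H_ops KR)
  show "madd H f g \<in> mcarrier H" if "f \<in> mcarrier H" "g \<in> mcarrier H" for f g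
    using H_carrierD[OF that(1)] H_carrierD[OF that(2)] KR
    by (intro H_carrierI) (simp_all add: H_ops a_ac r_distr)
  show "madd H (madd H f g) h = madd H f (madd H g h)"
    if "f \<in> mcarrier H" "g \<in> mcarrier H" "h \<in> mcarrier H" for f g h
    using H_carrierD(1)[OF that(1)] H_carrierD(1)[OF that(2)] H_carrierD(1)[OF that(3)]
    by (auto simp: H_ops a_assoc intro!: restrict_ext)
  show "madd H f g = madd H g f" if "f \<in> mcarrier H" "g \<in> mcarrier H" for f g
    using H_carrierD(1)[OF that(1)] H_carrierD(1)[OF that(2)]
    by (auto simp: H_ops a_comm intro!: restrict_ext)
  show "madd H (mzero H) f = f" if "f \<in> mcarrier H" for f
    using H_carrierD(1,2)[OF that] by (intro extensionalityI[of _ "carrier S"]) (auto simp: H_ops)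
  show "\<exists>g\<in>mcarrier H. madd H f g = mzero H" if "f \<in> mcarrier H" for f
  proof (rule bexI)
    show "(\<lambda>s\<in>carrier S. \<ominus> f s) \<in> mcarrier H"
      using H_carrierD[OF that] KR by (intro H_carrierI) (simp_all add: minus_add r_minus)
    show "madd H f (\<lambda>s\<in>carrier S. \<ominus> f s) = mzero H"
      using H_carrierD(1)[OF that] by (auto simp: H_ops r_neg intro!: restrict_ext)
  qed
  show "mact H f s \<in> mcarrier H" if f: "f \<in> mcarrier H" and s: "s \<in> carrier S" for f s
  proof (rule H_carrierI)
    fix t k assume t: "t \<in> carrier S" and k: "k \<in> K"
    have "s \<otimes>\<^bsub>S\<^esub> (t \<otimes>\<^bsub>S\<^esub> cst k) = (s \<otimes>\<^bsub>S\<^esub> t) \<otimes>\<^bsub>S\<^esub> cst k"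
      using s t KR[OF k] by (simp add: Sr.m_assoc)
    then show "mact H f s (t \<otimes>\<^bsub>S\<^esub> cst k) = k \<otimes> mact H f s t"
      using H_carrierD(4)[OF f, of "s \<otimes>\<^bsub>S\<^esub> t" k] s t k KR[OF k] by (simp add: H_ops)
  qed (use H_carrierD[OF f] s in \<open>simp_all add: H_ops Sr.r_distr\<close>)
  show "mact H f (s \<oplus>\<^bsub>S\<^esub> t) = madd H (mact H f s) (mact H f t)"
    if "f \<in> mcarrier H" "s \<in> carrier S" "t \<in> carrier S" for f s t
    using H_carrierD(3)[OF that(1)] that(2,3) by (auto simp: H_ops Sr.l_distr intro!: restrict_ext)
  show "mact H (madd H f g) s = madd H (mact H f s) (mact H g s)"
    if "f \<in> mcarrier H" "g \<in> mcarrier H" "s \<in> carrier S" for f g s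
    using that(3) by (auto simp: H_ops intro!: restrict_ext)
  show "mact H f (s \<otimes>\<^bsub>S\<^esub> t) = mact H (mact H f s) t"
    if "f \<in> mcarrier H" "s \<in> carrier S" "t \<in> carrier S" for f s t
    using that(2,3) by (auto simp: H_ops Sr.m_assoc intro!: restrict_ext)
  show "mact H f \<one>\<^bsub>S\<^esub> = f" if "f \<in> mcarrier H" for f
    using H_carrierD(1,2)[OF that] by (intro extensionalityI[of _ "carrier S"]) (auto simp: H_ops)
qed

text \<open>Adjunction: a linear map \<open>f\<close> into \<open>H\<close> is determined by the
  functional \<open>a \<mapsto> f a (1)\<close>. That functional extends from \<open>I\<close> to
  the whole ring, and its extension is the element \<open>e\<close>.\<close>

lemma H_baer:
  assumes I: "right_ideal S I" and f: "f \<in> I \<rightarrow> mcarrier H"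
    and fadd: "\<And>a b. a \<in> I \<Longrightarrow> b \<in> I \<Longrightarrow> f (a \<oplus>\<^bsub>S\<^esub> b) = madd H (f a) (f b)"
    and fact: "\<And>a s. a \<in> I \<Longrightarrow> s \<in> carrier S \<Longrightarrow> f (a \<otimes>\<^bsub>S\<^esub> s) = mact H (f a) s"
  shows "\<exists>e\<in>mcarrier H. \<forall>a\<in>I. f a = mact H e a"
proof -
  \<comment> \<open>The ring as a right module over itself. Through \<open>rm\<close>, constants act
    by right multiplication, the action for which the members of \<open>H\<close> are linear over
    \<open>K\<close>.\<close>
  define A :: "(nat \<Rightarrow> 'a, nat \<Rightarrow> 'a) rmod"
    where "A = \<lparr>mcarrier = carrier S, madd = (\<oplus>\<^bsub>S\<^esub>), mzero = \<zero>\<^bsub>S\<^esub>, mact = (\<otimes>\<^bsub>S\<^esub>)\<rparr>"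
  have A_simps: "mcarrier A = carrier S" "madd A = (\<oplus>\<^bsub>S\<^esub>)" "mzero A = \<zero>\<^bsub>S\<^esub>" "mact A = (\<otimes>\<^bsub>S\<^esub>)"
    unfolding A_def by simp_all
  have "rmodule S A"
    unfolding rmodule_def A_simps
  proof (intro conjI ballI)
    show "\<exists>y\<in>carrier S. x \<oplus>\<^bsub>S\<^esub> y = \<zero>\<^bsub>S\<^esub>" if "x \<in> carrier S" for x
      using Sr.r_neg[OF that] Sr.a_inv_closed[OF that] by blast
  qed (simp_all add: ring_S Sr.a_assoc Sr.a_comm Sr.a_lcomm Sr.l_distr Sr.r_distr Sr.m_assoc)
  then interpret N: skew_module R \<alpha> "rm A" "TX A" by (rule skew_module_rm)
  have IS: "a \<in> I \<Longrightarrow> a \<in> carrier S" for a using I unfolding right_ideal_def by blast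
  have fH: "f a \<in> mcarrier H" if "a \<in> I" for a using f that by blast
  let ?G = "{(a, f a \<one>\<^bsub>S\<^esub>) | a. a \<in> I}"
  have one: "f (a \<otimes>\<^bsub>S\<^esub> s) \<one>\<^bsub>S\<^esub> = f a s" if "a \<in> I" "s \<in> carrier S" for a s
    using fact[OF that] that(2) by (simp add: H_ops)
  have I0: "\<zero>\<^bsub>S\<^esub> \<in> I" using I unfolding right_ideal_def by blast
  have f0: "f \<zero>\<^bsub>S\<^esub> \<one>\<^bsub>S\<^esub> = \<zero>"
  proof -
    have "f \<zero>\<^bsub>S\<^esub> \<zero>\<^bsub>S\<^esub> = f \<zero>\<^bsub>S\<^esub> \<one>\<^bsub>S\<^esub>" using one[OF I0 Sr.zero_closed] by simp
    moreover have "f \<zero>\<^bsub>S\<^esub> (\<zero>\<^bsub>S\<^esub> \<otimes>\<^bsub>S\<^esub> cst \<zero>) = \<zero> \<otimes> f \<zero>\<^bsub>S\<^esub> \<zero>\<^bsub>S\<^esub>"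
      using H_carrierD(4)[OF fH[OF I0] Sr.zero_closed] subringE(2)[OF subfieldE(1)[OF K]] by blast
    ultimately show ?thesis using H_carrierD(1)[OF fH[OF I0]] by simp
  qed
  have "N.functional_graph K ?G"
    unfolding N.functional_graph_def
  proof (intro conjI allI impI)
    show "?G \<subseteq> carrier (rm A) \<times> carrier R"
      using IS H_carrierD(1)[OF fH] by (auto simp: A_simps)
    show "(\<zero>\<^bsub>rm A\<^esub>, \<zero>) \<in> ?G" using I0 f0 by (auto simp: A_simps)
    show "(x \<oplus>\<^bsub>rm A\<^esub> y, r \<oplus> s) \<in> ?G" if "(x, r) \<in> ?G" "(y, s) \<in> ?G" for x r y s
      using that I fadd unfolding right_ideal_def by (auto simp: A_simps H_ops)
    show "(k \<odot>\<^bsub>rm A\<^esub> x, k \<otimes> r) \<in> ?G" if k: "k \<in> K" and xr: "(x, r) \<in> ?G" for k x r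
    proof -
      have x: "x \<in> I" "r = f x \<one>\<^bsub>S\<^esub>" using xr by auto
      have kc: "cst k \<in> carrier S" using KR[OF k] by simp
      have "f (x \<otimes>\<^bsub>S\<^esub> cst k) \<one>\<^bsub>S\<^esub> = f x (\<one>\<^bsub>S\<^esub> \<otimes>\<^bsub>S\<^esub> cst k)" using one[OF x(1) kc] kc by simp
      then have "f (x \<otimes>\<^bsub>S\<^esub> cst k) \<one>\<^bsub>S\<^esub> = k \<otimes> r"
        using H_carrierD(4)[OF fH[OF x(1)] Sr.one_closed k] x(2) by simp
      moreover have "x \<otimes>\<^bsub>S\<^esub> cst k \<in> I" using I x(1) kc unfolding right_ideal_def by blast
      ultimately show ?thesis by (auto simp: A_simps)
    qed
    show "r = \<zero>" if "(\<zero>\<^bsub>rm A\<^esub>, r) \<in> ?G" for r using that f0 by (auto simp: A_simps)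
  qed
  then obtain h where h: "h \<in> carrier S \<rightarrow> carrier R"
    "\<forall>x\<in>carrier S. \<forall>y\<in>carrier S. h (x \<oplus>\<^bsub>S\<^esub> y) = h x \<oplus> h y"
    "\<forall>x\<in>carrier S. \<forall>k\<in>K. h (x \<otimes>\<^bsub>S\<^esub> cst k) = k \<otimes> h x" "\<forall>x r. (x, r) \<in> ?G \<longrightarrow> h x = r"
    using N.extend_functional[OF K, of ?G] unfolding rm_simps A_simps by blast
  define e where "e = restrict h (carrier S)"
  have "e \<in> mcarrier H"
    using h KR unfolding e_def by (intro H_carrierI) auto
  moreover have "f a = mact H e a" if a: "a \<in> I" for a
  proof (rule extensionalityI[of _ "carrier S"])
    show "f a \<in> extensional (carrier S)" using H_carrierD(2)[OF fH[OF a]] .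
    show "mact H e a \<in> extensional (carrier S)" by (simp add: H_ops)
    fix s assume s: "s \<in> carrier S"
    have as: "a \<otimes>\<^bsub>S\<^esub> s \<in> I" using I a s unfolding right_ideal_def by blast
    then have "h (a \<otimes>\<^bsub>S\<^esub> s) = f (a \<otimes>\<^bsub>S\<^esub> s) \<one>\<^bsub>S\<^esub>" using h(4) by blast
    then show "f a s = mact H e a s"
      using one[OF a s] s IS[OF a] by (simp add: H_ops e_def)
  qed
  ultimately show ?thesis by blast
qed

text \<open>The other half of the adjunction: a \<open>K\<close>-linear functional on
  \<open>M\<close> induces a module map into \<open>H\<close>. It replaces an appeal to injectivity
  of \<open>H\<close> for maps between arbitrary modules.\<close>

lemma coinduced_map:
  assumes M: "rmodule S M" and p: "\<phi> \<in> mcarrier M \<rightarrow> carrier R"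
    and add: "\<forall>m\<in>mcarrier M. \<forall>n\<in>mcarrier M. \<phi> (madd M m n) = \<phi> m \<oplus> \<phi> n"
    and lin: "\<forall>m\<in>mcarrier M. \<forall>k\<in>K. \<phi> (mact M m (cst k)) = k \<otimes> \<phi> m"
  shows "slinear M H (\<lambda>m. \<lambda>t\<in>carrier S. \<phi> (mact M m t))"
proof -
  define F where "F = (\<lambda>m. \<lambda>t\<in>carrier S. \<phi> (mact M m t))"
  note D = rmoduleD[OF M]
  have p': "\<phi> m \<in> carrier R" if "m \<in> mcarrier M" for m using p that by blast
  have "F m \<in> mcarrier H" if m: "m \<in> mcarrier M" for m
  proof (rule H_carrierI)
    show "F m (s \<otimes>\<^bsub>S\<^esub> cst k) = k \<otimes> F m s" if "s \<in> carrier S" "k \<in> K" for s k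
      using D(11)[OF m that(1), of "cst k"] lin D(8)[OF m that(1)] that(2) KR[OF that(2)] that(1)
      unfolding F_def by simp
  qed (use p' D(8)[OF m] D(9)[OF m] add in \<open>simp_all add: F_def\<close>)
  moreover have "F (madd M m n) = madd H (F m) (F n)" if "m \<in> mcarrier M" "n \<in> mcarrier M" for m n
    unfolding F_def H_ops using D(10)[OF that] add D(8) that by (auto intro!: restrict_ext)
  moreover have "F (mact M m s) = mact H (F m) s" if "m \<in> mcarrier M" "s \<in> carrier S" for m s
    unfolding F_def H_ops using D(11)[OF that] that(2) by (auto intro!: restrict_ext)
  ultimately show ?thesis unfolding slinear_def F_def by blast
qed

end

context automorphism_ring
begin

text \<open>Negatives are absent from the definition of \<open>submod\<close>; the last clause
  supplies them, through the action of minus one.\<close>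

lemma submodD:
  assumes M: "rmodule S M" and N: "submod S M N"
  shows "N \<subseteq> mcarrier M" "mzero M \<in> N" "\<And>x y. x \<in> N \<Longrightarrow> y \<in> N \<Longrightarrow> madd M x y \<in> N"
    "\<And>x s. x \<in> N \<Longrightarrow> s \<in> carrier S \<Longrightarrow> mact M x s \<in> N"
    "\<And>x y. x \<in> N \<Longrightarrow> y \<in> mcarrier M \<Longrightarrow> madd M x y = mzero M \<Longrightarrow> y \<in> N"
proof -
  show "N \<subseteq> mcarrier M" "mzero M \<in> N" "\<And>x y. x \<in> N \<Longrightarrow> y \<in> N \<Longrightarrow> madd M x y \<in> N"
    "\<And>x s. x \<in> N \<Longrightarrow> s \<in> carrier S \<Longrightarrow> mact M x s \<in> N"
    using N unfolding submod_def by auto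
  then have NC: "x \<in> N \<Longrightarrow> x \<in> carrier (rm M)" for x by auto
  interpret skew_module R \<alpha> "rm M" "TX M" by (rule skew_module_rm[OF M])
  have rs: "rsub N" using N submod_iff_ssub[OF M] ssubD(1) by blast
  show "y \<in> N" if xy: "x \<in> N" "y \<in> mcarrier M" "madd M x y = mzero M" for x y
  proof -
    have yc: "y \<in> carrier (rm M)" using xy(2) by simp
    have "y \<oplus>\<^bsub>rm M\<^esub> x = \<zero>\<^bsub>rm M\<^esub>"
      unfolding M.a_comm[OF yc NC[OF xy(1)]] using xy(3) by simp
    then have "\<ominus>\<^bsub>rm M\<^esub> x = y" by (rule M.minus_equality[OF _ NC[OF xy(1)] yc])
    then show ?thesis using rsubD(5)[OF rs xy(1)] by simp
  qed
qed

text \<open>Relative complements by Zorn's lemma. The hull will be a complement of a complement of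
  the embedded simple module.\<close>

lemma exists_maximal_disjoint_submod:
  assumes A: "submod S M A" and AB: "A \<inter> B \<subseteq> {mzero M}"
  shows "\<exists>C. submod S M C \<and> A \<subseteq> C \<and> C \<inter> B \<subseteq> {mzero M} \<and>
    (\<forall>C'. submod S M C' \<longrightarrow> C \<subseteq> C' \<longrightarrow> C' \<inter> B \<subseteq> {mzero M} \<longrightarrow> C' = C)"
proof -
  let ?F = "{C. submod S M C \<and> A \<subseteq> C \<and> C \<inter> B \<subseteq> {mzero M}}"
  have "\<exists>C\<in>?F. \<forall>X\<in>?F. C \<subseteq> X \<longrightarrow> X = C"
  proof (rule subset_Zorn_nonempty)
    show "?F \<noteq> {}" using A AB by blast
    fix \<C> assume C: "\<C> \<noteq> {}" "subset.chain ?F \<C>"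
    then have mem: "submod S M X" "A \<subseteq> X" "X \<inter> B \<subseteq> {mzero M}" if "X \<in> \<C>" for X
      using that unfolding subset.chain_def by auto
    have common: "\<exists>X\<in>\<C>. x \<in> X \<and> y \<in> X" if xy: "x \<in> \<Union>\<C>" "y \<in> \<Union>\<C>" for x y
    proof -
      obtain X Y where XY: "X \<in> \<C>" "x \<in> X" "Y \<in> \<C>" "y \<in> Y" using xy by blast
      then have "X \<subseteq> Y \<or> Y \<subseteq> X" using C(2) unfolding subset.chain_def by blast
      then show ?thesis using XY by blast
    qed
    have "submod S M (\<Union>\<C>)"
      unfolding submod_def
    proof (intro conjI ballI)
      show "\<Union>\<C> \<subseteq> mcarrier M" using mem(1) unfolding submod_def by blast
      show "mzero M \<in> \<Union>\<C>" using mem(1) C(1) unfolding submod_def by blast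
      show "madd M x y \<in> \<Union>\<C>" if "x \<in> \<Union>\<C>" "y \<in> \<Union>\<C>" for x y
        using common[OF that] mem(1) unfolding submod_def by blast
      show "mact M x s \<in> \<Union>\<C>" if "x \<in> \<Union>\<C>" "s \<in> carrier S" for x s
        using that mem(1) unfolding submod_def by blast
    qed
    then show "\<Union>\<C> \<in> ?F" using mem(2,3) C(1) by blast
  qed
  then obtain C where C: "C \<in> ?F" "\<forall>X\<in>?F. C \<subseteq> X \<longrightarrow> X = C" by blast
  then show ?thesis by (intro exI[of _ C]) auto
qed

lemma linear_image_vimage:
  assumes M: "rmodule S M" and M': "rmodule S M'"
    and lin: "slinear M M' F"
  shows "F (mzero M) = mzero M'"
    "\<And>N. submod S M N \<Longrightarrow> submod S M' (F ` N)"
    "\<And>L. submod S M' L \<Longrightarrow> submod S M {m \<in> mcarrier M. F m \<in> L}"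
proof -
  note D = rmoduleD[OF M]
  have F: "\<And>m. m \<in> mcarrier M \<Longrightarrow> F m \<in> mcarrier M'"
    and Fadd: "\<And>m n. m \<in> mcarrier M \<Longrightarrow> n \<in> mcarrier M \<Longrightarrow> F (madd M m n) = madd M' (F m) (F n)"
    and Fact: "\<And>m s. m \<in> mcarrier M \<Longrightarrow> s \<in> carrier S \<Longrightarrow> F (mact M m s) = mact M' (F m) s"
    using lin unfolding slinear_def by blast+
  interpret Sr: ring S using D(1) .
  show F0: "F (mzero M) = mzero M'"
    using Fact[OF D(2) Sr.zero_closed] act_zero(2)[OF M D(2)] act_zero(2)[OF M' F[OF D(2)]] by simp
  show "submod S M' (F ` N)" if N: "submod S M N" for N
  proof -
    note ND = submodD[OF M N]
    have NC: "x \<in> N \<Longrightarrow> x \<in> mcarrier M" for x using ND(1) by blast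
    show ?thesis
      unfolding submod_def
    proof (intro conjI ballI)
      show "F ` N \<subseteq> mcarrier M'" using NC F by blast
      show "mzero M' \<in> F ` N" using F0 ND(2) by (metis imageI)
      show "madd M' x y \<in> F ` N" if xy: "x \<in> F ` N" "y \<in> F ` N" for x y
      proof -
        obtain m n where mn: "m \<in> N" "n \<in> N" "x = F m" "y = F n" using xy by blast
        then have "madd M' x y = F (madd M m n)" using Fadd NC by simp
        then show ?thesis using ND(3) mn by blast
      qed
      show "mact M' x s \<in> F ` N" if xs: "x \<in> F ` N" "s \<in> carrier S" for x s
      proof -
        obtain m where m: "m \<in> N" "x = F m" using xs by blast
        then have "mact M' x s = F (mact M m s)" using Fact NC xs(2) by simp
        then show ?thesis using ND(4) m xs(2) by blast
      qed
    qed
  qed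
  show "submod S M {m \<in> mcarrier M. F m \<in> L}" if "submod S M' L" for L
    using submodD[OF M' that] D(2,3,8) F0 Fadd Fact unfolding submod_def by simp
qed

end

context coinduced
begin

text \<open>Let \<open>C\<close> be maximal with zero intersection with \<open>V\<close>, and
  \<open>E\<close> above \<open>V\<close> maximal with zero intersection with \<open>C\<close>.
  Projecting \<open>E + C\<close> onto \<open>E\<close> extends to an endomorphism of
  \<open>H\<close>, and maximality forces its image to be \<open>E\<close>. So \<open>E\<close> is a
  retract of \<open>H\<close>, hence injective, and essential over \<open>V\<close>.\<close>

theorem exists_injective_hull:
  fixes W :: "(nat \<Rightarrow> 'a, 'w) rmod"
  assumes W: "simple_module S W" "faithful S W"
  shows "\<exists>(E :: (nat \<Rightarrow> 'a, (nat \<Rightarrow> 'a) \<Rightarrow> 'a) rmod) V. injective_module S E \<and> simple_submod S E V \<and>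
    essential_submod S E V \<and> (\<forall>s\<in>carrier S. (\<forall>v\<in>V. mact E v s = mzero E) \<longrightarrow> s = \<zero>\<^bsub>S\<^esub>)"
proof -
  have WM: "rmodule S W" and Wsim: "simple_submod S W (mcarrier W)"
    using W(1) unfolding simple_module_def by auto
  note WD = rmoduleD[OF WM] and HD = rmoduleD[OF H_rmodule]
  interpret N: skew_module R \<alpha> "rm W" "TX W" by (rule skew_module_rm[OF WM])
  interpret HN: skew_module R \<alpha> "rm H" "TX H" by (rule skew_module_rm[OF H_rmodule])
  note Ksub = subringE[OF subfieldE(1)[OF K]]
  have "mcarrier W \<noteq> {mzero W}" using Wsim unfolding simple_submod_def by blast
  then obtain w where w: "w \<in> carrier (rm W)" "w \<noteq> \<zero>\<^bsub>rm W\<^esub>" using WD(2) by auto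
  \<comment> \<open>On the \<open>K\<close>-line through \<open>w\<close> send \<open>k w\<close> to
    \<open>k\<close>. An extension takes the value one at \<open>w\<close>, so the induced map into
    \<open>H\<close> is nonzero and, by simplicity, injective.\<close>
  let ?G = "{(k \<odot>\<^bsub>rm W\<^esub> w, k) | k. k \<in> K}"
  have G: "N.functional_graph K ?G"
    unfolding N.functional_graph_def
  proof (intro conjI allI impI)
    show "?G \<subseteq> carrier (rm W) \<times> carrier R" using N.smult_closed[OF KR w(1)] KR by blast
    show "(\<zero>\<^bsub>rm W\<^esub>, \<zero>) \<in> ?G" using N.smult_l_null[OF w(1)] Ksub(2) by force
    show "(x \<oplus>\<^bsub>rm W\<^esub> y, r \<oplus> s) \<in> ?G" if xr: "(x, r) \<in> ?G" "(y, s) \<in> ?G" for x r y s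
    proof -
      have "r \<in> K" "s \<in> K" "x = r \<odot>\<^bsub>rm W\<^esub> w" "y = s \<odot>\<^bsub>rm W\<^esub> w" using xr by blast+
      then have "x \<oplus>\<^bsub>rm W\<^esub> y = (r \<oplus> s) \<odot>\<^bsub>rm W\<^esub> w" "r \<oplus> s \<in> K"
        using N.smult_l_distr[OF KR KR w(1)] Ksub(7) by simp_all
      then show ?thesis by blast
    qed
    show "(k \<odot>\<^bsub>rm W\<^esub> x, k \<otimes> r) \<in> ?G" if k: "k \<in> K" and xr: "(x, r) \<in> ?G" for k x r
    proof -
      have "r \<in> K" "x = r \<odot>\<^bsub>rm W\<^esub> w" using xr by blast+
      then have "k \<odot>\<^bsub>rm W\<^esub> x = (k \<otimes> r) \<odot>\<^bsub>rm W\<^esub> w" "k \<otimes> r \<in> K"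
        using N.smult_assoc1[OF KR KR w(1)] k Ksub(6) by simp_all
      then show ?thesis by blast
    qed
    show "k = \<zero>" if kz: "(\<zero>\<^bsub>rm W\<^esub>, k) \<in> ?G" for k
    proof (rule ccontr)
      assume nz: "k \<noteq> \<zero>"
      have k: "k \<in> K" "k \<odot>\<^bsub>rm W\<^esub> w = \<zero>\<^bsub>rm W\<^esub>" using kz by auto
      then obtain l where l: "l \<in> K" "l \<otimes> k = \<one>" using subfield_m_inv[OF K] nz by blast
      have "w = (l \<otimes> k) \<odot>\<^bsub>rm W\<^esub> w" unfolding l(2) using N.smult_one[OF w(1)] by simp
      also have "\<dots> = l \<odot>\<^bsub>rm W\<^esub> (k \<odot>\<^bsub>rm W\<^esub> w)" by (rule N.smult_assoc1[OF KR KR w(1)]) (use l k in auto)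
      also have "\<dots> = \<zero>\<^bsub>rm W\<^esub>" unfolding k(2) by (rule N.smult_r_null[OF KR[OF l(1)]])
      finally show False using w(2) by blast
    qed
  qed
  have "\<exists>\<phi>. \<phi> \<in> mcarrier W \<rightarrow> carrier R \<and>
      (\<forall>x\<in>mcarrier W. \<forall>y\<in>mcarrier W. \<phi> (madd W x y) = \<phi> x \<oplus> \<phi> y) \<and>
      (\<forall>x\<in>mcarrier W. \<forall>k\<in>K. \<phi> (mact W x (cst k)) = k \<otimes> \<phi> x) \<and> (\<forall>x r. (x, r) \<in> ?G \<longrightarrow> \<phi> x = r)"
    using N.extend_functional[OF K G] unfolding rm_simps .
  then obtain \<phi> where \<phi>: "\<phi> \<in> mcarrier W \<rightarrow> carrier R"
    "\<forall>x\<in>mcarrier W. \<forall>y\<in>mcarrier W. \<phi> (madd W x y) = \<phi> x \<oplus> \<phi> y"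
    "\<forall>x\<in>mcarrier W. \<forall>k\<in>K. \<phi> (mact W x (cst k)) = k \<otimes> \<phi> x" and \<phi>G: "\<forall>x r. (x, r) \<in> ?G \<longrightarrow> \<phi> x = r"
    by blast
  have "(\<one> \<odot>\<^bsub>rm W\<^esub> w, \<one>) \<in> ?G" using Ksub(3) by blast
  then have "\<phi> (\<one> \<odot>\<^bsub>rm W\<^esub> w) = \<one>" using \<phi>G by blast
  then have \<phi>w: "\<phi> w = \<one>" unfolding N.smult_one[OF w(1)] .
  define \<iota> where "\<iota> = (\<lambda>m. \<lambda>t\<in>carrier S. \<phi> (mact W m t))"
  have \<iota>l: "slinear W H \<iota>" unfolding \<iota>_def by (rule coinduced_map[OF WM \<phi>])
  note \<iota>lin = linear_image_vimage[OF WM H_rmodule \<iota>l]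
  have \<iota>act: "\<iota> (mact W m s) = mact H (\<iota> m) s" if "m \<in> mcarrier W" "s \<in> carrier S" for m s
    using \<iota>l that unfolding slinear_def by blast
  have Wsub: "submod S W (mcarrier W)" using Wsim unfolding simple_submod_def by blast
  have wc: "w \<in> mcarrier W" using w by simp
  have \<iota>w: "\<iota> w \<noteq> mzero H"
  proof
    assume "\<iota> w = mzero H"
    then have "\<iota> w \<one>\<^bsub>S\<^esub> = mzero H \<one>\<^bsub>S\<^esub>" by simp
    then have "\<one> = \<zero>" using \<phi>w WD(12)[OF wc] by (simp add: \<iota>_def H_ops)
    then show False using subfieldE(6)[OF K] by blast
  qed
  have pre: "{m \<in> mcarrier W. \<iota> m \<in> L} = {mzero W} \<or> {m \<in> mcarrier W. \<iota> m \<in> L} = mcarrier W"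
    if "submod S H L" for L
    using \<iota>lin(3)[OF that] Wsim unfolding simple_submod_def by blast
  have H0: "submod S H {mzero H}"
    using HN.zero_rsub HN.T_zero unfolding submod_iff_ssub[OF H_rmodule] HN.ssub_def by simp
  have \<iota>0: "m = mzero W" if "m \<in> mcarrier W" "\<iota> m = mzero H" for m
  proof -
    have "{m \<in> mcarrier W. \<iota> m \<in> {mzero H}} \<noteq> mcarrier W" using \<iota>w wc by blast
    then show ?thesis using pre[OF H0] that by blast
  qed
  define V where "V = \<iota> ` mcarrier W"
  have Vs: "submod S H V" unfolding V_def by (rule \<iota>lin(2)[OF Wsub])
  have Vsim: "L = {mzero H} \<or> L = V" if L: "submod S H L" "L \<subseteq> V" for L
    using pre[OF L(1)]
  proof
    have eq: "L = \<iota> ` {m \<in> mcarrier W. \<iota> m \<in> L}" using L(2) unfolding V_def by blast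
    show ?thesis if "{m \<in> mcarrier W. \<iota> m \<in> L} = {mzero W}"
      using eq \<iota>lin(1) unfolding that by simp
    show ?thesis if "{m \<in> mcarrier W. \<iota> m \<in> L} = mcarrier W"
      using eq unfolding that V_def by simp
  qed
  have Vnz: "V \<noteq> {mzero H}" using \<iota>w wc unfolding V_def by blast
  have Vfaith: "s = \<zero>\<^bsub>S\<^esub>" if s: "s \<in> carrier S" "\<forall>v\<in>V. mact H v s = mzero H" for s
  proof -
    have "mact W m s = mzero W" if m: "m \<in> mcarrier W" for m
      using \<iota>0[OF WD(8)[OF m s(1)]] \<iota>act[OF m s(1)] s(2) m unfolding V_def by simp
    then show ?thesis using W(2) s(1) unfolding faithful_def by blast
  qed
  obtain C where C: "submod S H C" "C \<inter> V \<subseteq> {mzero H}"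
    "\<forall>C'. submod S H C' \<longrightarrow> C \<subseteq> C' \<longrightarrow> C' \<inter> V \<subseteq> {mzero H} \<longrightarrow> C' = C"
    using exists_maximal_disjoint_submod[OF H0, of V] by blast
  obtain E where E: "submod S H E" "V \<subseteq> E" "E \<inter> C \<subseteq> {mzero H}"
    "\<forall>E'. submod S H E' \<longrightarrow> E \<subseteq> E' \<longrightarrow> E' \<inter> C \<subseteq> {mzero H} \<longrightarrow> E' = E"
    using exists_maximal_disjoint_submod[OF Vs, of C] C(2) by blast
  note CD = submodD[OF H_rmodule C(1)] and ED = submodD[OF H_rmodule E(1)]
  have CC: "x \<in> C \<Longrightarrow> x \<in> mcarrier H" and EC: "x \<in> E \<Longrightarrow> x \<in> mcarrier H" for x using CD(1) ED(1) by blast+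
  have one: "madd H f g \<one>\<^bsub>S\<^esub> = f \<one>\<^bsub>S\<^esub> \<oplus> g \<one>\<^bsub>S\<^esub>" for f g by (simp add: H_ops)
  \<comment> \<open>Evaluation at one of the \<open>E\<close>-component, well defined because
    \<open>E\<close> and \<open>C\<close> meet in zero. The map induced by an extension fixes
    \<open>E\<close> and kills \<open>C\<close>.\<close>
  let ?G' = "{(madd H e c, e \<one>\<^bsub>S\<^esub>) | e c. e \<in> E \<and> c \<in> C}"
  have G': "HN.functional_graph K ?G'"
    unfolding HN.functional_graph_def rm_simps
  proof (intro conjI allI impI)
    show "?G' \<subseteq> mcarrier H \<times> carrier R" using HD(3) EC CC H_carrierD(1) Sr.one_closed by blast
    have "(madd H (mzero H) (mzero H), mzero H \<one>\<^bsub>S\<^esub>) \<in> ?G'" using ED(2) CD(2) by blast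
    then show "(mzero H, \<zero>) \<in> ?G'" using HD(6)[OF HD(2)] by (simp add: H_ops)
    show "(madd H x y, r \<oplus> s) \<in> ?G'" if xr: "(x, r) \<in> ?G'" "(y, s) \<in> ?G'" for x r y s
    proof -
      obtain e c where ec: "e \<in> E" "c \<in> C" "x = madd H e c" "r = e \<one>\<^bsub>S\<^esub>" using xr(1) by blast
      obtain e' c' where ec': "e' \<in> E" "c' \<in> C" "y = madd H e' c'" "s = e' \<one>\<^bsub>S\<^esub>" using xr(2) by blast
      have cc: "e \<in> mcarrier H" "c \<in> mcarrier H" "e' \<in> mcarrier H" "c' \<in> mcarrier H"
        using ec ec' EC CC by auto
      have "madd H c (madd H e' c') = madd H e' (madd H c c')"
        using HD(4)[OF cc(2,3,4)] HD(4)[OF cc(3,2,4)] HD(5)[OF cc(2,3)] by simp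
      then have "madd H x y = madd H (madd H e e') (madd H c c')"
        unfolding ec(3) ec'(3)
        using HD(4)[OF cc(1,2) HD(3)[OF cc(3,4)]] HD(4)[OF cc(1,3) HD(3)[OF cc(2,4)]] by simp
      moreover have "r \<oplus> s = madd H e e' \<one>\<^bsub>S\<^esub>" unfolding one ec(4) ec'(4) ..
      ultimately show ?thesis using ED(3)[OF ec(1) ec'(1)] CD(3)[OF ec(2) ec'(2)] by blast
    qed
    show "(mact H x (cst k), k \<otimes> r) \<in> ?G'" if k: "k \<in> K" and xr: "(x, r) \<in> ?G'" for k x r
    proof -
      obtain e c where ec: "e \<in> E" "c \<in> C" "x = madd H e c" "r = e \<one>\<^bsub>S\<^esub>" using xr(1) by blast
      have kc: "cst k \<in> carrier S" using KR[OF k] by simp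
      have "mact H x (cst k) = madd H (mact H e (cst k)) (mact H c (cst k))"
        unfolding ec(3) by (rule HD(10)[OF EC[OF ec(1)] CC[OF ec(2)] kc])
      moreover have "k \<otimes> r = mact H e (cst k) \<one>\<^bsub>S\<^esub>"
        using H_carrierD(4)[OF EC[OF ec(1)] Sr.one_closed k] kc ec(4) by (simp add: H_ops)
      ultimately show ?thesis using ED(4)[OF ec(1) kc] CD(4)[OF ec(2) kc] by blast
    qed
    show "r = \<zero>" if zr: "(mzero H, r) \<in> ?G'" for r
    proof -
      obtain e c where ec: "e \<in> E" "c \<in> C" "mzero H = madd H e c" "r = e \<one>\<^bsub>S\<^esub>" using zr by blast
      have "madd H c e = mzero H" using ec(3) HD(5)[OF EC[OF ec(1)] CC[OF ec(2)]] by simp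
      then have "e \<in> C" by (rule CD(5)[OF ec(2) EC[OF ec(1)]])
      then have "e = mzero H" using E(3) ec(1) by blast
      then show ?thesis using ec(4) by (simp add: H_ops)
    qed
  qed
  have "\<exists>\<psi>. \<psi> \<in> mcarrier H \<rightarrow> carrier R \<and>
      (\<forall>x\<in>mcarrier H. \<forall>y\<in>mcarrier H. \<psi> (madd H x y) = \<psi> x \<oplus> \<psi> y) \<and>
      (\<forall>x\<in>mcarrier H. \<forall>k\<in>K. \<psi> (mact H x (cst k)) = k \<otimes> \<psi> x) \<and> (\<forall>x r. (x, r) \<in> ?G' \<longrightarrow> \<psi> x = r)"
    using HN.extend_functional[OF K G'] unfolding rm_simps .
  then obtain \<psi> where \<psi>: "\<psi> \<in> mcarrier H \<rightarrow> carrier R"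
    "\<forall>x\<in>mcarrier H. \<forall>y\<in>mcarrier H. \<psi> (madd H x y) = \<psi> x \<oplus> \<psi> y"
    "\<forall>x\<in>mcarrier H. \<forall>k\<in>K. \<psi> (mact H x (cst k)) = k \<otimes> \<psi> x" and \<psi>G: "\<forall>x r. (x, r) \<in> ?G' \<longrightarrow> \<psi> x = r"
    by blast
  define \<Psi> where "\<Psi> = (\<lambda>m. \<lambda>t\<in>carrier S. \<psi> (mact H m t))"
  have \<Psi>l: "slinear H H \<Psi>" unfolding \<Psi>_def by (rule coinduced_map[OF H_rmodule \<psi>])
  note \<Psi>lin = linear_image_vimage[OF H_rmodule H_rmodule \<Psi>l]
  have \<Psi>act: "\<Psi> (mact H m s) = mact H (\<Psi> m) s" if "m \<in> mcarrier H" "s \<in> carrier S" for m s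
    using \<Psi>l that unfolding slinear_def by blast
  have addz: "madd H x (mzero H) = x" if "x \<in> mcarrier H" for x
    using HD(5)[OF that HD(2)] HD(6)[OF that] by simp
  have \<Psi>E: "\<Psi> e = e" if e: "e \<in> E" for e
  proof (rule extensionalityI[of _ "carrier S"])
    show "\<Psi> e \<in> extensional (carrier S)" unfolding \<Psi>_def by simp
    show "e \<in> extensional (carrier S)" by (rule H_carrierD(2)[OF EC[OF e]])
    fix t assume t: "t \<in> carrier S"
    have et: "mact H e t \<in> E" by (rule ED(4)[OF e t])
    then have "(madd H (mact H e t) (mzero H), mact H e t \<one>\<^bsub>S\<^esub>) \<in> ?G'" using CD(2) by blast
    then have "\<psi> (madd H (mact H e t) (mzero H)) = mact H e t \<one>\<^bsub>S\<^esub>" using \<psi>G by blast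
    then have "\<psi> (mact H e t) = mact H e t \<one>\<^bsub>S\<^esub>" unfolding addz[OF EC[OF et]] .
    also have "\<dots> = e t" using t by (simp add: H_ops)
    finally show "\<Psi> e t = e t" unfolding \<Psi>_def using t by simp
  qed
  have \<Psi>C: "\<Psi> c = mzero H" if c: "c \<in> C" for c
  proof (rule extensionalityI[of _ "carrier S"])
    show "\<Psi> c \<in> extensional (carrier S)" unfolding \<Psi>_def by simp
    show "mzero H \<in> extensional (carrier S)" by (simp add: H_ops)
    fix t assume t: "t \<in> carrier S"
    have ct: "mact H c t \<in> C" by (rule CD(4)[OF c t])
    then have "(madd H (mzero H) (mact H c t), mzero H \<one>\<^bsub>S\<^esub>) \<in> ?G'" using ED(2) by blast
    then have "\<psi> (madd H (mzero H) (mact H c t)) = mzero H \<one>\<^bsub>S\<^esub>" using \<psi>G by blast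
    then have "\<psi> (mact H c t) = mzero H \<one>\<^bsub>S\<^esub>" unfolding HD(6)[OF CC[OF ct]] .
    then show "\<Psi> c t = mzero H t" unfolding \<Psi>_def using t by (simp add: H_ops)
  qed
  have Hs: "submod S H (mcarrier H)" unfolding submod_def using HD(2,3,8) by blast
  define Im where "Im = \<Psi> ` mcarrier H"
  have Ims: "submod S H Im" unfolding Im_def by (rule \<Psi>lin(2)[OF Hs])
  \<comment> \<open>The preimage of \<open>L\<close> under \<Psi> contains \<open>C\<close> and
    still misses \<open>V\<close>, since \<Psi> fixes \<open>V\<close>. By maximality it is
    \<open>C\<close>, which \<Psi> kills.\<close>
  have essI: "L \<subseteq> {mzero H}" if L: "submod S H L" "L \<subseteq> Im" "L \<inter> V \<subseteq> {mzero H}" for L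
  proof
    let ?C = "{m \<in> mcarrier H. \<Psi> m \<in> L}"
    have "C \<subseteq> ?C" using CC \<Psi>C submodD(2)[OF H_rmodule L(1)] by auto
    moreover have "?C \<inter> V \<subseteq> {mzero H}"
    proof
      fix v assume v: "v \<in> ?C \<inter> V"
      then have "\<Psi> v = v" using \<Psi>E E(2) by blast
      then have "v \<in> L \<inter> V" using v by simp
      then show "v \<in> {mzero H}" using L(3) by blast
    qed
    ultimately have eq: "?C = C" using C(3) \<Psi>lin(3)[OF L(1)] by blast
    fix x assume x: "x \<in> L"
    then obtain m where m: "m \<in> mcarrier H" "x = \<Psi> m" using L(2) unfolding Im_def by blast
    then have "m \<in> C" using x eq by blast
    then show "x \<in> {mzero H}" using \<Psi>C m(2) by simp
  qed
  have "submod S H (Im \<inter> C)"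
    using submodD[OF H_rmodule Ims] CD unfolding submod_def by simp blast
  then have "Im \<inter> C \<subseteq> {mzero H}" using essI[of "Im \<inter> C"] C(2) by blast
  moreover have "E \<subseteq> Im" unfolding Im_def using \<Psi>E EC by (metis image_eqI subsetI)
  \<comment> \<open>The image contains \<open>E\<close> and misses \<open>C\<close>, so maximality
    of \<open>E\<close> gives equality. Then \<Psi> is a retraction onto \<open>E\<close>, and it
    carries solutions of Baer's problem from \<open>H\<close> to \<open>E\<close>.\<close>
  ultimately have ImE: "Im = E" using E(4) Ims by blast
  let ?E = "H\<lparr>mcarrier := E\<rparr>"
  have "injective_module S ?E"
    unfolding injective_module_def
  proof (intro conjI allI impI)
    show "rmodule S ?E" by (rule rmodule_submod[OF H_rmodule E(1)])
    fix I f
    assume h: "right_ideal S I \<and> f \<in> I \<rightarrow> mcarrier ?E \<and>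
      (\<forall>a\<in>I. \<forall>b\<in>I. f (a \<oplus>\<^bsub>S\<^esub> b) = madd ?E (f a) (f b)) \<and>
      (\<forall>a\<in>I. \<forall>s\<in>carrier S. f (a \<otimes>\<^bsub>S\<^esub> s) = mact ?E (f a) s)"
    have fE: "f a \<in> E" if "a \<in> I" for a using h that by auto
    have "\<exists>e\<in>mcarrier H. \<forall>a\<in>I. f a = mact H e a"
      using h EC by (intro H_baer) auto
    then obtain e where e: "e \<in> mcarrier H" "\<forall>a\<in>I. f a = mact H e a" by blast
    have "f a = mact ?E (\<Psi> e) a" if a: "a \<in> I" for a
    proof -
      have "a \<in> carrier S" using h a unfolding right_ideal_def by blast
      then have "\<Psi> (f a) = mact H (\<Psi> e) a" using e a \<Psi>act[OF e(1)] by simp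
      then show ?thesis using \<Psi>E[OF fE[OF a]] by simp
    qed
    moreover have "\<Psi> e \<in> E" using e(1) ImE unfolding Im_def by blast
    ultimately show "\<exists>e\<in>mcarrier ?E. \<forall>a\<in>I. f a = mact ?E e a" by (intro bexI[of _ "\<Psi> e"]) auto
  qed
  moreover have "simple_submod S ?E V"
    unfolding simple_submod_def submod_submod_iff[OF E(1)] using Vs E(2) Vnz Vsim by auto
  moreover have "essential_submod S ?E V"
    unfolding essential_submod_def submod_submod_iff[OF E(1)]
  proof (intro conjI allI impI)
    fix L assume L: "(submod S H L \<and> L \<subseteq> E) \<and> L \<noteq> {mzero ?E}"
    then have "mzero H \<in> L" using submodD(2)[OF H_rmodule] by blast
    then show "L \<inter> V \<noteq> {mzero ?E}" using essI[of L] L ImE by auto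
  qed (use Vs E(2) in auto)
  moreover have "\<forall>s\<in>carrier S. (\<forall>v\<in>V. mact ?E v s = mzero ?E) \<longrightarrow> s = \<zero>\<^bsub>S\<^esub>"
    using Vfaith by simp
  ultimately show ?thesis by blast
qed

end

text \<open>Transport of structure: a module on the smaller type is copied along \<open>enc\<close>,
  and the submodules of the copy are exactly the images. Read contrapositively, failure on a type
  passes to every type into which it injects.\<close>

lemma diamond_inj_transfer:
  fixes enc :: "'m \<Rightarrow> 'n"
  assumes inj: "inj enc" and dia: "diamond S TYPE('n)"
  shows "diamond S TYPE('m)"
  unfolding diamond_def
proof (intro allI impI, elim conjE)
  fix E :: "('a, 'm) rmod" and V N
  assume h: "injective_module S E" "simple_submod S E V" "essential_submod S E V" "fin_gen_submod S E N"
  define dec where "dec = the_inv enc"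
  have dec [simp]: "dec (enc x) = x" for x unfolding dec_def using inj by (rule the_inv_f_f)
  define E' where "E' = \<lparr>mcarrier = enc ` mcarrier E, madd = (\<lambda>x y. enc (madd E (dec x) (dec y))),
    mzero = enc (mzero E), mact = (\<lambda>x s. enc (mact E (dec x) s))\<rparr>"
  have E' [simp]: "mcarrier E' = enc ` mcarrier E" "madd E' x y = enc (madd E (dec x) (dec y))"
    "mzero E' = enc (mzero E)" "mact E' x s = enc (mact E (dec x) s)" for x y s
    unfolding E'_def by simp_all
  have eq [simp]: "enc x = enc y \<longleftrightarrow> x = y" for x y using inj by (simp add: inj_eq)
  have sub: "submod S E' (enc ` L) \<longleftrightarrow> submod S E L" for L
    unfolding submod_def by (auto simp: inj_image_mem_iff[OF inj])
  have img: "\<exists>L. L' = enc ` L" if "submod S E' L'" for L'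
    using that unfolding submod_def by (auto simp: subset_image_iff)
  have E: "rmodule S E" using h(1) unfolding injective_module_def by blast
  note D = rmoduleD[OF E]
  have "rmodule S E'"
    unfolding rmodule_def
  proof (intro conjI ballI)
    show "madd E' x y = madd E' y x" if "x \<in> mcarrier E'" "y \<in> mcarrier E'" for x y
      using that D(5) by auto
    show "\<exists>y\<in>mcarrier E'. madd E' x y = mzero E'" if "x \<in> mcarrier E'" for x
      using that D(7) by auto
  qed (use D(1-4,6,8-12) in auto)
  moreover have "\<exists>e\<in>mcarrier E'. \<forall>a\<in>I. f a = mact E' e a"
    if f: "right_ideal S I" "f \<in> I \<rightarrow> mcarrier E'"
      "\<forall>a\<in>I. \<forall>b\<in>I. f (a \<oplus>\<^bsub>S\<^esub> b) = madd E' (f a) (f b)"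
      "\<forall>a\<in>I. \<forall>s\<in>carrier S. f (a \<otimes>\<^bsub>S\<^esub> s) = mact E' (f a) s" for I f
  proof -
    have fe: "dec (f a) \<in> mcarrier E" "enc (dec (f a)) = f a" if "a \<in> I" for a
    proof -
      have "f a \<in> enc ` mcarrier E" using f(2)[unfolded E'(1)] that by blast
      then show "dec (f a) \<in> mcarrier E" "enc (dec (f a)) = f a" by auto
    qed
    have "\<exists>e\<in>mcarrier E. \<forall>a\<in>I. (\<lambda>a. dec (f a)) a = mact E e a"
    proof (rule h(1)[unfolded injective_module_def, THEN conjunct2, rule_format], intro conjI ballI)
      show "right_ideal S I" by (rule f(1))
      show "(\<lambda>a. dec (f a)) \<in> I \<rightarrow> mcarrier E" using fe by blast
      show "dec (f (a \<oplus>\<^bsub>S\<^esub> b)) = madd E (dec (f a)) (dec (f b))" if "a \<in> I" "b \<in> I" for a b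
        using f(3) that by simp
      show "dec (f (a \<otimes>\<^bsub>S\<^esub> s)) = mact E (dec (f a)) s" if "a \<in> I" "s \<in> carrier S" for a s
        using f(4) that by simp
    qed
    then obtain e where e: "e \<in> mcarrier E" "\<forall>a\<in>I. dec (f a) = mact E e a" by blast
    then have "f a = mact E' (enc e) a" if "a \<in> I" for a using fe(2)[OF that] that by simp
    then show ?thesis using e(1) unfolding E'(1) by blast
  qed
  ultimately have "injective_module S E'" unfolding injective_module_def by blast
  moreover have "simple_submod S E' (enc ` V)"
    unfolding simple_submod_def
  proof (intro conjI allI impI)
    show "submod S E' (enc ` V)" using h(2) sub unfolding simple_submod_def by blast
    show "enc ` V \<noteq> {mzero E'}"
      using h(2) inj_image_eq_iff[OF inj, of V "{mzero E}"] unfolding simple_submod_def by simp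
    fix L' assume L': "submod S E' L' \<and> L' \<subseteq> enc ` V"
    then obtain L where L: "L' = enc ` L" using img by blast
    then have "submod S E L" "L \<subseteq> V" using L' sub inj by (auto simp: inj_image_subset_iff)
    then have "L = {mzero E} \<or> L = V" using h(2) unfolding simple_submod_def by blast
    then show "L' = {mzero E'} \<or> L' = enc ` V" using L by auto
  qed
  moreover have "essential_submod S E' (enc ` V)"
    unfolding essential_submod_def
  proof (intro conjI allI impI)
    show "submod S E' (enc ` V)" using h(2) sub unfolding simple_submod_def by blast
    fix L' assume L': "submod S E' L' \<and> L' \<noteq> {mzero E'}"
    then obtain L where L: "L' = enc ` L" using img by blast
    then have "submod S E L" "L \<noteq> {mzero E}" using L' sub by auto
    then have "L \<inter> V \<noteq> {mzero E}" using h(3) unfolding essential_submod_def by blast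
    then have "enc ` (L \<inter> V) \<noteq> enc ` {mzero E}" unfolding inj_image_eq_iff[OF inj] .
    then show "L' \<inter> enc ` V \<noteq> {mzero E'}" unfolding L image_Int[OF inj] by simp
  qed
  moreover have "fin_gen_submod S E' (enc ` N)"
  proof -
    obtain A where A: "finite A" "A \<subseteq> N" "\<forall>L. submod S E L \<and> A \<subseteq> L \<longrightarrow> N \<subseteq> L" "submod S E N"
      using h(4) unfolding fin_gen_submod_def by blast
    have "enc ` N \<subseteq> L'" if L': "submod S E' L'" "enc ` A \<subseteq> L'" for L'
    proof -
      obtain L where L: "L' = enc ` L" using img[OF L'(1)] by blast
      then have "submod S E L" "A \<subseteq> L" using L' sub inj by (auto simp: inj_image_subset_iff)
      then show ?thesis using A(3) L by blast
    qed
    then show ?thesis unfolding fin_gen_submod_def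
      using A sub by (intro conjI exI[of _ "enc ` A"]) auto
  qed
  ultimately have art: "artinian_submod S E' (enc ` N)" using dia unfolding diamond_def by blast
  show "artinian_submod S E N"
    unfolding artinian_submod_def
  proof
    assume "\<exists>C :: nat \<Rightarrow> 'm set. \<forall>i. submod S E (C i) \<and> C i \<subseteq> N \<and> C (Suc i) \<subset> C i"
    then obtain C :: "nat \<Rightarrow> 'm set" where C: "\<forall>i. submod S E (C i) \<and> C i \<subseteq> N \<and> C (Suc i) \<subset> C i" by blast
    have "submod S E' (enc ` C i) \<and> enc ` C i \<subseteq> enc ` N \<and> enc ` C (Suc i) \<subset> enc ` C i" for i
      using C sub inj by (simp add: image_strict_mono inj_on_subset image_mono)
    then have "\<exists>C'. \<forall>i. submod S E' (C' i) \<and> C' i \<subseteq> enc ` N \<and> C' (Suc i) \<subset> C' i"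
      by (intro exI[of _ "\<lambda>i. enc ` C i"] allI)
    then show False using art unfolding artinian_submod_def by blast
  qed
qed

text \<open>A sequence is a head together with a tail, so \<open>h\<close> can be encoded by its
  graph: the sequences whose head is \<open>h\<close> of their tail. Prepending \<open>g s\<close>
  to \<open>s\<close> recovers the value at \<open>s\<close>.\<close>

lemma inj_function_encoding:
  "inj (\<lambda>(h :: (nat \<Rightarrow> 'a) \<Rightarrow> 'a). {f :: nat \<Rightarrow> 'a. f 0 = h (\<lambda>n. f (Suc n))})"
proof (rule injI, rule ext)
  fix g h :: "(nat \<Rightarrow> 'a) \<Rightarrow> 'a" and s
  assume "{f. f 0 = g (\<lambda>n. f (Suc n))} = {f. f 0 = h (\<lambda>n. f (Suc n))}"
  moreover have "case_nat (g s) s \<in> {f. f 0 = g (\<lambda>n. f (Suc n))}" by simp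
  ultimately have "case_nat (g s) s \<in> {f. f 0 = h (\<lambda>n. f (Suc n))}" by blast
  then show "g s = h s" by simp
qed

theorem theorem5p4:
  fixes R :: "'a ring" and \<alpha> :: "'a \<Rightarrow> 'a"
    and W :: "(nat \<Rightarrow> 'a, 'w) rmod"
  assumes "cring R" and "noetherian_ring R"
    and "\<alpha> \<in> ring_iso R R"
    and "simple_module (skew_poly_ring R \<alpha>) W"
    and "faithful (skew_poly_ring R \<alpha>) W"
  shows "(krull_dim_zero R \<longrightarrow> diamond (skew_poly_ring R \<alpha>) TYPE('m))
       \<and> ((\<exists>K. subfield K R \<and> uncountable K) \<and>
            (krull_dim_ge R 2 \<or> uncountable {P. primeideal P R})
          \<longrightarrow> \<not> diamond (skew_poly_ring R \<alpha>) TYPE((nat \<Rightarrow> 'a) set))"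
proof -
  interpret automorphism_ring R \<alpha>
    using assms(1-3) by (simp add: automorphism_ring_def automorphism_ring_axioms_def noetherian_cring_def)
  show ?thesis
  proof (intro conjI impI)
    assume "krull_dim_zero R"
    then show "diamond (skew_poly_ring R \<alpha>) TYPE('m)" by (rule diamond_dimension_zero[OF assms(4,5)])
  next
    assume h: "(\<exists>K. subfield K R \<and> uncountable K) \<and> (krull_dim_ge R 2 \<or> uncountable {P. primeideal P R})"
    then obtain K where sub: "subfield K R" "uncountable K" by blast
    have "ring (skew_poly_ring R \<alpha>)" using assms(4) unfolding simple_module_def rmodule_def by blast
    then interpret coinduced R \<alpha> K
      using sub(1) automorphism_ring_axioms by (simp add: coinduced_def coinduced_axioms_def)
    obtain E :: "(nat \<Rightarrow> 'a, (nat \<Rightarrow> 'a) \<Rightarrow> 'a) rmod" and V where EV: "injective_module S E"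
      "simple_submod S E V" "essential_submod S E V"
      and faith: "\<forall>s\<in>carrier S. (\<forall>v\<in>V. mact E v s = mzero E) \<longrightarrow> s = \<zero>\<^bsub>S\<^esub>"
      using exists_injective_hull[OF assms(4,5)] by blast
    have "\<exists>N. fin_gen_submod S E N \<and> \<not> artinian_submod S E N"
      using h faith by (intro exists_cyclic_not_artinian[OF EV _ sub]) auto
    then have "\<not> diamond S TYPE((nat \<Rightarrow> 'a) \<Rightarrow> 'a)" unfolding diamond_def using EV by blast
    then show "\<not> diamond (skew_poly_ring R \<alpha>) TYPE((nat \<Rightarrow> 'a) set)"
      using diamond_inj_transfer[OF inj_function_encoding] by blast
  qed
qed

end
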